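(* Let $K$ be a bounded self-adjoint locally trace class operator on $L^2(E,\mu)$ with $\mathrm{spec}(K)\subset[0,1]$. Let $B\subset E$ be a bounded Borel subset and let $Q$ be an orthogonal projection acting in $L^2(E,\mu)$ such that $\mathrm{Ran}(Q)\subset L^2(E\setminus B,\mu)$ and the operator $QKQ$ is locally trace class. Then for $\mathbb{P}_K$-almost every $X\in\mathrm{Conf}(E)$, $$\Big((Q+\chi_B)K(Q+\chi_B)\Big)^{[X,B]}=(Q+\chi_B)K^{[X,B]}(Q+\chi_B)=QK^{[X,B]}Q.$$
   Context: **Setting.** $E$ is a locally compact $\sigma$-compact Polish space with a metric for which every bounded set is relatively compact, and $\mu$ is a positive $\sigma$-finite Radon measure on $E$. $\mathrm{Conf}(E)$ is the space of locally finite configurations on $E$ (locally finite countable subsets, possibly with multiplicities) with the Borel structure of the vague topology under $X\mapsto\sum_{x\in X}\delta_x$. A point process is a Borel probability measure on $\mathrm{Conf}(E)$. $\chi_B$ denotes the indicator of $B$ and the corresponding multiplication operator. An operator $T$ on the complex Hilbert space $L^2(E,\mu)$ is locally trace class if $\chi_BT\chi_B$ is trace class for every bounded Borel $B$. For $K$ bounded self-adjoint locally trace class with spectrum in $[0,1]$, $\mathbb{P}_K$ is the unique point process with $\mathbb{E}_{\mathbb{P}_K}[\prod_{x\in X}(1+g(x))]=\det(1+\mathrm{sgn}(g)|g|^{1/2}K|g|^{1/2})$ (Fredholm determinant, $\mathrm{sgn}(g)=g/|g|$) for every compactly supported bounded measurable $g:E\to\mathbb{C}$. **Kernel.** For each such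 operator $K$ one fixes a Borel $E_0\subset E$ with $\mu(E\setminus E_0)=0$ and a Borel function $K:E_0\times E_0\to\mathbb{C}$, an integral kernel of $K$, such that $\mathrm{tr}((\chi_BK\chi_B)^k)=\int_{B^k}K(x_1,x_2)\cdots K(x_k,x_1)\,d\mu(x_1)\cdots d\mu(x_k)$ for all $k\in\mathbb{N}$ and bounded Borel $B$. **Canonical conditional kernels** (the operation $K\mapsto K^{[X,B]}$, applied to any such operator). For $p_1,\dots,p_n\in E_0$ and $x,y\in E_0$, put $p_0=x$, $q_0=y$, $q_i=p_i$ ($1\le i\le n$) and $$K^{p_1,\dots,p_n}(x,y)=\frac{\det[K(p_i,q_j)]_{0\le i,j\le n}}{\det[K(p_i,p_j)]_{1\le i,j\le n}}$$ if the denominator is $>0$, and $K^{p_1,\dots,p_n}(x,y)=0$ if it is $0$ (and $K^{\emptyset}=K$); the same symbol denotes the integral operator. For bounded Borel $B\subset E$ and $X\in\mathrm{Conf}(E)$ with $X\cap B=\{p_1,\dots,p_l\}\subset E_0$, $$K^{[X,B]}=\chi_{E\setminus B}K^{p_1,\dots,p_l}(1-\chi_BK^{p_1,\dots,p_l})^{-1}\chi_{E\setminus B}$$ if $1-\chi_BK^{p_1,\dots,p_l}$ is invertible, and $K^{[X,B]}=0$ otherwise. The operator $(Q+\chi_B)K(Q+\chi_B)$ in the claim is a positive contraction and locally trace class, so the operation applies to it. *)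

theory Defs
  imports
    "HOL-Probability.Probability"
    "HOL-Library.Function_Algebras"
    "Jordan_Normal_Form.Determinant"
begin

text \<open>
  The ground space is a type of class heine_borel (bounded sets are relatively compact) and
  polish_space; local compactness and sigma-compactness follow from these.
\<close>

definition radon_measure :: "'a::topological_space measure \<Rightarrow> bool" where
  "radon_measure \<mu> \<longleftrightarrow>
     sets \<mu> = sets borel \<and>
     (\<forall>C. compact C \<longrightarrow> emeasure \<mu> C < \<infinity>) \<and>
     (\<forall>A\<in>sets borel. emeasure \<mu> A = (SUP C\<in>{C. compact C \<and> C \<subseteq> A}. emeasure \<mu> C))"


section \<open>The Hilbert space of square-integrable functions and its operators\<close>

text \<open>
  Vectors are represented by square-integrable functions, and two of them are the same vector iff
  they agree almost everywhere. An operator is a map on functions; only its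
  values on square-integrable functions, up to almost everywhere equality, are relevant.
  Sums and differences of operators are the pointwise ones of Function_Algebras.
\<close>

definition L2 :: "'a measure \<Rightarrow> ('a \<Rightarrow> complex) set" where
  "L2 \<mu> = {f \<in> borel_measurable \<mu>. integrable \<mu> (\<lambda>x. (cmod (f x))\<^sup>2)}"

definition l2_inner :: "'a measure \<Rightarrow> ('a \<Rightarrow> complex) \<Rightarrow> ('a \<Rightarrow> complex) \<Rightarrow> complex" where
  "l2_inner \<mu> f g = (\<integral>x. f x * cnj (g x) \<partial>\<mu>)"

definition l2_norm :: "'a measure \<Rightarrow> ('a \<Rightarrow> complex) \<Rightarrow> real" where
  "l2_norm \<mu> f = sqrt (\<integral>x. (cmod (f x))\<^sup>2 \<partial>\<mu>)"

type_synonym 'a operator = "('a \<Rightarrow> complex) \<Rightarrow> ('a \<Rightarrow> complex)"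

definition op_eq :: "'a measure \<Rightarrow> 'a operator \<Rightarrow> 'a operator \<Rightarrow> bool" where
  "op_eq \<mu> S T \<longleftrightarrow> (\<forall>f\<in>L2 \<mu>. AE x in \<mu>. S f x = T f x)"

text \<open>
  Compatibility with almost everywhere equality is a consequence of linearity and boundedness.
\<close>

definition bounded_op :: "'a measure \<Rightarrow> 'a operator \<Rightarrow> bool" where
  "bounded_op \<mu> T \<longleftrightarrow>
     (\<forall>f\<in>L2 \<mu>. T f \<in> L2 \<mu>) \<and>
     (\<forall>f\<in>L2 \<mu>. \<forall>g\<in>L2 \<mu>. AE x in \<mu>. T (\<lambda>y. f y + g y) x = T f x + T g x) \<and>
     (\<forall>f\<in>L2 \<mu>. \<forall>c. AE x in \<mu>. T (\<lambda>y. c * f y) x = c * T f x) \<and>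
     (\<exists>C. \<forall>f\<in>L2 \<mu>. l2_norm \<mu> (T f) \<le> C * l2_norm \<mu> f)"

definition self_adjoint_op :: "'a measure \<Rightarrow> 'a operator \<Rightarrow> bool" where
  "self_adjoint_op \<mu> T \<longleftrightarrow>
     bounded_op \<mu> T \<and> (\<forall>f\<in>L2 \<mu>. \<forall>g\<in>L2 \<mu>. l2_inner \<mu> (T f) g = l2_inner \<mu> f (T g))"

definition positive_op :: "'a measure \<Rightarrow> 'a operator \<Rightarrow> bool" where
  "positive_op \<mu> T \<longleftrightarrow>
     self_adjoint_op \<mu> T \<and> (\<forall>f\<in>L2 \<mu>. 0 \<le> Re (l2_inner \<mu> (T f) f))"

definition orthogonal_projection :: "'a measure \<Rightarrow> 'a operator \<Rightarrow> bool" where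
  "orthogonal_projection \<mu> Q \<longleftrightarrow> self_adjoint_op \<mu> Q \<and> op_eq \<mu> (Q \<circ> Q) Q"

definition is_inverse_op :: "'a measure \<Rightarrow> 'a operator \<Rightarrow> 'a operator \<Rightarrow> bool" where
  "is_inverse_op \<mu> T S \<longleftrightarrow>
     bounded_op \<mu> S \<and> op_eq \<mu> (S \<circ> T) id \<and> op_eq \<mu> (T \<circ> S) id"

definition invertible_op :: "'a measure \<Rightarrow> 'a operator \<Rightarrow> bool" where
  "invertible_op \<mu> T \<longleftrightarrow> bounded_op \<mu> T \<and> (\<exists>S. is_inverse_op \<mu> T S)"

definition inverse_op :: "'a measure \<Rightarrow> 'a operator \<Rightarrow> 'a operator" where
  "inverse_op \<mu> T = (SOME S. is_inverse_op \<mu> T S)"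

definition mult_op :: "('a \<Rightarrow> complex) \<Rightarrow> 'a operator" where
  "mult_op h f = (\<lambda>x. h x * f x)"

definition chi :: "'a set \<Rightarrow> 'a operator" where
  "chi B = mult_op (indicator B)"

definition op_spectrum :: "'a measure \<Rightarrow> 'a operator \<Rightarrow> complex set" where
  "op_spectrum \<mu> T = {z. \<not> invertible_op \<mu> (mult_op (\<lambda>_. z) - T)}"


section \<open>Trace class, trace, Fredholm determinant\<close>

definition orthonormal_basis :: "'a measure \<Rightarrow> ('a \<Rightarrow> complex) set \<Rightarrow> bool" where
  "orthonormal_basis \<mu> A \<longleftrightarrow>
     A \<subseteq> L2 \<mu> \<and>
     (\<forall>e\<in>A. \<forall>e'\<in>A. l2_inner \<mu> e e' = (if e = e' then 1 else 0)) \<and>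
     (\<forall>f\<in>L2 \<mu>. (\<forall>e\<in>A. l2_inner \<mu> f e = 0) \<longrightarrow> (AE x in \<mu>. f x = 0))"

text \<open>The notions below do not depend on the choice of the basis.\<close>

definition l2_basis :: "'a measure \<Rightarrow> ('a \<Rightarrow> complex) set" where
  "l2_basis \<mu> = (SOME A. orthonormal_basis \<mu> A)"

text \<open>The operator S is the absolute value of T, i.e. the positive square root of T*T.\<close>

definition is_abs_op :: "'a measure \<Rightarrow> 'a operator \<Rightarrow> 'a operator \<Rightarrow> bool" where
  "is_abs_op \<mu> T S \<longleftrightarrow>
     positive_op \<mu> S \<and>
     (\<forall>f\<in>L2 \<mu>. \<forall>g\<in>L2 \<mu>. l2_inner \<mu> (S (S f)) g = l2_inner \<mu> (T f) (T g))"

definition trace_class :: "'a measure \<Rightarrow> 'a operator \<Rightarrow> bool" where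
  "trace_class \<mu> T \<longleftrightarrow>
     bounded_op \<mu> T \<and>
     (\<exists>S. is_abs_op \<mu> T S \<and> (\<lambda>e. Re (l2_inner \<mu> (S e) e)) summable_on l2_basis \<mu>)"

definition op_trace :: "'a measure \<Rightarrow> 'a operator \<Rightarrow> complex" where
  "op_trace \<mu> T = (\<Sum>\<^sub>\<infinity>e\<in>l2_basis \<mu>. l2_inner \<mu> (T e) e)"

definition locally_trace_class :: "'a::metric_space measure \<Rightarrow> 'a operator \<Rightarrow> bool" where
  "locally_trace_class \<mu> T \<longleftrightarrow>
     (\<forall>B\<in>sets borel. bounded B \<longrightarrow> trace_class \<mu> (chi B \<circ> T \<circ> chi B))"

text \<open>
  The trace of the n-th exterior power of T, computed in the orthonormal basis of vectors
  e_1 \<and> ... \<and> e_n. The sum runs over all n-tuples of basis vectors, so each such vector is counted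
  n! times; tuples with a repetition contribute 0.
\<close>

definition trace_ext_power :: "'a measure \<Rightarrow> nat \<Rightarrow> 'a operator \<Rightarrow> complex" where
  "trace_ext_power \<mu> n T =
     (\<Sum>\<^sub>\<infinity>es\<in>{es. length es = n \<and> set es \<subseteq> l2_basis \<mu>}.
        Determinant.det (Matrix.mat n n (\<lambda>(i, j). l2_inner \<mu> (T (es ! j)) (es ! i)))) / fact n"

text \<open>The Fredholm determinant det(1 + T).\<close>

definition fredholm_det :: "'a measure \<Rightarrow> 'a operator \<Rightarrow> complex" where
  "fredholm_det \<mu> T = (\<Sum>n. trace_ext_power \<mu> n T)"


section \<open>Configurations and determinantal point processes\<close>

text \<open>A configuration is given by the multiplicities of its points.\<close>

definition Conf :: "('a::metric_space \<Rightarrow> nat) set" where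
  "Conf = {X. \<forall>B. bounded B \<longrightarrow> finite {x\<in>B. X x \<noteq> 0}}"

definition vague_topology :: "('a::metric_space \<Rightarrow> nat) topology" where
  "vague_topology = topology_generated_by
     {{X\<in>Conf. (\<Sum>x | X x \<noteq> 0 \<and> f x \<noteq> 0. real (X x) * f x) \<in> U} | (f :: 'a \<Rightarrow> real) U.
        continuous_on UNIV f \<and> (\<exists>C. compact C \<and> (\<forall>x. x \<notin> C \<longrightarrow> f x = 0)) \<and> open U}"

definition conf_borel :: "('a::metric_space \<Rightarrow> nat) measure" where
  "conf_borel = sigma Conf {V. openin vague_topology V}"

definition point_process :: "('a::metric_space \<Rightarrow> nat) measure \<Rightarrow> bool" where
  "point_process P \<longleftrightarrow> prob_space P \<and> space P = Conf \<and> sets P = sets conf_borel"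

definition conf_prod :: "('a \<Rightarrow> complex) \<Rightarrow> ('a \<Rightarrow> nat) \<Rightarrow> complex" where
  "conf_prod g X = (\<Prod>x | X x \<noteq> 0 \<and> g x \<noteq> 0. (1 + g x) ^ X x)"

definition determinantal_process ::
    "'a::metric_space measure \<Rightarrow> 'a operator \<Rightarrow> ('a \<Rightarrow> nat) measure \<Rightarrow> bool" where
  "determinantal_process \<mu> K P \<longleftrightarrow>
     point_process P \<and>
     (\<forall>g :: 'a \<Rightarrow> complex.
        g \<in> borel_measurable borel \<and> bounded (range g) \<and>
        (\<exists>C. compact C \<and> (\<forall>x. x \<notin> C \<longrightarrow> g x = 0)) \<longrightarrow>
        integrable P (conf_prod g) \<and>
        (\<integral>X. conf_prod g X \<partial>P) =
          fredholm_det \<mu> (mult_op (\<lambda>x. sgn (g x) * complex_of_real (sqrt (cmod (g x)))) \<circ> K \<circ>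
                          mult_op (\<lambda>x. complex_of_real (sqrt (cmod (g x))))))"


section \<open>Kernels and canonical conditional kernels\<close>

text \<open>A kernel k is only meaningful on E0; the integral operator vanishes off E0.\<close>

definition integral_op :: "'a measure \<Rightarrow> 'a set \<Rightarrow> ('a \<Rightarrow> 'a \<Rightarrow> complex) \<Rightarrow> 'a operator" where
  "integral_op \<mu> E0 k f =
     (\<lambda>x. if x \<in> E0 then set_lebesgue_integral \<mu> E0 (\<lambda>y. k x y * f y) else 0)"

text \<open>
  Integrability is part of the requirement that an integral represents the operator or its traces.
  Since the kernel lives on E0 and the complement of E0 is a null set, the integrals over powers of
  B are taken over powers of \<open>B \<inter> E0\<close>.
\<close>

definition admissible_kernel ::
    "'a::metric_space measure \<Rightarrow> 'a operator \<Rightarrow> 'a set \<Rightarrow> ('a \<Rightarrow> 'a \<Rightarrow> complex) \<Rightarrow> bool" where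
  "admissible_kernel \<mu> T E0 k \<longleftrightarrow>
     E0 \<in> sets borel \<and> emeasure \<mu> (- E0) = 0 \<and>
     (\<lambda>(x, y). k x y) \<in> borel_measurable (restrict_space borel (E0 \<times> E0)) \<and>
     (\<forall>f\<in>L2 \<mu>. AE x in \<mu>. set_integrable \<mu> E0 (\<lambda>y. k x y * f y)) \<and>
     op_eq \<mu> T (integral_op \<mu> E0 k) \<and>
     (\<forall>n B. 1 \<le> n \<and> B \<in> sets borel \<and> bounded B \<longrightarrow>
        set_integrable (\<Pi>\<^sub>M i\<in>{..<n}. \<mu>) (\<Pi>\<^sub>E i\<in>{..<n}. B \<inter> E0)
          (\<lambda>x. \<Prod>i<n. k (x i) (x (Suc i mod n))) \<and>
        op_trace \<mu> ((chi B \<circ> T \<circ> chi B) ^^ n) =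
          set_lebesgue_integral (\<Pi>\<^sub>M i\<in>{..<n}. \<mu>) (\<Pi>\<^sub>E i\<in>{..<n}. B \<inter> E0)
            (\<lambda>x. \<Prod>i<n. k (x i) (x (Suc i mod n))))"

definition kernel_det :: "('a \<Rightarrow> 'a \<Rightarrow> complex) \<Rightarrow> 'a list \<Rightarrow> 'a list \<Rightarrow> complex" where
  "kernel_det k ps qs =
     Determinant.det (Matrix.mat (length ps) (length ps) (\<lambda>(i, j). k (ps ! i) (qs ! j)))"

definition palm_kernel ::
    "('a \<Rightarrow> 'a \<Rightarrow> complex) \<Rightarrow> 'a list \<Rightarrow> 'a \<Rightarrow> 'a \<Rightarrow> complex" where
  "palm_kernel k ps x y =
     (if kernel_det k ps ps \<in> \<real> \<and> 0 < Re (kernel_det k ps ps)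
      then kernel_det k (x # ps) (y # ps) / kernel_det k ps ps
      else 0)"

definition enumerates :: "'a list \<Rightarrow> ('a \<Rightarrow> nat) \<Rightarrow> 'a set \<Rightarrow> bool" where
  "enumerates ps X B \<longleftrightarrow> (\<forall>x. count_list ps x = (if x \<in> B then X x else 0))"

text \<open>
  The choice of the enumeration is immaterial because \<^const>\<open>palm_kernel\<close> is symmetric in the
  points. Configurations having points in B outside E0, for which the conditional kernel has no
  meaning, get the value 0.
\<close>

definition conditional_op ::
    "'a measure \<Rightarrow> 'a set \<Rightarrow> ('a \<Rightarrow> 'a \<Rightarrow> complex) \<Rightarrow> ('a \<Rightarrow> nat) \<Rightarrow> 'a set \<Rightarrow> 'a operator" where
  "conditional_op \<mu> E0 k X B =
     (let ps = (SOME ps. enumerates ps X B);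
          Kp = integral_op \<mu> E0 (palm_kernel k ps);
          R = id - (chi B \<circ> Kp)
      in if set ps \<subseteq> E0 \<and> invertible_op \<mu> R
         then chi (- B) \<circ> Kp \<circ> inverse_op \<mu> R \<circ> chi (- B)
         else 0)"

end

theory Submission
  imports Defs
begin

text \<open>
  Put \<open>W = Q + chi B\<close>, so that the second operator is \<open>W K W\<close>. As W is the identity on functions
  supported in B, the two kernels agree at almost every pair of points of B and, by the trace formula,
  at almost every point of the diagonal over B; moreover, for almost every p in B, the p-th row of the
  second kernel is the image under W of the p-th row of the first, which is square-integrable because
  \<open>K \<circ> chi B\<close> is a Hilbert-Schmidt operator.

  Almost surely these exceptional sets are not met by the configuration. For pairs of distinct points
  this follows from the bound \<open>tr A1 * tr A2\<close> for the probability of having points in each of two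
  disjoint sets A1 and A2, which is read off the expansion of the Fredholm determinants to second
  order at \<open>s = 0\<close>.

  Consequently the Palm operators, which are finite-rank perturbations of K and \<open>W K W\<close> with the same
  coefficients, satisfy \<open>A1 = W A W\<close>, and the claim reduces to the resolvent identity
  \<open>(1 - U W)\<^sup>-\<^sup>1 = 1 + U (1 - W U)\<^sup>-\<^sup>1 W\<close> for \<open>U = chi B A = W U\<close>.
\<close>

text \<open>The conditional operators depend on values of \<open>k\<close> and \<open>k1\<close> at
  finitely many random points, while the operators determine these kernels only up to null sets. A
  determinant over any number of points uses its kernel only through the entries at pairs, so it
  suffices to control single points and pairs; a second-order expansion of the Fredholm determinants
  is therefore enough and no higher correlation functions occur. The diagonal is a separate matter:
  it may be a null set of the product, so agreement at almost every pair says nothing about it, and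
  only the trace formula with \<open>n = 1\<close> does. Two features of the setting shape the
  analytic part. Infinite sums default to 0 when they diverge, so traces carry information only
  after summability has been proved; as trace class is stated through the absolute value, this needs
  the comparison of a positive operator with its absolute value. And vectors are functions, so each
  change of representative has to be justified by boundedness.\<close>

section \<open>Square-integrable functions\<close>

lemma L2_iff: "f \<in> L2 M \<longleftrightarrow> f \<in> borel_measurable M \<and> integrable M (\<lambda>x. (cmod (f x))\<^sup>2)"
  by (simp add: L2_def)

lemma L2_measurable [measurable_dest]: "f \<in> L2 M \<Longrightarrow> f \<in> borel_measurable M"
  by (simp add: L2_def)

lemma borel_measurable_cnj [measurable (raw)]:
  "f \<in> borel_measurable M \<Longrightarrow> (\<lambda>x. cnj (f x)) \<in> borel_measurable M"
  by (rule borel_measurable_continuous_on[where f = cnj]) (auto intro: continuous_intros)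

lemma L2_bound:
  assumes "g \<in> borel_measurable M" "integrable M h" "AE x in M. (cmod (g x))\<^sup>2 \<le> h x"
  shows "g \<in> L2 M"
  using assms
  by (auto simp: L2_iff intro!: Bochner_Integration.integrable_bound[OF assms(2)])

lemma L2_zero [simp]: "(\<lambda>x. 0) \<in> L2 M"
  by (simp add: L2_iff)

lemma L2_scale [intro]: "f \<in> L2 M \<Longrightarrow> (\<lambda>x. c * f x) \<in> L2 M"
  by (auto simp: L2_iff norm_mult power_mult_distrib)

lemma L2_add [intro]:
  assumes "f \<in> L2 M" "g \<in> L2 M" shows "(\<lambda>x. f x + g x) \<in> L2 M"
proof (rule L2_bound[where h = "\<lambda>x. 2 * (cmod (f x))\<^sup>2 + 2 * (cmod (g x))\<^sup>2"])
  show "AE x in M. (cmod (f x + g x))\<^sup>2 \<le> 2 * (cmod (f x))\<^sup>2 + 2 * (cmod (g x))\<^sup>2"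
  proof (intro AE_I2)
    fix x
    have "(cmod (f x + g x))\<^sup>2 \<le> (cmod (f x) + cmod (g x))\<^sup>2"
      by (simp add: norm_triangle_ineq power_mono)
    also have "\<dots> \<le> 2 * (cmod (f x))\<^sup>2 + 2 * (cmod (g x))\<^sup>2"
      using sum_squares_bound[of "cmod (f x)" "cmod (g x)"] by (simp add: power2_sum)
    finally show "(cmod (f x + g x))\<^sup>2 \<le> 2 * (cmod (f x))\<^sup>2 + 2 * (cmod (g x))\<^sup>2" .
  qed
qed (use assms in \<open>auto simp: L2_iff\<close>)

lemma L2_diff [intro]: "f \<in> L2 M \<Longrightarrow> g \<in> L2 M \<Longrightarrow> (\<lambda>x. f x - g x) \<in> L2 M"
  using L2_add[of f M "\<lambda>x. (-1) * g x"] L2_scale[of g M "-1"] by simp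

lemma L2_sum [intro]: "(\<And>i. i \<in> I \<Longrightarrow> f i \<in> L2 M) \<Longrightarrow> (\<lambda>x. \<Sum>i\<in>I. f i x) \<in> L2 M"
  by (induction I rule: infinite_finite_induct) auto

lemma L2_cong_AE:
  assumes "f \<in> L2 M" "g \<in> borel_measurable M" "AE x in M. g x = f x"
  shows "g \<in> L2 M"
  by (rule L2_bound[OF assms(2), where h = "\<lambda>x. (cmod (f x))\<^sup>2"]) (use assms in \<open>auto simp: L2_iff\<close>)

lemma L2_mult_bounded:
  assumes "f \<in> L2 M" "h \<in> borel_measurable M" "\<And>x. cmod (h x) \<le> C"
  shows "(\<lambda>x. h x * f x) \<in> L2 M"
proof (rule L2_bound[where h = "\<lambda>x. C\<^sup>2 * (cmod (f x))\<^sup>2"])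
  show "AE x in M. (cmod (h x * f x))\<^sup>2 \<le> C\<^sup>2 * (cmod (f x))\<^sup>2"
    by (auto simp: norm_mult power_mult_distrib intro!: mult_right_mono power_mono assms)
qed (use assms in \<open>auto simp: L2_iff\<close>)

lemma L2_indicator:
  assumes "A \<in> sets M" "emeasure M A < \<infinity>"
  shows "indicator A \<in> L2 M"
  by (rule L2_bound[where h = "indicator A"]) (use assms in \<open>auto split: split_indicator\<close>)

lemma integrable_l2_inner:
  assumes "f \<in> L2 M" "g \<in> L2 M"
  shows "integrable M (\<lambda>x. f x * cnj (g x))"
proof (rule Bochner_Integration.integrable_bound)
  show "integrable M (\<lambda>x. (cmod (f x))\<^sup>2 + (cmod (g x))\<^sup>2)"
    using assms by (auto simp: L2_iff)
  show "AE x in M. cmod (f x * cnj (g x)) \<le> norm ((cmod (f x))\<^sup>2 + (cmod (g x))\<^sup>2)"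
  proof (intro AE_I2)
    fix x
    show "cmod (f x * cnj (g x)) \<le> norm ((cmod (f x))\<^sup>2 + (cmod (g x))\<^sup>2)"
      using sum_squares_bound[of "cmod (f x)" "cmod (g x)"] mult_nonneg_nonneg[of "cmod (f x)" "cmod (g x)"]
      unfolding norm_mult complex_mod_cnj real_norm_def by linarith
  qed
qed (use assms in measurable)

lemma l2_inner_commute: "l2_inner M g f = cnj (l2_inner M f g)"
proof -
  have "(\<lambda>x. g x * cnj (f x)) = (\<lambda>x. cnj (f x * cnj (g x)))" by (simp add: mult.commute)
  then show ?thesis unfolding l2_inner_def by (simp only: Bochner_Integration.integral_cnj)
qed

lemma l2_inner_add_left:
  "f \<in> L2 M \<Longrightarrow> g \<in> L2 M \<Longrightarrow> h \<in> L2 M \<Longrightarrow>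
     l2_inner M (\<lambda>x. f x + g x) h = l2_inner M f h + l2_inner M g h"
  unfolding l2_inner_def by (simp add: distrib_right integrable_l2_inner)

lemma l2_inner_diff_left:
  "f \<in> L2 M \<Longrightarrow> g \<in> L2 M \<Longrightarrow> h \<in> L2 M \<Longrightarrow>
     l2_inner M (\<lambda>x. f x - g x) h = l2_inner M f h - l2_inner M g h"
  unfolding l2_inner_def by (simp add: left_diff_distrib integrable_l2_inner)

lemma l2_inner_scale_left: "l2_inner M (\<lambda>x. c * f x) h = c * l2_inner M f h"
  unfolding l2_inner_def by (simp add: mult.assoc)

lemma l2_inner_add_right:
  "f \<in> L2 M \<Longrightarrow> g \<in> L2 M \<Longrightarrow> h \<in> L2 M \<Longrightarrow>
     l2_inner M h (\<lambda>x. f x + g x) = l2_inner M h f + l2_inner M h g"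
  by (simp add: l2_inner_commute[of M h] l2_inner_add_left)

lemma l2_inner_diff_right:
  "f \<in> L2 M \<Longrightarrow> g \<in> L2 M \<Longrightarrow> h \<in> L2 M \<Longrightarrow>
     l2_inner M h (\<lambda>x. f x - g x) = l2_inner M h f - l2_inner M h g"
  by (simp add: l2_inner_commute[of M h] l2_inner_diff_left)

lemma l2_inner_scale_right: "l2_inner M h (\<lambda>x. c * f x) = cnj c * l2_inner M h f"
  by (simp add: l2_inner_commute[of M h] l2_inner_scale_left)

lemma l2_inner_zero [simp]: "l2_inner M (\<lambda>x. 0) g = 0" "l2_inner M f (\<lambda>x. 0) = 0"
  by (simp_all add: l2_inner_def)

lemma l2_inner_sum_left:
  "(\<And>i. i \<in> I \<Longrightarrow> f i \<in> L2 M) \<Longrightarrow> h \<in> L2 M \<Longrightarrow>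
     l2_inner M (\<lambda>x. \<Sum>i\<in>I. f i x) h = (\<Sum>i\<in>I. l2_inner M (f i) h)"
proof (induction I rule: infinite_finite_induct)
  case (insert i I)
  then show ?case by (simp add: l2_inner_add_left L2_sum)
qed auto

lemma l2_inner_cong_AE:
  assumes "AE x in M. f x = f' x" "AE x in M. g x = g' x"
    and "f \<in> L2 M" "f' \<in> L2 M" "g \<in> L2 M" "g' \<in> L2 M"
  shows "l2_inner M f g = l2_inner M f' g'"
  unfolding l2_inner_def
proof (rule integral_cong_AE)
  show "AE x in M. f x * cnj (g x) = f' x * cnj (g' x)"
    using assms(1,2) by eventually_elim simp
qed (use assms in measurable)

lemma l2_norm_nonneg [simp]: "0 \<le> l2_norm M f"
  by (simp add: l2_norm_def)

lemma l2_inner_self: "l2_inner M f f = of_real ((l2_norm M f)\<^sup>2)"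
proof -
  have "l2_inner M f f = (\<integral>x. complex_of_real ((cmod (f x))\<^sup>2) \<partial>M)"
    unfolding l2_inner_def by (simp only: complex_norm_square)
  then show ?thesis unfolding integral_complex_of_real by (simp add: l2_norm_def)
qed

lemma l2_norm_power2: "(l2_norm M f)\<^sup>2 = (\<integral>x. (cmod (f x))\<^sup>2 \<partial>M)"
  by (simp add: l2_norm_def)

lemma l2_norm_cong_AE:
  assumes "AE x in M. f x = g x" "f \<in> borel_measurable M" "g \<in> borel_measurable M"
  shows "l2_norm M f = l2_norm M g"
proof -
  have "(\<integral>x. (cmod (f x))\<^sup>2 \<partial>M) = (\<integral>x. (cmod (g x))\<^sup>2 \<partial>M)"
    using assms by (intro integral_cong_AE) auto
  then show ?thesis by (simp add: l2_norm_def)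
qed

lemma l2_norm_eq_0_iff: "f \<in> L2 M \<Longrightarrow> l2_norm M f = 0 \<longleftrightarrow> (AE x in M. f x = 0)"
  by (simp add: l2_norm_def L2_iff integral_nonneg_eq_0_iff_AE)

lemma l2_norm_scale: "l2_norm M (\<lambda>x. c * f x) = cmod c * l2_norm M f"
  by (simp add: l2_norm_def norm_mult power_mult_distrib real_sqrt_mult)

lemma l2_norm_add_power2:
  assumes "f \<in> L2 M" "g \<in> L2 M"
  shows "(l2_norm M (\<lambda>x. f x + g x))\<^sup>2 = (l2_norm M f)\<^sup>2 + 2 * Re (l2_inner M f g) + (l2_norm M g)\<^sup>2"
proof -
  have "complex_of_real ((l2_norm M (\<lambda>x. f x + g x))\<^sup>2) =
      l2_inner M (\<lambda>x. f x + g x) (\<lambda>x. f x + g x)" by (simp add: l2_inner_self)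
  also have "\<dots> = l2_inner M f f + l2_inner M g g + (l2_inner M f g + cnj (l2_inner M f g))"
    using assms by (simp add: l2_inner_add_left l2_inner_add_right L2_add l2_inner_commute[of M g f])
  also have "\<dots> = complex_of_real ((l2_norm M f)\<^sup>2 + 2 * Re (l2_inner M f g) + (l2_norm M g)\<^sup>2)"
    by (simp add: l2_inner_self complex_add_cnj)
  finally show ?thesis using of_real_eq_iff by blast
qed


section \<open>Bounded, self-adjoint and positive operators\<close>

lemma bounded_op_L2 [intro]: "bounded_op M T \<Longrightarrow> f \<in> L2 M \<Longrightarrow> T f \<in> L2 M"
  by (simp add: bounded_op_def)

lemma bounded_op_add:
  "bounded_op M T \<Longrightarrow> f \<in> L2 M \<Longrightarrow> g \<in> L2 M \<Longrightarrow> AE x in M. T (\<lambda>y. f y + g y) x = T f x + T g x"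
  by (simp add: bounded_op_def)

lemma bounded_op_scale:
  "bounded_op M T \<Longrightarrow> f \<in> L2 M \<Longrightarrow> AE x in M. T (\<lambda>y. c * f y) x = c * T f x"
  by (simp add: bounded_op_def)

lemma bounded_op_zero: "bounded_op M T \<Longrightarrow> AE x in M. T (\<lambda>y. 0) x = 0"
  using bounded_op_scale[of M T "\<lambda>_. 0" 0] by simp

lemma bounded_op_diff:
  assumes "bounded_op M T" "f \<in> L2 M" "g \<in> L2 M"
  shows "AE x in M. T (\<lambda>y. f y - g y) x = T f x - T g x"
  using bounded_op_add[OF assms(1,2) L2_scale[OF assms(3)], of "-1"] bounded_op_scale[OF assms(1,3), of "-1"]
  by eventually_elim simp

lemma bounded_op_sum:
  assumes "bounded_op M T" "\<And>i. i \<in> I \<Longrightarrow> f i \<in> L2 M"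
  shows "AE x in M. T (\<lambda>y. \<Sum>i\<in>I. f i y) x = (\<Sum>i\<in>I. T (f i) x)"
  using assms(2)
proof (induction I rule: infinite_finite_induct)
  case (insert i I)
  have "AE x in M. T (\<lambda>y. f i y + (\<Sum>i\<in>I. f i y)) x = T (f i) x + T (\<lambda>y. \<Sum>i\<in>I. f i y) x"
    using insert.prems by (intro bounded_op_add[OF assms(1)]) auto
  moreover have "AE x in M. T (\<lambda>y. \<Sum>i\<in>I. f i y) x = (\<Sum>i\<in>I. T (f i) x)"
    using insert by auto
  ultimately show ?case by eventually_elim (simp add: insert.hyps)
qed (use bounded_op_zero[OF assms(1)] in simp_all)

lemma bounded_opE:
  assumes "bounded_op M T"
  obtains C where "0 < C" "\<And>f. f \<in> L2 M \<Longrightarrow> l2_norm M (T f) \<le> C * l2_norm M f"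
proof -
  obtain C where C: "\<forall>f\<in>L2 M. l2_norm M (T f) \<le> C * l2_norm M f"
    using assms by (auto simp: bounded_op_def)
  have "l2_norm M (T f) \<le> max C 1 * l2_norm M f" if "f \<in> L2 M" for f
    using C that by (meson dual_order.trans l2_norm_nonneg max.cobounded1 mult_right_mono)
  then show ?thesis by (intro that[of "max C 1"]) auto
qed

text \<open>The difference of the two representatives has norm 0, and boundedness passes this on to
  its image. Every later replacement of a vector inside an operator rests on this.\<close>

lemma bounded_op_cong_AE:
  assumes "bounded_op M T" "f \<in> L2 M" "g \<in> L2 M" "AE x in M. f x = g x"
  shows "AE x in M. T f x = T g x"
proof -
  obtain C where C: "\<And>f. f \<in> L2 M \<Longrightarrow> l2_norm M (T f) \<le> C * l2_norm M f"
    using bounded_opE[OF assms(1)] by metis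
  have "l2_norm M (\<lambda>x. f x - g x) = 0"
    using assms by (subst l2_norm_eq_0_iff) auto
  then have "l2_norm M (T (\<lambda>x. f x - g x)) = 0"
    using C[OF L2_diff[OF assms(2,3)]] l2_norm_nonneg[of M "T (\<lambda>x. f x - g x)"] by simp
  then have "AE x in M. T (\<lambda>x. f x - g x) x = 0"
    using assms by (subst (asm) l2_norm_eq_0_iff) auto
  with bounded_op_diff[OF assms(1-3)] show ?thesis by eventually_elim simp
qed

lemma bounded_opI:
  assumes "\<And>f. f \<in> L2 M \<Longrightarrow> T f \<in> L2 M"
    and "\<And>f g. f \<in> L2 M \<Longrightarrow> g \<in> L2 M \<Longrightarrow> AE x in M. T (\<lambda>y. f y + g y) x = T f x + T g x"
    and "\<And>f c. f \<in> L2 M \<Longrightarrow> AE x in M. T (\<lambda>y. c * f y) x = c * T f x"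
    and "\<And>f. f \<in> L2 M \<Longrightarrow> l2_norm M (T f) \<le> C * l2_norm M f"
  shows "bounded_op M T"
  using assms unfolding bounded_op_def by blast

text \<open>The measure need not be complete, so measurability of \<open>S f\<close> does not follow
  from almost everywhere equality with \<open>T f\<close> and is demanded separately.\<close>

lemma bounded_op_cong:
  assumes "bounded_op M T" "op_eq M S T" "\<And>f. f \<in> L2 M \<Longrightarrow> S f \<in> borel_measurable M"
  shows "bounded_op M S"
proof -
  have eq: "AE x in M. S f x = T f x" if "f \<in> L2 M" for f
    using assms(2) that by (auto simp: op_eq_def)
  obtain C where C: "\<And>f. f \<in> L2 M \<Longrightarrow> l2_norm M (T f) \<le> C * l2_norm M f"
    using bounded_opE[OF assms(1)] by metis
  show ?thesis
  proof (rule bounded_opI[where C = C])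
    fix f assume f: "f \<in> L2 M"
    show "S f \<in> L2 M" by (rule L2_cong_AE[OF _ assms(3)[OF f] eq[OF f]]) (use assms f in auto)
    show "l2_norm M (S f) \<le> C * l2_norm M f"
      using C[OF f] l2_norm_cong_AE[OF eq[OF f] assms(3)[OF f] L2_measurable[OF bounded_op_L2[OF assms(1) f]]]
      by simp
    show "AE x in M. S (\<lambda>y. c * f y) x = c * S f x" for c
      using eq[OF f] eq[OF L2_scale[OF f, of c]] bounded_op_scale[OF assms(1) f, of c]
      by eventually_elim simp
    fix g assume g: "g \<in> L2 M"
    show "AE x in M. S (\<lambda>y. f y + g y) x = S f x + S g x"
      using eq[OF f] eq[OF g] eq[OF L2_add[OF f g]] bounded_op_add[OF assms(1) f g]
      by eventually_elim simp
  qed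
qed

lemma bounded_op_id: "bounded_op M id"
  by (rule bounded_opI[where C = 1]) auto

lemma bounded_op_comp:
  assumes "bounded_op M S" "bounded_op M T" shows "bounded_op M (S \<circ> T)"
proof -
  obtain C where C: "0 < C" "\<And>f. f \<in> L2 M \<Longrightarrow> l2_norm M (S f) \<le> C * l2_norm M f"
    using bounded_opE[OF assms(1)] by metis
  obtain D where D: "0 < D" "\<And>f. f \<in> L2 M \<Longrightarrow> l2_norm M (T f) \<le> D * l2_norm M f"
    using bounded_opE[OF assms(2)] by metis
  show ?thesis
  proof (rule bounded_opI[where C = "C * D"])
    fix f assume f: "f \<in> L2 M"
    then have Tf: "T f \<in> L2 M" using assms by auto
    then show "(S \<circ> T) f \<in> L2 M" using assms by auto
    show "l2_norm M ((S \<circ> T) f) \<le> C * D * l2_norm M f"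
      using order.trans[OF C(2)[OF Tf] mult_left_mono[OF D(2)[OF f]]] C(1) by (simp add: mult.assoc)
    show "AE x in M. (S \<circ> T) (\<lambda>y. c * f y) x = c * (S \<circ> T) f x" for c
    proof -
      have "AE x in M. S (T (\<lambda>y. c * f y)) x = S (\<lambda>x. c * T f x) x"
        using f Tf by (intro bounded_op_cong_AE[OF assms(1) _ _ bounded_op_scale[OF assms(2)]])
          (auto intro: bounded_op_L2[OF assms(2)])
      with bounded_op_scale[OF assms(1) Tf, of c] show ?thesis by auto
    qed
    fix g assume g: "g \<in> L2 M"
    then have Tg: "T g \<in> L2 M" using assms by auto
    have "AE x in M. S (T (\<lambda>y. f y + g y)) x = S (\<lambda>x. T f x + T g x) x"
      using f g Tf Tg by (intro bounded_op_cong_AE[OF assms(1) _ _ bounded_op_add[OF assms(2)]])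
        (auto intro: bounded_op_L2[OF assms(2)])
    with bounded_op_add[OF assms(1) Tf Tg]
    show "AE x in M. (S \<circ> T) (\<lambda>y. f y + g y) x = (S \<circ> T) f x + (S \<circ> T) g x" by auto
  qed
qed

lemma positive_opD:
  assumes "positive_op M T"
  shows "bounded_op M T" "\<And>f g. f \<in> L2 M \<Longrightarrow> g \<in> L2 M \<Longrightarrow> l2_inner M (T f) g = l2_inner M f (T g)"
    "\<And>f. f \<in> L2 M \<Longrightarrow> 0 \<le> Re (l2_inner M (T f) f)"
  using assms by (auto simp: positive_op_def self_adjoint_op_def)

lemma self_adjoint_opD:
  assumes "self_adjoint_op M T"
  shows "bounded_op M T" "\<And>f g. f \<in> L2 M \<Longrightarrow> g \<in> L2 M \<Longrightarrow> l2_inner M (T f) g = l2_inner M f (T g)"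
  using assms by (auto simp: self_adjoint_op_def)

lemma self_adjoint_inner_real:
  assumes "self_adjoint_op M T" "f \<in> L2 M"
  shows "l2_inner M (T f) f = of_real (Re (l2_inner M (T f) f))"
  using self_adjoint_opD(2)[OF assms(1) assms(2,2)] l2_inner_commute[of M "T f" f]
  by (simp add: complex_eq_iff)

lemma bounded_op_inner_add:
  assumes "bounded_op M T" "f \<in> L2 M" "g \<in> L2 M" "h \<in> L2 M"
  shows "l2_inner M (T (\<lambda>x. f x + g x)) h = l2_inner M (T f) h + l2_inner M (T g) h"
proof -
  have "l2_inner M (T (\<lambda>x. f x + g x)) h = l2_inner M (\<lambda>x. T f x + T g x) h"
    using assms by (intro l2_inner_cong_AE bounded_op_add) auto
  then show ?thesis using assms by (simp add: l2_inner_add_left bounded_op_L2)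
qed

lemma bounded_op_inner_scale:
  assumes "bounded_op M T" "f \<in> L2 M" "h \<in> L2 M"
  shows "l2_inner M (T (\<lambda>x. c * f x)) h = c * l2_inner M (T f) h"
proof -
  have "l2_inner M (T (\<lambda>x. c * f x)) h = l2_inner M (\<lambda>x. c * T f x) h"
    using assms by (intro l2_inner_cong_AE bounded_op_scale) auto
  then show ?thesis using assms by (simp add: l2_inner_scale_left)
qed

text \<open>Expanding the nonnegative form at \<open>f + c * g\<close> gives a quadratic in
  \<open>c\<close>. The form may be degenerate, so \<open>b = 0\<close> is a separate case. With
  \<open>T = id\<close> this is the ordinary Cauchy-Schwarz inequality.\<close>

lemma positive_op_Cauchy_Schwarz:
  assumes T: "positive_op M T" and f: "f \<in> L2 M" and g: "g \<in> L2 M"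
  shows "(cmod (l2_inner M (T f) g))\<^sup>2 \<le> Re (l2_inner M (T f) f) * Re (l2_inner M (T g) g)"
proof -
  note D = positive_opD[OF T]
  define a where "a = Re (l2_inner M (T f) f)"
  define b where "b = Re (l2_inner M (T g) g)"
  define z where "z = l2_inner M (T f) g"
  have zc: "l2_inner M (T g) f = cnj z"
    unfolding z_def D(2)[OF g f] by (rule l2_inner_commute)
  have key: "0 \<le> a + 2 * Re (cnj c * z) + (cmod c)\<^sup>2 * b" for c
  proof -
    let ?h = "\<lambda>x. f x + c * g x"
    have cg: "(\<lambda>x. c * g x) \<in> L2 M" using g by auto
    have "l2_inner M (T ?h) ?h = l2_inner M (T f) f + cnj c * z + c * cnj z + c * cnj c * l2_inner M (T g) g"
      using D(1) f g cg
      by (simp add: bounded_op_inner_add[OF D(1) f cg] bounded_op_inner_scale L2_add l2_inner_add_right[OF f cg]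
          bounded_op_L2 l2_inner_scale_right zc z_def[symmetric]) (simp add: algebra_simps)
    then have "Re (l2_inner M (T ?h) ?h) = a + 2 * Re (cnj c * z) + (cmod c)\<^sup>2 * b"
      by (simp add: a_def b_def complex_mult_cnj cmod_power2 algebra_simps)
    then show ?thesis using D(3)[OF L2_add[OF f cg]] by simp
  qed
  have ab: "0 \<le> a" "0 \<le> b" using D(3) f g by (auto simp: a_def b_def)
  \<comment> \<open>Taking \<open>c = - t * z\<close> aligns the phase of \<open>c\<close> with
    \<open>z\<close> and leaves a real quadratic in \<open>t\<close>.\<close>
  have key': "0 \<le> a - 2 * t * (cmod z)\<^sup>2 + t\<^sup>2 * (cmod z)\<^sup>2 * b" for t :: real
  proof -
    have "Re (cnj (- of_real t * z) * z) = - t * (cmod z)\<^sup>2"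
      unfolding cmod_power2 by (simp add: power2_eq_square algebra_simps)
    moreover have "(cmod (- of_real t * z))\<^sup>2 = t\<^sup>2 * (cmod z)\<^sup>2"
      by (simp add: norm_mult power_mult_distrib)
    ultimately show ?thesis using key[of "- of_real t * z"] by simp
  qed
  have "(cmod z)\<^sup>2 \<le> a * b"
  proof (cases "b = 0")
    case True
    have "(cmod z)\<^sup>2 = 0"
    proof (rule ccontr)
      assume nz: "(cmod z)\<^sup>2 \<noteq> 0"
      \<comment> \<open>This \<open>t\<close> makes the linear term equal to \<open>a + 1\<close>,
        so the quadratic takes the value -1.\<close>
      then show False using key'[of "(a + 1) / (2 * (cmod z)\<^sup>2)"] True ab by (simp add: field_simps)
    qed
    then show ?thesis using True by simp
  next
    case False
    \<comment> \<open>\<open>t = 1 / b\<close> minimises the quadratic.\<close>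
    then have "0 \<le> a - (cmod z)\<^sup>2 / b"
      using key'[of "1 / b"] by (simp add: power2_eq_square field_simps)
    then show ?thesis using False ab by (simp add: field_simps)
  qed
  then show ?thesis by (simp add: a_def b_def z_def)
qed

lemma positive_op_id: "positive_op M id"
  by (auto simp: positive_op_def self_adjoint_op_def bounded_op_id l2_inner_self)

lemma l2_Cauchy_Schwarz:
  assumes "f \<in> L2 M" "g \<in> L2 M"
  shows "cmod (l2_inner M f g) \<le> l2_norm M f * l2_norm M g"
proof (rule power2_le_imp_le)
  show "(cmod (l2_inner M f g))\<^sup>2 \<le> (l2_norm M f * l2_norm M g)\<^sup>2"
    using positive_op_Cauchy_Schwarz[OF positive_op_id assms] by (simp add: l2_inner_self power_mult_distrib)
qed auto

lemma l2_norm_triangle: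
  assumes "f \<in> L2 M" "g \<in> L2 M"
  shows "l2_norm M (\<lambda>x. f x + g x) \<le> l2_norm M f + l2_norm M g"
proof (rule power2_le_imp_le)
  have "Re (l2_inner M f g) \<le> l2_norm M f * l2_norm M g"
    by (rule order.trans[OF complex_Re_le_cmod l2_Cauchy_Schwarz[OF assms]])
  then show "(l2_norm M (\<lambda>x. f x + g x))\<^sup>2 \<le> (l2_norm M f + l2_norm M g)\<^sup>2"
    by (simp add: l2_norm_add_power2[OF assms] power2_sum)
qed auto

text \<open>Cauchy-Schwarz for the form of \<open>T\<close>, applied to \<open>f\<close> and
  \<open>T f\<close>, bounds the fourth power of the norm of \<open>T f\<close>; its square then
  cancels. A small value of the quadratic form thus forces \<open>T f\<close> to be small, and
  Hilbert-Schmidt norms become bounded by traces.\<close>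

lemma positive_op_norm_le:
  assumes T: "positive_op M T" and C: "\<And>f. f \<in> L2 M \<Longrightarrow> l2_norm M (T f) \<le> C * l2_norm M f"
    and f: "f \<in> L2 M"
  shows "(l2_norm M (T f))\<^sup>2 \<le> C * Re (l2_inner M (T f) f)"
proof -
  note D = positive_opD[OF T]
  have Tf: "T f \<in> L2 M" using D f by auto
  let ?n = "l2_norm M (T f)"
  have "?n\<^sup>2 * ?n\<^sup>2 = (cmod (l2_inner M (T f) (T f)))\<^sup>2"
    by (simp add: l2_inner_self power2_eq_square norm_mult)
  also have "\<dots> \<le> Re (l2_inner M (T f) f) * Re (l2_inner M (T (T f)) (T f))"
    by (rule positive_op_Cauchy_Schwarz[OF T f Tf])
  also have "\<dots> \<le> Re (l2_inner M (T f) f) * (C * ?n\<^sup>2)"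
  proof (rule mult_left_mono)
    have "Re (l2_inner M (T (T f)) (T f)) \<le> l2_norm M (T (T f)) * ?n"
      by (rule order.trans[OF complex_Re_le_cmod l2_Cauchy_Schwarz]) (use D(1) Tf in auto)
    also have "\<dots> \<le> (C * ?n) * ?n" by (intro mult_right_mono C Tf) auto
    finally show "Re (l2_inner M (T (T f)) (T f)) \<le> C * ?n\<^sup>2" by (simp add: power2_eq_square mult.assoc)
  qed (use D f in auto)
  finally have le: "?n\<^sup>2 * ?n\<^sup>2 \<le> (C * Re (l2_inner M (T f) f)) * ?n\<^sup>2" by (simp add: mult_ac)
  show ?thesis
  proof (cases "?n = 0")
    case True
    \<comment> \<open>\<open>C\<close> may be negative if L2 contains only null vectors, so its sign
      is traded against \<open>f\<close> having norm 0.\<close>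
    have "0 \<le> C \<or> l2_norm M f = 0"
      using C[OF f] True l2_norm_nonneg[of M f] by (auto simp: zero_le_mult_iff)
    moreover have "l2_norm M f = 0 \<Longrightarrow> Re (l2_inner M (T f) f) = 0"
      using l2_Cauchy_Schwarz[OF Tf f] by simp
    ultimately show ?thesis using True D(3)[OF f] by auto
  next
    case False
    then have "0 < ?n\<^sup>2" by simp
    with le show ?thesis by (simp only: mult_le_cancel_right_pos)
  qed
qed


lemma bounded_op_plus:
  assumes "bounded_op M S" "bounded_op M T" shows "bounded_op M (S + T)"
proof -
  obtain C where C: "0 < C" "\<And>f. f \<in> L2 M \<Longrightarrow> l2_norm M (S f) \<le> C * l2_norm M f"
    using bounded_opE[OF assms(1)] by blast
  obtain D where D: "0 < D" "\<And>f. f \<in> L2 M \<Longrightarrow> l2_norm M (T f) \<le> D * l2_norm M f"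
    using bounded_opE[OF assms(2)] by blast
  have ST: "(S + T) f = (\<lambda>x. S f x + T f x)" for f by (simp add: fun_eq_iff)
  show ?thesis
  proof (rule bounded_opI[where C = "C + D"])
    fix f assume f: "f \<in> L2 M"
    then have Sf: "S f \<in> L2 M" and Tf: "T f \<in> L2 M" using assms by auto
    show "(S + T) f \<in> L2 M" unfolding ST using Sf Tf by auto
    show "l2_norm M ((S + T) f) \<le> (C + D) * l2_norm M f"
      unfolding ST using l2_norm_triangle[OF Sf Tf] C(2)[OF f] D(2)[OF f] by (simp add: distrib_right)
    show "AE x in M. (S + T) (\<lambda>y. c * f y) x = c * (S + T) f x" for c
      unfolding ST using bounded_op_scale[OF assms(1) f, of c] bounded_op_scale[OF assms(2) f, of c]
      by eventually_elim (simp add: distrib_left)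
    fix g assume g: "g \<in> L2 M"
    show "AE x in M. (S + T) (\<lambda>y. f y + g y) x = (S + T) f x + (S + T) g x"
      unfolding ST using bounded_op_add[OF assms(1) f g] bounded_op_add[OF assms(2) f g]
      by eventually_elim simp
  qed
qed

lemma bounded_op_mult_op:
  assumes h: "h \<in> borel_measurable M" "\<And>x. cmod (h x) \<le> C"
  shows "bounded_op M (mult_op h)"
proof (rule bounded_opI[where C = C])
  fix f assume f: "f \<in> L2 M"
  show *: "mult_op h f \<in> L2 M"
    unfolding mult_op_def by (rule L2_mult_bounded[OF f h])
  have C: "0 \<le> C" by (rule order.trans[OF norm_ge_zero h(2)])
  have "(l2_norm M (mult_op h f))\<^sup>2 \<le> (\<integral>x. C\<^sup>2 * (cmod (f x))\<^sup>2 \<partial>M)"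
    unfolding l2_norm_power2
  proof (rule integral_mono)
    show "(cmod (mult_op h f x))\<^sup>2 \<le> C\<^sup>2 * (cmod (f x))\<^sup>2" for x
      by (auto simp: mult_op_def norm_mult power_mult_distrib intro!: mult_right_mono power_mono h)
  qed (use * f in \<open>auto simp: L2_iff\<close>)
  also have "\<dots> = (C * l2_norm M f)\<^sup>2"
    by (simp add: l2_norm_power2 power_mult_distrib)
  finally show "l2_norm M (mult_op h f) \<le> C * l2_norm M f"
    by (rule power2_le_imp_le) (use C in auto)
qed (auto simp: mult_op_def algebra_simps)

lemma self_adjoint_op_mult_op:
  assumes "h \<in> borel_measurable M" "\<And>x. cmod (h x) \<le> C" "\<And>x. cnj (h x) = h x"
  shows "self_adjoint_op M (mult_op h)"
  using assms bounded_op_mult_op[OF assms(1,2)]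
  by (auto simp: self_adjoint_op_def mult_op_def l2_inner_def mult_ac)

lemma self_adjoint_op_plus:
  assumes "self_adjoint_op M S" "self_adjoint_op M T" shows "self_adjoint_op M (S + T)"
proof -
  note S = self_adjoint_opD[OF assms(1)] and T = self_adjoint_opD[OF assms(2)]
  have ST: "(S + T) f = (\<lambda>x. S f x + T f x)" for f by (simp add: fun_eq_iff)
  have "l2_inner M ((S + T) f) g = l2_inner M f ((S + T) g)" if f: "f \<in> L2 M" and g: "g \<in> L2 M" for f g
    unfolding ST l2_inner_add_left[OF bounded_op_L2[OF S(1) f] bounded_op_L2[OF T(1) f] g]
      l2_inner_add_right[OF bounded_op_L2[OF S(1) g] bounded_op_L2[OF T(1) g] f]
    by (simp only: S(2)[OF f g] T(2)[OF f g])
  then show ?thesis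
    unfolding self_adjoint_op_def by (intro conjI ballI bounded_op_plus S(1) T(1))
qed

lemma self_adjoint_op_sandwich:
  assumes "self_adjoint_op M S" "self_adjoint_op M T" shows "self_adjoint_op M (S \<circ> T \<circ> S)"
  using self_adjoint_opD[OF assms(1)] self_adjoint_opD[OF assms(2)]
  by (auto simp: self_adjoint_op_def bounded_op_comp bounded_op_L2)

lemma positive_op_sandwich:
  assumes "self_adjoint_op M S" "positive_op M T" shows "positive_op M (S \<circ> T \<circ> S)"
proof -
  have T: "self_adjoint_op M T" using assms by (simp add: positive_op_def)
  note S = self_adjoint_opD[OF assms(1)]
  have "0 \<le> Re (l2_inner M ((S \<circ> T \<circ> S) f) f)" if f: "f \<in> L2 M" for f
  proof -
    have Sf: "S f \<in> L2 M" using S f by auto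
    then have "l2_inner M ((S \<circ> T \<circ> S) f) f = l2_inner M (T (S f)) (S f)"
      using S(2)[of "T (S f)" f] f positive_opD(1)[OF assms(2)] by auto
    then show ?thesis using positive_opD(3)[OF assms(2) Sf] by simp
  qed
  then show ?thesis
    unfolding positive_op_def by (intro conjI ballI self_adjoint_op_sandwich[OF assms(1) T])
qed

section \<open>Almost everywhere equality of operators\<close>

lemma op_eq_refl [simp]: "op_eq M T T" by (simp add: op_eq_def)

lemma op_eq_sym: "op_eq M S T \<Longrightarrow> op_eq M T S" by (auto simp: op_eq_def eq_commute)

lemma op_eq_trans [trans]:
  assumes "op_eq M S T" "op_eq M T U" shows "op_eq M S U"
  unfolding op_eq_def
proof
  fix f assume f: "f \<in> L2 M"
  have "AE x in M. S f x = T f x" "AE x in M. T f x = U f x"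
    using assms f by (auto simp: op_eq_def)
  then show "AE x in M. S f x = U f x" by eventually_elim simp
qed

lemma op_eq_comp:
  assumes "op_eq M S S'" "op_eq M T T'" "bounded_op M S" "bounded_op M T" "bounded_op M T'"
  shows "op_eq M (S \<circ> T) (S' \<circ> T')"
  unfolding op_eq_def
proof
  fix f assume f: "f \<in> L2 M"
  have "AE x in M. S (T f) x = S (T' f) x"
    using assms f by (intro bounded_op_cong_AE[OF assms(3)]) (auto simp: op_eq_def)
  moreover have "AE x in M. S (T' f) x = S' (T' f) x"
    using assms f by (auto simp: op_eq_def)
  ultimately show "AE x in M. (S \<circ> T) f x = (S' \<circ> T') f x" by eventually_elim simp
qed

text \<open>Let \<open>m\<close> be the infimum of the quadratic form on unit vectors. Then
  \<open>D - m\<close> is positive with a form that is arbitrarily small on unit vectors, so by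
  \<open>positive_op_norm_le\<close> it nearly annihilates some of them; \<open>l\<close> is
  \<open>- m\<close>.\<close>

lemma approx_eigenvector_of_not_positive:
  assumes D: "self_adjoint_op M D" and nonpos: "\<not> positive_op M D"
  obtains l :: real where "0 < l"
    "\<And>\<epsilon>. 0 < \<epsilon> \<Longrightarrow> \<exists>f\<in>L2 M. l2_norm M f = 1 \<and> l2_norm M (\<lambda>x. D f x + l * f x) < \<epsilon>"
proof -
  note Db = self_adjoint_opD(1)[OF D]
  let ?q = "\<lambda>f. Re (l2_inner M (D f) f)"
  define V where "V = ?q ` {f \<in> L2 M. l2_norm M f = 1}"
  obtain C where C: "0 < C" "\<And>f. f \<in> L2 M \<Longrightarrow> l2_norm M (D f) \<le> C * l2_norm M f"
    using bounded_opE[OF Db] by blast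
  have "- C \<le> v" if v: "v \<in> V" for v
  proof -
    obtain f where f: "f \<in> L2 M" "l2_norm M f = 1" "v = ?q f" using v by (auto simp: V_def)
    have "\<bar>v\<bar> \<le> l2_norm M (D f) * l2_norm M f"
      unfolding f(3) by (rule order.trans[OF abs_Re_le_cmod l2_Cauchy_Schwarz]) (use f Db in auto)
    then show ?thesis using C(2)[OF f(1)] f(2) by simp
  qed
  then have bdd: "bdd_below V" by (auto simp: bdd_below_def)
  have q_scale: "?q (\<lambda>x. of_real t * f x) = t\<^sup>2 * ?q f" if "f \<in> L2 M" for f and t :: real
    using that Db by (simp add: bounded_op_inner_scale L2_scale l2_inner_scale_right power2_eq_square)
  obtain f0 where f0: "f0 \<in> L2 M" "?q f0 < 0"
    using D nonpos by (auto simp: positive_op_def not_le)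
  have unit: "?q f / (l2_norm M f)\<^sup>2 \<in> V" if f: "f \<in> L2 M" "l2_norm M f \<noteq> 0" for f
  proof -
    let ?t = "1 / l2_norm M f"
    have "?q (\<lambda>x. of_real ?t * f x) \<in> V"
      unfolding V_def by (rule imageI) (use f in \<open>auto simp: l2_norm_scale simp del: of_real_divide\<close>)
    then show ?thesis by (simp only: q_scale[OF f(1)]) (simp add: power_divide)
  qed
  have null: "?q f = 0" if f: "f \<in> L2 M" "l2_norm M f = 0" for f
    using l2_Cauchy_Schwarz[OF bounded_op_L2[OF Db f(1)] f(1)] f(2) by simp
  define m where "m = Inf V"
  have m_le: "m * (l2_norm M f)\<^sup>2 \<le> ?q f" if f: "f \<in> L2 M" for f
  proof (cases "l2_norm M f = 0")
    case False
    then have "m \<le> ?q f / (l2_norm M f)\<^sup>2"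
      unfolding m_def by (intro cInf_lower unit f bdd)
    then show ?thesis using False by (simp add: pos_le_divide_eq)
  qed (simp add: null f)
  have f0n: "l2_norm M f0 \<noteq> 0" using null f0 by auto
  then have "m \<le> ?q f0 / (l2_norm M f0)\<^sup>2"
    unfolding m_def by (intro cInf_lower unit f0 bdd)
  also have "\<dots> < 0" using f0 f0n by (simp add: divide_neg_pos)
  finally have m0: "m < 0" .
  define H where "H = D + mult_op (\<lambda>_. of_real (- m))"
  have H_eq: "H f = (\<lambda>x. D f x + of_real (- m) * f x)" for f by (simp add: H_def mult_op_def fun_eq_iff)
  have Hsa: "self_adjoint_op M H"
    unfolding H_def by (intro self_adjoint_op_plus D self_adjoint_op_mult_op[where C = "\<bar>m\<bar>"]) auto
  have qH: "Re (l2_inner M (H f) f) = ?q f - m * (l2_norm M f)\<^sup>2" if "f \<in> L2 M" for f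
    unfolding H_eq using that Db L2_scale[OF that, of "of_real (- m)"]
    by (simp only: l2_inner_add_left bounded_op_L2 l2_inner_scale_left l2_inner_self) simp
  have Hpos: "positive_op M H"
    unfolding positive_op_def using Hsa qH m_le by auto
  obtain C' where C': "0 < C'" "\<And>f. f \<in> L2 M \<Longrightarrow> l2_norm M (H f) \<le> C' * l2_norm M f"
    using bounded_opE[OF positive_opD(1)[OF Hpos]] by blast
  show ?thesis
  proof (rule that[of "- m"])
    fix \<epsilon> :: real assume \<epsilon>: "0 < \<epsilon>"
    have "V \<noteq> {}" using unit f0 f0n by auto
    \<comment> \<open>The margin \<open>\<epsilon>\<^sup>2 / C'\<close> is what
      \<open>positive_op_norm_le\<close> with constant \<open>C'\<close> turns into
      \<open>\<epsilon>\<^sup>2\<close>.\<close>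
    then obtain v where "v \<in> V" "v < m + \<epsilon>\<^sup>2 / C'"
      using cInf_lessD[of V "m + \<epsilon>\<^sup>2 / C'"] \<epsilon> C'(1) by (auto simp: m_def)
    then obtain f where f: "f \<in> L2 M" "l2_norm M f = 1" "?q f - m < \<epsilon>\<^sup>2 / C'"
      by (auto simp: V_def)
    have "(l2_norm M (H f))\<^sup>2 \<le> C' * Re (l2_inner M (H f) f)"
      using positive_op_norm_le[OF Hpos C'(2) f(1)] by auto
    also have "\<dots> < \<epsilon>\<^sup>2"
      using f C'(1) by (simp add: qH field_simps)
    finally have "l2_norm M (H f) < \<epsilon>" by (rule power2_less_imp_less) (use \<epsilon> in auto)
    then show "\<exists>f\<in>L2 M. l2_norm M f = 1 \<and> l2_norm M (\<lambda>x. D f x + of_real (- m) * f x) < \<epsilon>"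
      using f by (auto simp: H_eq)
  qed (use m0 in auto)
qed

text \<open>Otherwise some \<open>- l < 0\<close> would be an approximate eigenvalue of
  \<open>K\<close>, contradicting the bounded inverse that exists because \<open>- l\<close> lies
  outside the spectrum.\<close>

lemma positive_op_of_spectrum:
  assumes K: "self_adjoint_op M K" and spec: "op_spectrum M K \<subseteq> complex_of_real ` {0..1}"
  shows "positive_op M K"
proof (rule ccontr)
  assume np: "\<not> positive_op M K"
  obtain l :: real where l: "0 < l"
    "\<And>\<epsilon>. 0 < \<epsilon> \<Longrightarrow> \<exists>f\<in>L2 M. l2_norm M f = 1 \<and> l2_norm M (\<lambda>x. K f x + l * f x) < \<epsilon>"
    using approx_eigenvector_of_not_positive[OF K np] by blast
  let ?T = "mult_op (\<lambda>_. - complex_of_real l) - K"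
  have "- complex_of_real l \<notin> complex_of_real ` {0..1}"
    using l(1) by (auto simp flip: of_real_minus)
  then have "invertible_op M ?T" using spec by (auto simp: op_spectrum_def)
  then obtain S where T: "bounded_op M ?T" and S: "bounded_op M S" "op_eq M (S \<circ> ?T) id"
    by (auto simp: invertible_op_def is_inverse_op_def)
  obtain C where C: "0 < C" "\<And>f. f \<in> L2 M \<Longrightarrow> l2_norm M (S f) \<le> C * l2_norm M f"
    using bounded_opE[OF S(1)] by blast
  obtain f where f: "f \<in> L2 M" "l2_norm M f = 1" "l2_norm M (\<lambda>x. K f x + of_real l * f x) < 1 / C"
    using l(2)[of "1 / C"] C(1) by auto
  have "?T f = (\<lambda>x. (- 1) * (K f x + of_real l * f x))" by (simp add: mult_op_def fun_eq_iff)
  then have n: "l2_norm M (?T f) = l2_norm M (\<lambda>x. K f x + of_real l * f x)" by (simp only: l2_norm_scale) simp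
  have Tf: "?T f \<in> L2 M" using bounded_op_L2[OF T f(1)] .
  have "AE x in M. S (?T f) x = f x" using S(2) f(1) by (auto simp: op_eq_def)
  then have "l2_norm M f = l2_norm M (S (?T f))"
    using f(1) bounded_op_L2[OF S(1) Tf] by (intro l2_norm_cong_AE[symmetric]) auto
  also have "\<dots> \<le> C * l2_norm M (\<lambda>x. K f x + of_real l * f x)"
    using C(2)[OF Tf] by (simp only: n)
  also have "\<dots> < 1" using f(3) C(1) by (simp add: field_simps)
  finally show False using f(2) by simp
qed

text \<open>
  With \<open>D = S - T\<close> and \<open>A = S + T\<close>, the equality \<open>S\<^sup>2 = T\<^sup>2\<close> means \<open>A D + D A = 0\<close>. An approximate
  eigenvector of D for \<open>- l < 0\<close> would be one of A for 0, hence, as \<open>- A \<le> D \<le> A\<close>, of D for 0.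
\<close>

lemma positive_op_le_abs:
  assumes T: "positive_op M T" and S: "is_abs_op M T S" and h: "h \<in> L2 M"
  shows "Re (l2_inner M (T h) h) \<le> Re (l2_inner M (S h) h)"
proof -
  have Sp: "positive_op M S" using S by (simp add: is_abs_op_def)
  note TD = positive_opD[OF T] and SD = positive_opD[OF Sp]
  define D where "D = S + (mult_op (\<lambda>_. - 1) \<circ> T)"
  have D_eq: "D f = (\<lambda>x. S f x - T f x)" for f by (simp add: D_def mult_op_def fun_eq_iff)
  have Dsa: "self_adjoint_op M D"
    unfolding self_adjoint_op_def
  proof
    show "bounded_op M D"
      unfolding D_def by (intro bounded_op_plus SD bounded_op_comp TD bounded_op_mult_op[where C = 1]) auto
    show "\<forall>f\<in>L2 M. \<forall>g\<in>L2 M. l2_inner M (D f) g = l2_inner M f (D g)"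
      using TD SD by (auto simp: D_eq l2_inner_diff_left l2_inner_diff_right bounded_op_L2)
  qed
  have "positive_op M D"
  proof (rule ccontr)
    assume np: "\<not> positive_op M D"
    obtain l :: real where l: "0 < l"
      "\<And>\<epsilon>. 0 < \<epsilon> \<Longrightarrow> \<exists>f\<in>L2 M. l2_norm M f = 1 \<and> l2_norm M (\<lambda>x. D f x + l * f x) < \<epsilon>"
      using approx_eigenvector_of_not_positive[OF Dsa np] by blast
    obtain C where C: "0 < C" "\<And>f. f \<in> L2 M \<Longrightarrow> l2_norm M ((S + T) f) \<le> C * l2_norm M f"
      using bounded_opE[OF bounded_op_plus[OF SD(1) TD(1)]] by blast
    \<comment> \<open>The final estimate is \<open>l\<^sup>2 \<le> \<epsilon> * (l + C)\<close>;
      this choice makes its right-hand side half of \<open>l\<^sup>2\<close>.\<close>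
    define \<epsilon> where "\<epsilon> = l\<^sup>2 / (2 * (l + C))"
    have \<epsilon>: "0 < \<epsilon>" using l C by (simp add: \<epsilon>_def)
    obtain f where f: "f \<in> L2 M" "l2_norm M f = 1" "l2_norm M (\<lambda>x. D f x + of_real l * f x) < \<epsilon>"
      using l(2)[OF \<epsilon>] by auto
    define g where "g = (\<lambda>x. D f x + of_real l * f x)"
    have Sf: "S f \<in> L2 M" and Tf: "T f \<in> L2 M" and Df: "D f \<in> L2 M"
      using f SD TD self_adjoint_opD[OF Dsa] by auto
    have g: "g \<in> L2 M" unfolding g_def using Df f by auto
    define Af where "Af = (\<lambda>x. S f x + T f x)"
    have Af: "Af \<in> L2 M" unfolding Af_def using Sf Tf by auto
    have Af_eq: "Af = (S + T) f" by (simp add: Af_def fun_eq_iff)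
    have "l2_norm M Af \<le> C" using C(2)[OF f(1)] f(2) by (simp add: Af_eq)
    \<comment> \<open>Equality of the squares makes the two diagonal terms cancel, and what remains
      of \<open>l2_inner M (D f) Af\<close> is purely imaginary.\<close>
    have "l2_inner M (S f) (S f) = l2_inner M (T f) (T f)"
      using S f(1) Sf SD(2)[OF Sf f(1)] by (auto simp: is_abs_op_def)
    then have "l2_inner M (D f) Af = l2_inner M (S f) (T f) - cnj (l2_inner M (S f) (T f))"
      unfolding D_eq Af_def using Sf Tf
      by (simp add: l2_inner_diff_left l2_inner_add_right L2_add l2_inner_commute[of M "T f" "S f"])
    then have 0: "Re (l2_inner M (D f) Af) = 0" by simp
    have Dfg: "D f = (\<lambda>x. g x - of_real l * f x)" by (simp add: g_def)
    then have "l2_inner M (D f) Af = l2_inner M g Af - l * l2_inner M f Af"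
      using l2_inner_diff_left[OF g L2_scale[OF f(1)] Af] by (simp only: l2_inner_scale_left Dfg)
    with 0 have "l * Re (l2_inner M f Af) = Re (l2_inner M g Af)" by simp
    also have "\<dots> \<le> l2_norm M g * l2_norm M Af"
      by (rule order.trans[OF complex_Re_le_cmod l2_Cauchy_Schwarz[OF g Af]])
    also have "\<dots> \<le> \<epsilon> * C"
      using f(3) \<open>l2_norm M Af \<le> C\<close> by (intro mult_mono) (auto simp: g_def \<epsilon> less_imp_le)
    finally have le1: "l * Re (l2_inner M f Af) \<le> \<epsilon> * C" .
    have "Re (l2_inner M f Af) = Re (l2_inner M (S f) f) + Re (l2_inner M (T f) f)"
      unfolding Af_def using f Sf Tf SD(2)[OF f(1) f(1)] TD(2)[OF f(1) f(1)] by (simp add: l2_inner_add_right)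
    moreover have "Re (l2_inner M (D f) f) = Re (l2_inner M (S f) f) - Re (l2_inner M (T f) f)"
      unfolding D_eq using f Sf Tf by (simp add: l2_inner_diff_left)
    moreover have "0 \<le> Re (l2_inner M (S f) f)" using SD(3) f by auto
    ultimately have le2: "- Re (l2_inner M (D f) f) \<le> Re (l2_inner M f Af)" by linarith
    have "l2_inner M (D f) f = l2_inner M g f - l"
      using l2_inner_diff_left[OF g L2_scale[OF f(1)] f(1), of "of_real l"] f(2)
      by (simp add: l2_inner_scale_left Dfg[symmetric] l2_inner_self)
    moreover have "Re (l2_inner M g f) \<le> \<epsilon>"
      by (rule order.trans[OF complex_Re_le_cmod order.trans[OF l2_Cauchy_Schwarz[OF g f(1)]]])
        (use f in \<open>simp add: g_def\<close>)
    ultimately have "l - \<epsilon> \<le> Re (l2_inner M f Af)" using le2 by simp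
    then have "l * (l - \<epsilon>) \<le> l * Re (l2_inner M f Af)" using l(1) by (intro mult_left_mono) auto
    with le1 have "l * (l - \<epsilon>) \<le> \<epsilon> * C" by linarith
    then have "l\<^sup>2 \<le> \<epsilon> * (l + C)" by (simp add: power2_eq_square algebra_simps)
    also have "\<dots> = l\<^sup>2 / 2" using l C by (simp add: \<epsilon>_def field_simps)
    finally show False using l by simp
  qed
  then have "0 \<le> Re (l2_inner M (D h) h)" using h positive_opD(3) by blast
  then show ?thesis
    unfolding D_eq using h SD TD by (simp add: l2_inner_diff_left bounded_op_L2)
qed


section \<open>Completeness and orthonormal bases\<close>

text \<open>The squared increments are at most \<open>(1 / 4) ^ n\<close>, which leaves room for a
  weight \<open>2 ^ n\<close>: the weighted sum is integrable, hence finite almost everywhere, and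
  this forces absolute convergence of the increments at almost every point. Fatou's lemma then
  identifies the pointwise limit as the limit in norm.\<close>

lemma L2_complete:
  assumes f: "\<And>n. f n \<in> L2 M"
    and step: "\<And>n. (l2_norm M (\<lambda>x. f (Suc n) x - f n x))\<^sup>2 \<le> (1 / 4) ^ n"
  obtains g where "g \<in> L2 M" "(\<lambda>n. l2_norm M (\<lambda>x. f n x - g x)) \<longlonglongrightarrow> 0"
proof -
  have quarter: "(1 / 4 :: real) ^ n = ((1 / 2) ^ n)\<^sup>2" for n
  proof -
    have "((1 / 2 :: real) ^ n)\<^sup>2 = ((1 / 2)\<^sup>2) ^ n" by (simp only: power_mult[symmetric] mult.commute)
    then show ?thesis by (simp add: power2_eq_square)
  qed
  note [measurable] = L2_measurable[OF f]
  define d where "d n x = f (Suc n) x - f n x" for n x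
  have d: "d n \<in> L2 M" for n using L2_diff[OF f f, of "Suc n" n] by (simp add: d_def[abs_def])
  note [measurable] = L2_measurable[OF d]
  have dn: "(\<integral>\<^sup>+x. ennreal ((cmod (d n x))\<^sup>2) \<partial>M) = ennreal ((l2_norm M (d n))\<^sup>2)" for n
    using d[of n] by (simp add: nn_integral_eq_integral L2_iff l2_norm_power2)
  have "(\<integral>\<^sup>+x. (\<Sum>n. ennreal (2 ^ n * (cmod (d n x))\<^sup>2)) \<partial>M) = (\<Sum>n. \<integral>\<^sup>+x. ennreal (2 ^ n * (cmod (d n x))\<^sup>2) \<partial>M)"
    by (intro nn_integral_suminf) measurable
  also have "\<dots> \<le> (\<Sum>n. ennreal ((1 / 2) ^ n))"
  proof (intro suminf_le)
    fix n
    have "(\<integral>\<^sup>+x. ennreal (2 ^ n * (cmod (d n x))\<^sup>2) \<partial>M) = ennreal (2 ^ n) * ennreal ((l2_norm M (d n))\<^sup>2)"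
      unfolding dn[symmetric] by (subst nn_integral_cmult[symmetric]) (auto simp: ennreal_mult)
    also have "\<dots> \<le> ennreal (2 ^ n * (1 / 4) ^ n)"
      using step[of n] by (subst ennreal_mult[symmetric]) (auto simp: d_def[abs_def] intro!: ennreal_leI)
    also have "2 ^ n * (1 / 4 :: real) ^ n = (1 / 2) ^ n"
      by (simp flip: power_mult_distrib)
    finally show "(\<integral>\<^sup>+x. ennreal (2 ^ n * (cmod (d n x))\<^sup>2) \<partial>M) \<le> ennreal ((1 / 2) ^ n)" .
  qed auto
  also have "\<dots> < \<infinity>"
    by (subst suminf_ennreal2) (auto simp: summable_geometric)
  finally have "AE x in M. (\<Sum>n. ennreal (2 ^ n * (cmod (d n x))\<^sup>2)) \<noteq> \<infinity>"
    by (intro nn_integral_PInf_AE) auto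
  then have conv: "AE x in M. convergent (\<lambda>n. f n x)"
  proof eventually_elim
    case (elim x)
    have s1: "summable (\<lambda>n. 2 ^ n * (cmod (d n x))\<^sup>2)"
      using elim by (intro summable_suminf_not_top) auto
    have s2: "summable (\<lambda>n. (1 / 2 :: real) ^ n)" by (auto simp: summable_geometric)
    have "summable (\<lambda>n. d n x)"
    proof (rule summable_comparison_test'[where N = 0])
      show "summable (\<lambda>n. 2 ^ n * (cmod (d n x))\<^sup>2 + (1 / 2) ^ n)" using s1 s2 by (rule summable_add)
      fix n
      \<comment> \<open>\<open>2 * a \<le> a\<^sup>2 + 1\<close> with
        \<open>a = 2 ^ n * cmod (d n x)\<close>, divided by \<open>2 ^ n\<close>, trades the squared
        increments for the increments themselves.\<close>
      have "2 * (cmod (d n x)) = 2 * ((2 ^ n * cmod (d n x)) * 1) / 2 ^ n" by simp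
      also have "\<dots> \<le> ((2 ^ n * cmod (d n x))\<^sup>2 + 1\<^sup>2) / 2 ^ n"
        using sum_squares_bound[of "2 ^ n * cmod (d n x)" 1] by (intro divide_right_mono) auto
      also have "\<dots> = 2 ^ n * (cmod (d n x))\<^sup>2 + (1 / 2) ^ n"
        by (simp add: field_simps power2_eq_square power_one_over)
      finally show "norm (d n x) \<le> 2 ^ n * (cmod (d n x))\<^sup>2 + (1 / 2) ^ n"
        using norm_ge_zero[of "d n x"] by linarith
    qed
    then have "convergent (\<lambda>n. f 0 x + (\<Sum>i<n. d i x))"
      by (intro convergent_add convergent_const) (simp add: summable_iff_convergent)
    moreover have "f 0 x + (\<Sum>i<n. d i x) = f n x" for n
      by (induction n) (simp_all add: d_def add.assoc[symmetric])
    ultimately show ?case by simp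
  qed
  define g where "g x = lim (\<lambda>n. f n x)" for x
  have gm [measurable]: "g \<in> borel_measurable M"
    unfolding g_def[abs_def] by measurable
  have diff: "l2_norm M (\<lambda>x. f (n + m) x - f n x) \<le> 2 * (1 / 2) ^ n - 2 * (1 / 2) ^ (n + m)" for n m
  proof (induction m)
    case (Suc m)
    have "l2_norm M (\<lambda>x. f (n + Suc m) x - f n x) = l2_norm M (\<lambda>x. (f (n + m) x - f n x) + d (n + m) x)"
      by (simp add: d_def)
    also have "\<dots> \<le> l2_norm M (\<lambda>x. f (n + m) x - f n x) + l2_norm M (d (n + m))"
      using f d by (intro l2_norm_triangle) auto
    also have "l2_norm M (d (n + m)) \<le> (1 / 2) ^ (n + m)"
      by (rule power2_le_imp_le) (use step[of "n + m"] in \<open>unfold quarter d_def, auto\<close>)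
    finally show ?case using Suc by simp
  qed (simp add: l2_norm_def)
  have nn: "(\<integral>\<^sup>+x. ennreal ((cmod (f n x - g x))\<^sup>2) \<partial>M) \<le> ennreal (4 * (1 / 4) ^ n)" for n
  proof -
    have "(\<integral>\<^sup>+x. ennreal ((cmod (f n x - g x))\<^sup>2) \<partial>M) =
        (\<integral>\<^sup>+x. liminf (\<lambda>m. ennreal ((cmod (f (n + m) x - f n x))\<^sup>2)) \<partial>M)"
    proof (intro nn_integral_cong_AE, use conv in eventually_elim)
      case (elim x)
      then have "(\<lambda>m. f m x) \<longlonglongrightarrow> g x" by (simp add: g_def convergent_LIMSEQ_iff)
      then have "(\<lambda>m. f (m + n) x) \<longlonglongrightarrow> g x" by (rule LIMSEQ_ignore_initial_segment)
      then have "(\<lambda>m. ennreal ((cmod (f (n + m) x - f n x))\<^sup>2)) \<longlonglongrightarrow> ennreal ((cmod (g x - f n x))\<^sup>2)"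
        by (auto intro!: tendsto_intros simp: add.commute)
      from lim_imp_Liminf[OF sequentially_bot this] show ?case
        by (simp add: norm_minus_commute[of "f n x" "g x"])
    qed
    also have "\<dots> \<le> liminf (\<lambda>m. \<integral>\<^sup>+x. ennreal ((cmod (f (n + m) x - f n x))\<^sup>2) \<partial>M)"
      by (intro nn_integral_liminf) measurable
    also have "\<dots> \<le> ennreal (4 * (1 / 4) ^ n)"
    proof (rule Liminf_le)
      show "\<forall>\<^sub>F m in sequentially. (\<integral>\<^sup>+x. ennreal ((cmod (f (n + m) x - f n x))\<^sup>2) \<partial>M) \<le> ennreal (4 * (1 / 4) ^ n)"
      proof (intro always_eventually allI)
        fix m
        have "(\<lambda>x. f (n + m) x - f n x) \<in> L2 M" using f by auto
        then have "(\<integral>\<^sup>+x. ennreal ((cmod (f (n + m) x - f n x))\<^sup>2) \<partial>M) =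
            ennreal ((l2_norm M (\<lambda>x. f (n + m) x - f n x))\<^sup>2)"
          by (simp add: nn_integral_eq_integral L2_iff l2_norm_power2)
        also have "\<dots> \<le> ennreal ((2 * (1 / 2) ^ n)\<^sup>2)"
        proof (intro ennreal_leI power_mono)
          have "0 \<le> (1 / 2 :: real) ^ (n + m)" by simp
          then show "l2_norm M (\<lambda>x. f (n + m) x - f n x) \<le> 2 * (1 / 2) ^ n"
            using diff[of n m] by linarith
        qed simp
        also have "(2 * (1 / 2 :: real) ^ n)\<^sup>2 = 4 * (1 / 4) ^ n"
          by (simp add: quarter power_mult_distrib)
        finally show "(\<integral>\<^sup>+x. ennreal ((cmod (f (n + m) x - f n x))\<^sup>2) \<partial>M) \<le> ennreal (4 * (1 / 4) ^ n)" .
      qed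
    qed simp
    finally show ?thesis .
  qed
  have dL2: "(\<lambda>x. f n x - g x) \<in> L2 M" for n
    unfolding L2_iff using nn[of n]
    by (auto simp: integrable_iff_bounded less_top[symmetric] top_unique intro!: le_less_trans[OF nn])
  have "g \<in> L2 M" using L2_diff[OF f[of 0] dL2[of 0]] by simp
  have bound: "l2_norm M (\<lambda>x. f n x - g x) \<le> 2 * (1 / 2) ^ n" for n
  proof (rule power2_le_imp_le)
    have "ennreal ((l2_norm M (\<lambda>x. f n x - g x))\<^sup>2) \<le> ennreal (4 * (1 / 4) ^ n)"
      using nn[of n] dL2[of n] by (simp add: nn_integral_eq_integral L2_iff l2_norm_power2)
    then show "(l2_norm M (\<lambda>x. f n x - g x))\<^sup>2 \<le> (2 * (1 / 2) ^ n)\<^sup>2"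
      by (simp add: quarter power_mult_distrib)
  qed simp
  have "(\<lambda>n. l2_norm M (\<lambda>x. f n x - g x)) \<longlonglongrightarrow> 0"
  proof (rule Lim_null_comparison)
    show "\<forall>\<^sub>F n in sequentially. norm (l2_norm M (\<lambda>x. f n x - g x)) \<le> 2 * (1 / 2) ^ n"
      using bound by simp
    show "(\<lambda>n. 2 * (1 / 2 :: real) ^ n) \<longlonglongrightarrow> 0"
      by (rule tendsto_mult_right_zero, rule LIMSEQ_realpow_zero) auto
  qed
  with \<open>g \<in> L2 M\<close> show ?thesis by (rule that)
qed

text \<open>A maximal orthonormal set exists by Zorn's lemma, and a non-null vector orthogonal to it
  could be normalised and added. Distinct representatives of one vector never both belong to such a
  set, as their inner product would be 1 instead of 0.\<close>

lemma orthonormal_basis_exists: "\<exists>A. orthonormal_basis M A"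
proof -
  define \<C> where "\<C> = {A. A \<subseteq> L2 M \<and> (\<forall>e\<in>A. \<forall>e'\<in>A. l2_inner M e e' = (if e = e' then 1 else 0))}"
  have "\<exists>A\<in>\<C>. \<forall>X\<in>\<C>. A \<subseteq> X \<longrightarrow> X = A"
  proof (rule subset_Zorn')
    fix C assume "subset.chain \<C> C"
    then have C: "C \<subseteq> \<C>" and chain: "\<And>X Y. X \<in> C \<Longrightarrow> Y \<in> C \<Longrightarrow> X \<subseteq> Y \<or> Y \<subseteq> X"
      by (auto simp: subset.chain_def)
    show "\<Union> C \<in> \<C>"
      unfolding \<C>_def
    proof (intro CollectI conjI ballI)
      show "\<Union> C \<subseteq> L2 M" using C by (auto simp: \<C>_def)
      fix e e' assume "e \<in> \<Union> C" "e' \<in> \<Union> C"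
      then obtain X where "X \<in> C" "e \<in> X" "e' \<in> X" using chain by blast
      then show "l2_inner M e e' = (if e = e' then 1 else 0)" using C by (auto simp: \<C>_def)
    qed
  qed
  then obtain A where A: "A \<in> \<C>" and max: "\<And>X. X \<in> \<C> \<Longrightarrow> A \<subseteq> X \<Longrightarrow> X = A" by blast
  have "AE x in M. f x = 0" if f: "f \<in> L2 M" "\<forall>e\<in>A. l2_inner M f e = 0" for f
  proof (rule ccontr)
    assume "\<not> (AE x in M. f x = 0)"
    then have n: "l2_norm M f \<noteq> 0" using f by (simp add: l2_norm_eq_0_iff)
    define u where "u = (\<lambda>x. of_real (1 / l2_norm M f) * f x)"
    have uL2: "u \<in> L2 M" unfolding u_def by (rule L2_scale[OF f(1)])
    have uA: "l2_inner M u e = 0" if "e \<in> A" for e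
      unfolding u_def l2_inner_scale_left using f that by auto
    then have Au: "l2_inner M e u = 0" if "e \<in> A" for e
      using that l2_inner_commute[of M e u] by simp
    have "l2_norm M u = 1" unfolding u_def l2_norm_scale using n by (simp add: norm_divide)
    then have uu: "l2_inner M u u = 1" by (simp add: l2_inner_self)
    then have "insert u A \<in> \<C>"
      using A uL2 uA Au by (auto simp: \<C>_def)
    then have "u \<in> A" using max by blast
    then show False using uA uu by fastforce
  qed
  then show ?thesis using A unfolding orthonormal_basis_def \<C>_def by blast
qed

lemma orthonormal_basis_l2_basis: "orthonormal_basis M (l2_basis M)"
  unfolding l2_basis_def using orthonormal_basis_exists by (rule someI_ex)

lemma orthonormal_sum_norm:
  assumes "finite F" "F \<subseteq> L2 M" "\<And>e e'. e \<in> F \<Longrightarrow> e' \<in> F \<Longrightarrow> l2_inner M e e' = (if e = e' then 1 else 0)"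
  shows "\<And>h. h \<in> L2 M \<Longrightarrow> l2_inner M (\<lambda>x. \<Sum>e\<in>F. c e * e x) h = (\<Sum>e\<in>F. c e * l2_inner M e h)"
    and "(l2_norm M (\<lambda>x. \<Sum>e\<in>F. c e * e x))\<^sup>2 = (\<Sum>e\<in>F. (cmod (c e))\<^sup>2)"
proof -
  let ?p = "\<lambda>x. \<Sum>e\<in>F. c e * e x"
  have ip: "l2_inner M ?p h = (\<Sum>e\<in>F. c e * l2_inner M e h)" if "h \<in> L2 M" for h
    using assms(2) that by (subst l2_inner_sum_left) (auto simp: l2_inner_scale_left)
  show "\<And>h. h \<in> L2 M \<Longrightarrow> l2_inner M ?p h = (\<Sum>e\<in>F. c e * l2_inner M e h)" by (rule ip)
  have p: "?p \<in> L2 M" using assms(2) by (intro L2_sum L2_scale) auto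
  have "complex_of_real ((l2_norm M ?p)\<^sup>2) = (\<Sum>e\<in>F. c e * l2_inner M e ?p)"
    unfolding l2_inner_self[symmetric] by (rule ip[OF p])
  also have "\<dots> = (\<Sum>e\<in>F. c e * cnj (c e))"
  proof (rule sum.cong[OF refl])
    fix e assume e: "e \<in> F"
    then have "l2_inner M ?p e = (\<Sum>e'\<in>F. c e' * l2_inner M e' e)" using ip assms(2) by auto
    also have "\<dots> = (\<Sum>e'\<in>F. if e' = e then c e' else 0)"
      using assms(3) e by (intro sum.cong) auto
    also have "\<dots> = c e" using e assms(1) by simp
    finally show "c e * l2_inner M e ?p = c e * cnj (c e)" by (subst l2_inner_commute) simp
  qed
  also have "\<dots> = complex_of_real (\<Sum>e\<in>F. (cmod (c e))\<^sup>2)"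
    by (simp only: complex_norm_square of_real_sum)
  finally show "(l2_norm M ?p)\<^sup>2 = (\<Sum>e\<in>F. (cmod (c e))\<^sup>2)" by (simp only: of_real_eq_iff)
qed

text \<open>Bessel's inequality makes the squared coefficients summable, and suitable finite partial
  sums converge to some \<open>g\<close> by \<open>L2_complete\<close>. Since \<open>g\<close> and
  \<open>f\<close> have the same coefficients, completeness of the basis gives \<open>f = g\<close>
  almost everywhere. The basis may be uncountable, whence the passage through finite
  subsets.\<close>

lemma Parseval:
  assumes A: "orthonormal_basis M A" and f: "f \<in> L2 M"
  shows "((\<lambda>e. (cmod (l2_inner M f e))\<^sup>2) has_sum (l2_norm M f)\<^sup>2) A"
proof -
  define c where "c e = l2_inner M f e" for e
  define q where "q e = (cmod (c e))\<^sup>2" for e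
  have AL: "A \<subseteq> L2 M" and AO: "\<And>e e'. e \<in> A \<Longrightarrow> e' \<in> A \<Longrightarrow> l2_inner M e e' = (if e = e' then 1 else 0)"
    and AC: "\<And>f. f \<in> L2 M \<Longrightarrow> (\<And>e. e \<in> A \<Longrightarrow> l2_inner M f e = 0) \<Longrightarrow> AE x in M. f x = 0"
    using A by (auto simp: orthonormal_basis_def)
  define p where "p F x = (\<Sum>e\<in>F. c e * e x)" for F x
  have p: "p F \<in> L2 M" if "F \<subseteq> A" for F
    unfolding p_def[abs_def] using AL that by (intro L2_sum L2_scale) auto
  have norm_p: "(l2_norm M (p F))\<^sup>2 = sum q F" if "finite F" "F \<subseteq> A" for F
    unfolding p_def[abs_def] q_def by (rule orthonormal_sum_norm) (use that AL AO in \<open>auto simp: subset_iff\<close>)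
  have inner_p: "l2_inner M (p F) e = (if e \<in> F then c e else 0)" if "finite F" "F \<subseteq> A" "e \<in> A" for F e
  proof -
    have "l2_inner M (p F) e = (\<Sum>e'\<in>F. c e' * l2_inner M e' e)"
      unfolding p_def[abs_def] by (rule orthonormal_sum_norm) (use that AL AO in \<open>auto simp: subset_iff\<close>)
    also have "\<dots> = (\<Sum>e'\<in>F. if e' = e then c e' else 0)"
      using AO that by (intro sum.cong) auto
    finally show ?thesis using that by simp
  qed
  have rest: "(l2_norm M (\<lambda>x. f x - p F x))\<^sup>2 = (l2_norm M f)\<^sup>2 - sum q F" if F: "finite F" "F \<subseteq> A" for F
  proof -
    have "l2_inner M (p F) f = (\<Sum>e\<in>F. c e * l2_inner M e f)"
      unfolding p_def[abs_def] by (rule orthonormal_sum_norm) (use F AL AO f in \<open>auto simp: subset_iff\<close>)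
    also have "\<dots> = (\<Sum>e\<in>F. c e * cnj (c e))"
      by (intro sum.cong refl) (simp add: c_def l2_inner_commute[of M _ f])
    also have "\<dots> = complex_of_real (sum q F)" unfolding q_def
      by (simp only: complex_norm_square of_real_sum)
    finally have "l2_inner M f (p F) = complex_of_real (sum q F)"
      using l2_inner_commute[of M f "p F"] by simp
    then show ?thesis
      using l2_norm_add_power2[OF f L2_scale[OF p[OF F(2)]], of "-1"] norm_p[OF F]
      by (simp only: l2_inner_scale_right l2_norm_scale) simp
  qed
  have Bessel: "sum q F \<le> (l2_norm M f)\<^sup>2" if "finite F" "F \<subseteq> A" for F
    using rest[OF that] zero_le_power2[of "l2_norm M (\<lambda>x. f x - p F x)"] by linarith
  have q0: "0 \<le> q e" for e by (simp add: q_def)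
  have summ: "q summable_on A"
    by (rule nonneg_bdd_above_summable_on) (auto simp: q0 bdd_above_def intro!: exI[of _ "(l2_norm M f)\<^sup>2"] Bessel)
  define s where "s = infsum q A"
  have s: "(q has_sum s) A" using summ by (simp add: s_def)
  have le_s: "sum q F \<le> s" if "finite F" "F \<subseteq> A" for F
    unfolding s_def using that summ q0 by (intro finite_sum_le_infsum) auto
  have "\<exists>F. finite F \<and> F \<subseteq> A \<and> s - (1 / 4) ^ n \<le> sum q F" for n :: nat
  proof -
    have "\<forall>\<^sub>F F in finite_subsets_at_top A. dist (sum q F) s < (1 / 4) ^ n"
      using s unfolding has_sum_def by (rule tendstoD) simp
    then obtain F where "finite F" "F \<subseteq> A" "dist (sum q F) s < (1 / 4) ^ n"
      unfolding eventually_finite_subsets_at_top by blast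
    then show ?thesis by (intro exI[of _ F]) (auto simp: dist_real_def)
  qed
  then obtain G where G: "\<And>n. finite (G n)" "\<And>n. G n \<subseteq> A" "\<And>n::nat. s - (1 / 4) ^ n \<le> sum q (G n)" by metis
  \<comment> \<open>Unions make the finite sets nested, so that the step from one partial sum to the
    next involves only the newly added coefficients.\<close>
  define F where "F n = (\<Union>i\<le>n. G i)" for n
  have F: "finite (F n)" "F n \<subseteq> A" for n using G by (auto simp: F_def)
  have sF: "s - (1 / 4) ^ n \<le> sum q (F n)" for n
    by (rule order.trans[OF G(3) sum_mono2]) (auto simp: F(1) q0, auto simp: F_def)
  have F_mono: "F n \<subseteq> F (Suc n)" for n unfolding F_def by (intro UN_mono) auto
  have step: "(l2_norm M (\<lambda>x. p (F (Suc n)) x - p (F n) x))\<^sup>2 \<le> (1 / 4) ^ n" for n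
  proof -
    have "(\<lambda>x. p (F (Suc n)) x - p (F n) x) = p (F (Suc n) - F n)"
      unfolding p_def by (rule ext) (simp add: sum_diff F F_mono)
    then have "(l2_norm M (\<lambda>x. p (F (Suc n)) x - p (F n) x))\<^sup>2 = sum q (F (Suc n) - F n)"
      using norm_p[of "F (Suc n) - F n"] F by auto
    also have "\<dots> = sum q (F (Suc n)) - sum q (F n)" by (simp add: sum_diff F F_mono)
    finally show ?thesis using le_s[OF F, of "Suc n"] sF[of n] by linarith
  qed
  obtain g where g: "g \<in> L2 M" "(\<lambda>n. l2_norm M (\<lambda>x. p (F n) x - g x)) \<longlonglongrightarrow> 0"
    by (rule L2_complete[of "\<lambda>n. p (F n)" M, OF p[OF F(2)] step]) blast
  have "l2_inner M (\<lambda>x. f x - g x) e = 0" if e: "e \<in> A" for e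
  proof -
    have eL: "e \<in> L2 M" "l2_norm M e = 1"
      using e AL AO[OF e e] l2_norm_nonneg[of M e] by (auto simp: l2_inner_self power2_eq_1_iff simp flip: of_real_power)
    have conv1: "(\<lambda>n. l2_inner M (p (F n)) e - l2_inner M g e) \<longlonglongrightarrow> 0"
    proof (rule Lim_null_comparison[OF _ g(2)], intro always_eventually allI)
      fix n
      have "cmod (l2_inner M (\<lambda>x. p (F n) x - g x) e) \<le> l2_norm M (\<lambda>x. p (F n) x - g x) * l2_norm M e"
        using p F g eL by (intro l2_Cauchy_Schwarz) auto
      then show "norm (l2_inner M (p (F n)) e - l2_inner M g e) \<le> l2_norm M (\<lambda>x. p (F n) x - g x)"
        using p F g eL by (simp add: l2_inner_diff_left)
    qed
    have conv2: "(\<lambda>n. c e - l2_inner M (p (F n)) e) \<longlonglongrightarrow> 0"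
    proof (rule Lim_null_comparison)
      show "\<forall>\<^sub>F n in sequentially. norm (c e - l2_inner M (p (F n)) e) \<le> (1 / 2) ^ n"
      proof (intro always_eventually allI)
        fix n
        show "norm (c e - l2_inner M (p (F n)) e) \<le> (1 / 2) ^ n"
        proof (cases "e \<in> F n")
          case False
          \<comment> \<open>A vector outside \<open>F n\<close> can raise the sum by at most the
            remaining \<open>(1 / 4) ^ n\<close>.\<close>
          have "q e + sum q (F n) \<le> s"
            using le_s[of "insert e (F n)"] F e False by simp
          then have "(cmod (c e))\<^sup>2 \<le> (1 / 4) ^ n" using sF[of n] by (simp add: q_def)
          also have "(1 / 4 :: real) ^ n = ((1 / 2) ^ n)\<^sup>2"
          proof -
            have "((1 / 2 :: real) ^ n)\<^sup>2 = ((1 / 2)\<^sup>2) ^ n" by (simp only: power_mult[symmetric] mult.commute)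
            then show ?thesis by (simp add: power2_eq_square)
          qed
          finally have "cmod (c e) \<le> (1 / 2) ^ n" by (rule power2_le_imp_le) simp
          then show ?thesis using False inner_p[OF F e] by simp
        qed (use inner_p[OF F e] in simp)
      qed
      show "(\<lambda>n. (1 / 2 :: real) ^ n) \<longlonglongrightarrow> 0" by (rule LIMSEQ_realpow_zero) auto
    qed
    have "(\<lambda>n::nat. c e - l2_inner M g e) \<longlonglongrightarrow> 0"
      using tendsto_add[OF conv1 conv2] by simp
    then have "c e - l2_inner M g e = 0" by (simp add: LIMSEQ_const_iff)
    then show ?thesis using f g eL by (simp add: l2_inner_diff_left c_def)
  qed
  then have fg: "AE x in M. f x - g x = 0" using f g by (intro AC) auto
  have "(\<lambda>n. (l2_norm M (\<lambda>x. p (F n) x - g x))\<^sup>2) \<longlonglongrightarrow> 0"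
    using tendsto_power[OF g(2), of 2] by simp
  moreover have "(l2_norm M (\<lambda>x. p (F n) x - g x))\<^sup>2 = (l2_norm M f)\<^sup>2 - sum q (F n)" for n
  proof -
    have m: "p (F n) \<in> borel_measurable M" "f \<in> borel_measurable M" "g \<in> borel_measurable M"
      using p F f g by auto
    have "l2_norm M (\<lambda>x. p (F n) x - g x) = l2_norm M (\<lambda>x. (- 1) * (f x - p (F n) x))"
      by (rule l2_norm_cong_AE, use fg in eventually_elim) (use m in \<open>auto simp: algebra_simps\<close>)
    then show ?thesis unfolding l2_norm_scale using rest[OF F] by simp
  qed
  ultimately have lim: "(\<lambda>n. (l2_norm M f)\<^sup>2 - sum q (F n)) \<longlonglongrightarrow> 0" by simp
  have "(l2_norm M f)\<^sup>2 \<le> s"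
  proof (rule ccontr)
    assume "\<not> ?thesis"
    then have "0 < (l2_norm M f)\<^sup>2 - s" by simp
    moreover have "(l2_norm M f)\<^sup>2 - s \<le> 0"
      by (rule tendsto_lowerbound[OF lim]) (use le_s[OF F] in auto)
    ultimately show False by simp
  qed
  moreover have "s \<le> (l2_norm M f)\<^sup>2"
    unfolding s_def using summ Bessel by (intro infsum_le_finite_sums) auto
  ultimately show ?thesis using s unfolding q_def[abs_def] c_def[abs_def] by simp
qed

text \<open>One nonnegative double series of squared matrix entries is summed by rows and by
  columns; Parseval's identity evaluates both. The first claim yields the symmetry of
  \<open>hs\<close>, the second the Hilbert-Schmidt term in the trace of the exterior
  square.\<close>

lemma Hilbert_Schmidt_swap:
  assumes A: "orthonormal_basis M A" and T: "bounded_op M T" and T': "bounded_op M T'"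
    and adj: "\<And>f g. f \<in> L2 M \<Longrightarrow> g \<in> L2 M \<Longrightarrow> l2_inner M (T f) g = l2_inner M f (T' g)"
    and s: "((\<lambda>e. (l2_norm M (T e))\<^sup>2) has_sum s) A"
  shows "((\<lambda>e. (l2_norm M (T' e))\<^sup>2) has_sum s) A"
    and "((\<lambda>(e, e'). (cmod (l2_inner M (T e) e'))\<^sup>2) has_sum s) (A \<times> A)"
proof -
  have AL: "A \<subseteq> L2 M" using A by (simp add: orthonormal_basis_def)
  have row: "((\<lambda>e'. (cmod (l2_inner M (T e) e'))\<^sup>2) has_sum (l2_norm M (T e))\<^sup>2) A" if "e \<in> A" for e
    using that AL T by (intro Parseval[OF A]) auto
  have col: "((\<lambda>e. (cmod (l2_inner M (T e) e'))\<^sup>2) has_sum (l2_norm M (T' e'))\<^sup>2) A" if e': "e' \<in> A" for e'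
  proof -
    have "((\<lambda>e. (cmod (l2_inner M (T' e') e))\<^sup>2) has_sum (l2_norm M (T' e'))\<^sup>2) A"
      using e' AL T' by (intro Parseval[OF A]) auto
    moreover have "(cmod (l2_inner M (T' e') e))\<^sup>2 = (cmod (l2_inner M (T e) e'))\<^sup>2" if "e \<in> A" for e
    proof -
      have "l2_inner M (T' e') e = cnj (l2_inner M (T e) e')"
        using adj[OF subsetD[OF AL that] subsetD[OF AL e']] l2_inner_commute[of M "T' e'" e] by simp
      then show ?thesis by simp
    qed
    ultimately show ?thesis by (simp cong: has_sum_cong)
  qed
  show prod: "((\<lambda>(e, e'). (cmod (l2_inner M (T e) e'))\<^sup>2) has_sum s) (A \<times> A)"
  proof (rule has_sum_SigmaI[where g = "\<lambda>e. (l2_norm M (T e))\<^sup>2"])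
    show "(\<lambda>(e, e'). (cmod (l2_inner M (T e) e'))\<^sup>2) summable_on A \<times> A"
      by (rule summable_on_SigmaI[where g = "\<lambda>e. (l2_norm M (T e))\<^sup>2"])
        (simp_all add: row has_sum_imp_summable[OF s])
  qed (simp_all add: row s)
  have "((\<lambda>(e', e). (cmod (l2_inner M (T e) e'))\<^sup>2) has_sum s) (A \<times> A)"
    using prod[THEN has_sum_swap[THEN iffD1]] by simp
  then show "((\<lambda>e. (l2_norm M (T' e))\<^sup>2) has_sum s) A"
    by (rule has_sum_SigmaD) (simp add: col)
qed


section \<open>Traces of exterior powers and the Fredholm determinant\<close>

lemma l2_basis_L2: "e \<in> l2_basis M \<Longrightarrow> e \<in> L2 M"
  using orthonormal_basis_l2_basis[of M] by (auto simp: orthonormal_basis_def)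

text \<open>\<open>trace_class\<close> gives summability of the diagonal of the absolute value only;
  \<open>positive_op_le_abs\<close> transfers it to \<open>T\<close> itself. Without it
  \<open>op_trace\<close> could be the default value 0.\<close>

lemma trace_class_has_sum:
  assumes T: "positive_op M T" and "trace_class M T"
  shows "((\<lambda>e. Re (l2_inner M (T e) e)) has_sum Re (op_trace M T)) (l2_basis M)"
    and "op_trace M T = of_real (Re (op_trace M T))"
proof -
  obtain S where S: "is_abs_op M T S" "(\<lambda>e. Re (l2_inner M (S e) e)) summable_on l2_basis M"
    using assms by (auto simp: trace_class_def)
  have "(\<lambda>e. Re (l2_inner M (T e) e)) summable_on l2_basis M"
    by (rule summable_on_comparison_test[OF S(2)])
      (auto intro!: positive_op_le_abs[OF T S(1)] positive_opD(3)[OF T] l2_basis_L2)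
  then have 1: "((\<lambda>e. Re (l2_inner M (T e) e)) has_sum infsum (\<lambda>e. Re (l2_inner M (T e) e)) (l2_basis M)) (l2_basis M)"
    (is "(_ has_sum ?s) _") by simp
  have "((\<lambda>e. complex_of_real (Re (l2_inner M (T e) e))) has_sum of_real ?s) (l2_basis M)"
    using 1 by (rule has_sum_of_real)
  moreover have "l2_inner M (T e) e = complex_of_real (Re (l2_inner M (T e) e))" if "e \<in> l2_basis M" for e
    using T that by (intro self_adjoint_inner_real l2_basis_L2) (auto simp: positive_op_def)
  ultimately have "((\<lambda>e. l2_inner M (T e) e) has_sum of_real ?s) (l2_basis M)"
    by (subst has_sum_cong)
  then have "op_trace M T = of_real ?s" unfolding op_trace_def by (rule infsumI)
  with 1 show "((\<lambda>e. Re (l2_inner M (T e) e)) has_sum Re (op_trace M T)) (l2_basis M)"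
    "op_trace M T = of_real (Re (op_trace M T))" by simp_all
qed

text \<open>Splitting off the head of a tuple turns the sum into a nonnegative double series, which
  may be summed by rows.\<close>

lemma prod_list_has_sum:
  fixes f :: "'b \<Rightarrow> real"
  assumes nonneg: "\<And>x. x \<in> A \<Longrightarrow> 0 \<le> f x" and s: "(f has_sum s) A"
  shows "((\<lambda>xs. prod_list (map f xs)) has_sum s ^ n) {xs. length xs = n \<and> set xs \<subseteq> A}"
proof (induction n)
  case 0
  have "{xs. length xs = 0 \<and> set xs \<subseteq> A} = {[]}" by auto
  then show ?case by (simp add: has_sum_finite_iff)
next
  case (Suc n)
  let ?L = "{xs. length xs = n \<and> set xs \<subseteq> A}"
  have nn: "0 \<le> prod_list (map f xs)" if "set xs \<subseteq> A" for xs
    using that nonneg by (induction xs) auto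
  have row: "((\<lambda>xs. f x * prod_list (map f xs)) has_sum f x * s ^ n) ?L" for x
    by (intro has_sum_cmult_right Suc.IH)
  have s': "((\<lambda>x. f x * s ^ n) has_sum s * s ^ n) A" by (intro has_sum_cmult_left s)
  have "((\<lambda>(x, xs). f x * prod_list (map f xs)) has_sum s * s ^ n) (A \<times> ?L)"
  proof (rule has_sum_SigmaI[where g = "\<lambda>x. f x * s ^ n"])
    show "(\<lambda>(x, xs). f x * prod_list (map f xs)) summable_on A \<times> ?L"
      by (rule summable_on_SigmaI[where g = "\<lambda>x. f x * s ^ n"])
        (simp_all add: row has_sum_imp_summable[OF s'] nn nonneg)
  qed (simp_all add: row s')
  moreover have "bij_betw (\<lambda>(x, xs). x # xs) (A \<times> ?L) {xs. length xs = Suc n \<and> set xs \<subseteq> A}"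
    by (rule bij_betwI[where g = "\<lambda>xs. (hd xs, tl xs)"]) (auto simp: length_Suc_conv)
  ultimately show ?case
    by (subst has_sum_reindex_bij_betw[symmetric]) (auto simp: case_prod_unfold)
qed

lemma det_mat_2:
  fixes f :: "nat \<times> nat \<Rightarrow> 'b :: comm_ring_1"
  shows "Determinant.det (Matrix.mat 2 2 f) = f (0, 0) * f (1, 1) - f (0, 1) * f (1, 0)"
proof -
  have "Determinant.det (Matrix.mat 2 2 f) = (\<Sum>j<2. Matrix.mat 2 2 f $$ (0, j) * cofactor (Matrix.mat 2 2 f) 0 j)"
    by (rule laplace_expansion_row) auto
  also have "\<dots> = f (0, 0) * f (1, 1) - f (0, 1) * f (1, 0)"
    by (simp add: numeral_2_eq_2 cofactor_def mat_delete_def det_single)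
  finally show ?thesis .
qed

lemma trace_ext_power_0: "trace_ext_power M 0 S = 1"
proof -
  have L: "{es. length es = 0 \<and> set es \<subseteq> l2_basis M} = {[]}" by auto
  show ?thesis unfolding trace_ext_power_def L by simp
qed

text \<open>Exterior traces depend only on the matrix entries in the chosen basis and are
  homogeneous of degree \<open>n\<close> in them. The identity holds whether or not the sum
  converges.\<close>

lemma trace_ext_power_cmult:
  assumes "\<And>e e'. e \<in> l2_basis M \<Longrightarrow> e' \<in> l2_basis M \<Longrightarrow> l2_inner M (S' e) e' = c * l2_inner M (S e) e'"
  shows "trace_ext_power M n S' = c ^ n * trace_ext_power M n S"
proof -
  let ?L = "{es. length es = n \<and> set es \<subseteq> l2_basis M}"
  have "Determinant.det (Matrix.mat n n (\<lambda>(i, j). l2_inner M (S' (es ! j)) (es ! i))) =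
      c ^ n * Determinant.det (Matrix.mat n n (\<lambda>(i, j). l2_inner M (S (es ! j)) (es ! i)))"
    if "es \<in> ?L" for es
  proof -
    have "Matrix.mat n n (\<lambda>(i, j). l2_inner M (S' (es ! j)) (es ! i)) =
        c \<cdot>\<^sub>m Matrix.mat n n (\<lambda>(i, j). l2_inner M (S (es ! j)) (es ! i))"
      using that by (intro eq_matI) (auto intro!: assms)
    then show ?thesis by simp
  qed
  then have "infsum (\<lambda>es. Determinant.det (Matrix.mat n n (\<lambda>(i, j). l2_inner M (S' (es ! j)) (es ! i)))) ?L =
      infsum (\<lambda>es. c ^ n * Determinant.det (Matrix.mat n n (\<lambda>(i, j). l2_inner M (S (es ! j)) (es ! i)))) ?L"
    by (rule infsum_cong)
  then show ?thesis by (simp add: trace_ext_power_def infsum_cmult_right')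
qed

context
  fixes M :: "'a measure" and T :: "'a operator" and t :: real
  assumes T: "positive_op M T"
    and t: "((\<lambda>e. Re (l2_inner M (T e) e)) has_sum t) (l2_basis M)"
begin

lemma diag_nonneg: "e \<in> l2_basis M \<Longrightarrow> 0 \<le> Re (l2_inner M (T e) e)"
  by (intro positive_opD(3)[OF T] l2_basis_L2)

lemma trace_nonneg: "0 \<le> t"
  using t diag_nonneg by (rule has_sum_nonneg)

text \<open>By Cauchy-Schwarz each entry is at most the geometric mean of two diagonal entries.
  Along a permutation each diagonal entry occurs twice under the root, so all terms of the
  determinant have the same bound, the product of the diagonal. Their number \<open>fact n\<close>
  is cancelled by the normalisation of \<open>trace_ext_power\<close>.\<close>

lemma cmod_det_le:
  assumes "length es = n" "set es \<subseteq> l2_basis M"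
  shows "cmod (Determinant.det (Matrix.mat n n (\<lambda>(i, j). l2_inner M (T (es ! j)) (es ! i))))
    \<le> fact n * prod_list (map (\<lambda>e. Re (l2_inner M (T e) e)) es)"
proof -
  define d where "d i = Re (l2_inner M (T (es ! i)) (es ! i))" for i
  have es: "es ! i \<in> l2_basis M" if "i < n" for i using assms that by auto
  have d: "0 \<le> d i" if "i < n" for i unfolding d_def by (intro diag_nonneg es that)
  have entry: "cmod (l2_inner M (T (es ! j)) (es ! i)) \<le> sqrt (d j) * sqrt (d i)" if "i < n" "j < n" for i j
    unfolding real_sqrt_mult[symmetric] d_def
    by (intro real_le_rsqrt positive_op_Cauchy_Schwarz[OF T] l2_basis_L2 es that)
  let ?P = "{p. p permutes {0..<n}}"
  let ?A = "Matrix.mat n n (\<lambda>(i, j). l2_inner M (T (es ! j)) (es ! i))"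
  have "cmod (Determinant.det ?A) \<le> (\<Sum>p\<in>?P. cmod (signof p * (\<Prod>i = 0..<n. ?A $$ (i, p i))))"
    by (subst det_def'[of _ n]) (auto intro: norm_sum)
  also have "\<dots> \<le> (\<Sum>p\<in>?P. \<Prod>i = 0..<n. d i)"
  proof (intro sum_mono)
    fix p assume "p \<in> ?P"
    then have p: "p permutes {0..<n}" by simp
    have pn: "p i < n" if "i < n" for i using permutes_in_image[OF p, of i] that by simp
    have "cmod (signof p * (\<Prod>i = 0..<n. ?A $$ (i, p i))) = (\<Prod>i = 0..<n. cmod (l2_inner M (T (es ! p i)) (es ! i)))"
      using pn by (simp add: norm_mult prod_norm sign_def)
    also have "\<dots> \<le> (\<Prod>i = 0..<n. sqrt (d (p i)) * sqrt (d i))"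
      using pn by (intro prod_mono) (auto intro: entry)
    also have "\<dots> = (\<Prod>i = 0..<n. sqrt (d (p i))) * (\<Prod>i = 0..<n. sqrt (d i))" by (rule prod.distrib)
    also have "(\<Prod>i = 0..<n. sqrt (d (p i))) = (\<Prod>i = 0..<n. sqrt (d i))"
      using prod.permute[OF p, of "\<lambda>i. sqrt (d i)"] by (simp add: comp_def)
    also have "\<dots> * (\<Prod>i = 0..<n. sqrt (d i)) = (\<Prod>i = 0..<n. d i)"
      using d by (simp flip: prod.distrib)
    finally show "cmod (signof p * (\<Prod>i = 0..<n. ?A $$ (i, p i))) \<le> (\<Prod>i = 0..<n. d i)" .
  qed
  also have "\<dots> = fact n * (\<Prod>i = 0..<n. d i)"
    by (simp add: card_permutations)
  also have "(\<Prod>i = 0..<n. d i) = prod_list (map (\<lambda>e. Re (l2_inner M (T e) e)) es)"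
    using assms(1) by (simp add: d_def prod.list_conv_set_nth)
  finally show ?thesis .
qed

lemma cmod_trace_ext_power_le: "cmod (trace_ext_power M n T) \<le> t ^ n"
proof -
  let ?L = "{es. length es = n \<and> set es \<subseteq> l2_basis M}"
  let ?D = "\<lambda>es. Determinant.det (Matrix.mat n n (\<lambda>(i, j). l2_inner M (T (es ! j)) (es ! i)))"
  have b: "((\<lambda>es. fact n * prod_list (map (\<lambda>e. Re (l2_inner M (T e) e)) es)) has_sum fact n * t ^ n) ?L"
    by (intro has_sum_cmult_right prod_list_has_sum t diag_nonneg)
  have "cmod (infsum ?D ?L) \<le> fact n * t ^ n"
  proof (cases "?D summable_on ?L")
    case True
    then have "(?D has_sum infsum ?D ?L) ?L" by simp
    then show ?thesis using b by (rule norm_infsum_le) (use cmod_det_le in auto)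
  next
    case False
    \<comment> \<open>A divergent sum has the value 0 by convention, so the bound holds here
      too.\<close>
    then show ?thesis using trace_nonneg by (simp add: infsum_not_exists)
  qed
  then show ?thesis by (simp add: trace_ext_power_def norm_divide field_simps)
qed

lemma trace_ext_power_1: "trace_ext_power M 1 T = of_real t"
proof -
  have L: "{es. length es = 1 \<and> set es \<subseteq> l2_basis M} = (\<lambda>e. [e]) ` l2_basis M"
    by (auto simp: length_Suc_conv)
  have "trace_ext_power M 1 T = (\<Sum>\<^sub>\<infinity>e\<in>l2_basis M. l2_inner M (T e) e)"
    unfolding trace_ext_power_def L
    by (subst infsum_reindex) (auto simp: inj_on_def comp_def det_single)
  also have "\<dots> = (\<Sum>\<^sub>\<infinity>e\<in>l2_basis M. complex_of_real (Re (l2_inner M (T e) e)))"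
    using T by (intro infsum_cong self_adjoint_inner_real l2_basis_L2) (simp_all add: positive_op_def)
  also have "\<dots> = of_real t" by (intro infsumI has_sum_of_real t)
  finally show ?thesis .
qed

lemma op_trace_power2:
  assumes h: "((\<lambda>e. (l2_norm M (T e))\<^sup>2) has_sum h) (l2_basis M)"
  shows "op_trace M (T ^^ 2) = of_real h"
proof -
  have "op_trace M (T ^^ 2) = (\<Sum>\<^sub>\<infinity>e\<in>l2_basis M. complex_of_real ((l2_norm M (T e))\<^sup>2))"
    unfolding op_trace_def
  proof (intro infsum_cong)
    fix e assume "e \<in> l2_basis M"
    then have "e \<in> L2 M" "T e \<in> L2 M" using l2_basis_L2 positive_opD(1)[OF T] by auto
    then show "l2_inner M ((T ^^ 2) e) e = complex_of_real ((l2_norm M (T e))\<^sup>2)"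
      using positive_opD(2)[OF T, of "T e" e] by (simp add: numeral_2_eq_2 l2_inner_self)
  qed
  also have "\<dots> = of_real h" by (intro infsumI has_sum_of_real h)
  finally show ?thesis .
qed

text \<open>Each 2 by 2 minor is a product of diagonal entries minus the squared modulus of an
  off-diagonal entry; over all pairs these sum to \<open>t\<^sup>2\<close> and to the squared
  Hilbert-Schmidt norm \<open>h\<close>.\<close>

lemma trace_ext_power_2:
  assumes h: "((\<lambda>e. (l2_norm M (T e))\<^sup>2) has_sum h) (l2_basis M)"
  shows "trace_ext_power M 2 T = of_real ((t\<^sup>2 - h) / 2)"
proof -
  let ?A = "l2_basis M"
  let ?d = "\<lambda>e. Re (l2_inner M (T e) e)"
  have bij: "bij_betw (\<lambda>(e, e'). [e, e']) (?A \<times> ?A) {es. length es = 2 \<and> set es \<subseteq> ?A}"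
    by (rule bij_betwI[where g = "\<lambda>es. (es ! 0, es ! 1)"]) (auto simp: numeral_2_eq_2 length_Suc_conv)
  have "((\<lambda>es. prod_list (map ?d es)) has_sum t\<^sup>2) {es. length es = 2 \<and> set es \<subseteq> ?A}"
    by (intro prod_list_has_sum t diag_nonneg)
  then have 1: "((\<lambda>(e, e'). ?d e * ?d e') has_sum t\<^sup>2) (?A \<times> ?A)"
    by (subst (asm) has_sum_reindex_bij_betw[OF bij, symmetric]) (auto simp: case_prod_unfold)
  have 2: "((\<lambda>(e, e'). (cmod (l2_inner M (T e) e'))\<^sup>2) has_sum h) (?A \<times> ?A)"
    by (rule Hilbert_Schmidt_swap(2)[OF orthonormal_basis_l2_basis positive_opD(1)[OF T] positive_opD(1)[OF T] _ h])
      (rule positive_opD(2)[OF T])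
  have 3: "((\<lambda>x. (case x of (e, e') \<Rightarrow> ?d e * ?d e') - (case x of (e, e') \<Rightarrow> (cmod (l2_inner M (T e) e'))\<^sup>2))
      has_sum t\<^sup>2 - h) (?A \<times> ?A)"
    using has_sum_add[OF 1 has_sum_uminusI[OF 2]] by simp
  have "infsum (\<lambda>es. Determinant.det (Matrix.mat 2 2 (\<lambda>(i, j). l2_inner M (T (es ! j)) (es ! i))))
      {es. length es = 2 \<and> set es \<subseteq> ?A} =
    infsum (\<lambda>(e, e'). complex_of_real (?d e * ?d e' - (cmod (l2_inner M (T e) e'))\<^sup>2)) (?A \<times> ?A)"
  proof (subst infsum_reindex_bij_betw[OF bij, symmetric], intro infsum_cong)
    fix p assume "p \<in> ?A \<times> ?A"
    then obtain e e' where p: "p = (e, e')" "e \<in> L2 M" "e' \<in> L2 M" using l2_basis_L2 by blast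
    have sa: "self_adjoint_op M T" using T by (simp add: positive_op_def)
    have "l2_inner M (T e') e = cnj (l2_inner M (T e) e')"
      using l2_inner_commute[of M "T e'" e] positive_opD(2)[OF T p(2,3)] by simp
    then have "l2_inner M (T e') e * l2_inner M (T e) e' = complex_of_real ((cmod (l2_inner M (T e) e'))\<^sup>2)"
      by (simp only: complex_norm_square mult.commute)
    moreover have "l2_inner M (T e) e * l2_inner M (T e') e' = complex_of_real (?d e * ?d e')"
      unfolding of_real_mult by (intro arg_cong2[where f = "(*)"] self_adjoint_inner_real[OF sa] p)
    ultimately show "Determinant.det (Matrix.mat 2 2 (\<lambda>(i, j). l2_inner M (T ((case p of (e, e') \<Rightarrow> [e, e']) ! j))
        ((case p of (e, e') \<Rightarrow> [e, e']) ! i))) =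
      (case p of (e, e') \<Rightarrow> complex_of_real (?d e * ?d e' - (cmod (l2_inner M (T e) e'))\<^sup>2))"
      by (simp add: p(1) det_mat_2)
  qed
  also have "\<dots> = of_real (t\<^sup>2 - h)"
    using has_sum_of_real[OF 3, where 'a = complex] by (intro infsumI) (simp add: case_prod_unfold)
  finally show ?thesis by (simp add: trace_ext_power_def)
qed

text \<open>The exterior traces of order 0, 1 and 2 are explicit; the others are dominated by a
  geometric series with ratio \<open>x * t\<close>. As the ratio is at most 1/2, the tail is at most
  twice its first term \<open>(x * t) ^ 3\<close>.\<close>

lemma fredholm_det_expansion:
  assumes h: "((\<lambda>e. (l2_norm M (T e))\<^sup>2) has_sum h) (l2_basis M)"
    and S: "\<And>e e'. e \<in> l2_basis M \<Longrightarrow> e' \<in> l2_basis M \<Longrightarrow> l2_inner M (S e) e' = - of_real x * l2_inner M (T e) e'"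
    and x: "0 \<le> x" "x * t \<le> 1 / 2"
  shows "\<bar>Re (fredholm_det M S) - (1 - x * t + x\<^sup>2 * ((t\<^sup>2 - h) / 2))\<bar> \<le> 2 * (x * t) ^ 3"
proof -
  define b where "b n = trace_ext_power M n S" for n
  have b: "b n = (- of_real x) ^ n * trace_ext_power M n T" for n
    unfolding b_def by (rule trace_ext_power_cmult) (rule S)
  have xt: "0 \<le> x * t" using x trace_nonneg by simp
  have bn: "norm (b n) \<le> (x * t) ^ n" for n
    using cmod_trace_ext_power_le[of n] x(1)
    by (simp add: b norm_mult norm_power power_mult_distrib mult_left_mono)
  have geo: "(\<lambda>n. (x * t) ^ 3 * (x * t) ^ n) sums ((x * t) ^ 3 * (1 / (1 - x * t)))"
    by (intro sums_mult geometric_sums) (use xt x in auto)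
  have sb: "summable b"
    by (rule summable_comparison_test'[OF summable_geometric bn]) (use xt x in auto)
  have "norm (b (n + 3)) \<le> (x * t) ^ 3 * (x * t) ^ n" for n
    using bn[of "n + 3"] by (simp add: power_add mult.commute)
  then have "norm (\<Sum>n. b (n + 3)) \<le> (\<Sum>n. (x * t) ^ 3 * (x * t) ^ n)"
    using sums_summable[OF geo] by (intro norm_suminf_le)
  also have "\<dots> = (x * t) ^ 3 * (1 / (1 - x * t))" using geo by (rule sums_unique[symmetric])
  also have "\<dots> \<le> (x * t) ^ 3 * 2"
    using xt x by (intro mult_left_mono zero_le_power) (auto simp: field_simps)
  finally have tail: "norm (\<Sum>n. b (n + 3)) \<le> 2 * (x * t) ^ 3" by simp
  have "fredholm_det M S = (\<Sum>n. b (n + 3)) + (\<Sum>n<3. b n)"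
    unfolding fredholm_det_def b_def[symmetric] using sb by (rule suminf_split_initial_segment)
  moreover have "(\<Sum>n<3. b n) = of_real (1 - x * t + x\<^sup>2 * ((t\<^sup>2 - h) / 2))"
  proof -
    have "b 0 = 1" unfolding b_def by (rule trace_ext_power_0)
    moreover have "b 1 = - of_real (x * t)" unfolding b trace_ext_power_1 by simp
    moreover have "b 2 = of_real (x\<^sup>2 * ((t\<^sup>2 - h) / 2))" unfolding b trace_ext_power_2[OF h] by simp
    moreover have "(\<Sum>n<3. b n) = b 0 + b 1 + b 2" by (simp add: numeral_3_eq_3 numeral_2_eq_2)
    ultimately show ?thesis by simp
  qed
  ultimately have "Re (fredholm_det M S) - (1 - x * t + x\<^sup>2 * ((t\<^sup>2 - h) / 2)) = Re (\<Sum>n. b (n + 3))"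
    by simp
  then show ?thesis using tail abs_Re_le_cmod[of "\<Sum>n. b (n + 3)"] by linarith
qed

end

lemma fredholm_det_zero:
  assumes "\<And>e e'. e \<in> l2_basis M \<Longrightarrow> e' \<in> l2_basis M \<Longrightarrow> l2_inner M (S e) e' = 0"
  shows "fredholm_det M S = 1"
proof -
  have "trace_ext_power M n S = (if n = 0 then 1 else 0)" for n
  proof (cases "n = 0")
    case False
    have "trace_ext_power M n S = 0 ^ n * trace_ext_power M n S"
      by (rule trace_ext_power_cmult) (simp add: assms)
    moreover have "(0::complex) ^ n = 0" using False by simp
    ultimately have "trace_ext_power M n S = 0" by simp
    then show ?thesis using False by simp
  qed (simp add: trace_ext_power_0)
  then show ?thesis
    unfolding fredholm_det_def using suminf_finite[of "{0}" "\<lambda>n::nat. if n = 0 then 1 else 0 :: complex"] by simp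
qed


section \<open>Measure-theoretic preliminaries\<close>

text \<open>The sets over which \<open>h\<close> integrates to 0 form a Dynkin system, complements
  being available because the whole space lies in \<open>G\<close>. So rectangles, or a countable
  family, suffice as test sets.\<close>

lemma AE_zero_if_integral_zero_on_generator:
  fixes h :: "'b \<Rightarrow> complex"
  assumes "sigma_finite_measure M" and h: "integrable M h"
    and G: "Int_stable G" "G \<subseteq> Pow (space M)" "sets M = sigma_sets (space M) G" "space M \<in> G"
    and zero: "\<And>A. A \<in> G \<Longrightarrow> set_lebesgue_integral M A h = 0"
  shows "AE x in M. h x = 0"
proof (rule sigma_finite_measure.density_zero[OF assms(1) h])
  have si: "set_integrable M A h" if "A \<in> sets M" for A
    using h that by (auto simp: set_integrable_def intro: integrable_mult_indicator)
  fix A assume "A \<in> sets M"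
  then have "A \<in> sigma_sets (space M) G" by (simp add: G)
  then show "set_lebesgue_integral M A h = 0"
  proof (induction rule: sigma_sets_induct_disjoint[OF G(1,2), consumes 1, case_names basic empty compl union])
    case (basic A) then show ?case by (rule zero)
  next
    case (compl A)
    then have A: "A \<in> sets M" by (simp add: G)
    have "set_lebesgue_integral M (A \<union> (space M - A)) h =
        set_lebesgue_integral M A h + set_lebesgue_integral M (space M - A) h"
      using A by (intro set_integral_Un si) auto
    moreover have "A \<union> (space M - A) = space M" using sets.sets_into_space[OF A] by auto
    ultimately show ?case using compl zero[OF G(4)] by simp
  next
    case (union A)
    then have A: "A i \<in> sets M" for i using G by auto
    have "set_lebesgue_integral M (\<Union>i. A i) h = (\<Sum>i. set_lebesgue_integral M (A i) h)"
      using A union(1) by (intro lebesgue_integral_countable_add si) (auto simp: disjoint_family_on_def)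
    then show ?case by (simp add: union)
  qed (simp add: set_lebesgue_integral_def)
qed

text \<open>Countability allows the exceptional null sets of all test sets to be united into one, as
  \<open>row_compressed\<close> requires. The whole space arises as the intersection of the empty
  family.\<close>

lemma countable_Int_stable_generator:
  obtains G :: "'a::second_countable_topology set set"
  where "countable G" "Int_stable G" "UNIV \<in> G" "\<And>A. A \<in> G \<Longrightarrow> open A" "sets borel = sigma_sets UNIV G"
proof -
  obtain B :: "'a set set" where B: "countable B" "topological_basis B" using ex_countable_basis by blast
  define G where "G = Inter ` {F. finite F \<and> F \<subseteq> B}"
  have "countable G" unfolding G_def by (intro countable_image countable_Collect_finite_subset B)
  moreover have "Int_stable G"
  proof (rule Int_stableI)
    fix a b assume "a \<in> G" "b \<in> G"
    then obtain F F' where F: "finite F" "F \<subseteq> B" "a = \<Inter>F" "finite F'" "F' \<subseteq> B" "b = \<Inter>F'"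
      by (auto simp: G_def)
    then have "a \<inter> b = \<Inter>(F \<union> F')" by auto
    then show "a \<inter> b \<in> G" unfolding G_def using F by (intro image_eqI[of _ _ "F \<union> F'"]) auto
  qed
  moreover have "UNIV \<in> G" unfolding G_def by (intro image_eqI[of _ _ "{}"]) auto
  moreover have G_open: "open A" if "A \<in> G" for A
    using that B(2) by (auto simp: G_def intro!: open_Inter dest: topological_basis_open)
  moreover have "sets borel = sigma_sets UNIV G"
  proof
    have "B \<subseteq> G" unfolding G_def by (auto intro!: image_eqI[of _ _ "{_}"])
    then have "sigma_sets UNIV B \<subseteq> sigma_sets UNIV G" by (rule sigma_sets_mono')
    moreover have "sets borel = sigma_sets UNIV B" by (simp add: borel_eq_countable_basis[OF B])
    ultimately show "sets borel \<subseteq> sigma_sets UNIV G" by simp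
    have "sigma_sets (space borel) G \<subseteq> sets (borel :: 'a measure)"
      using G_open by (intro sets.sigma_sets_subset) auto
    then show "sigma_sets UNIV G \<subseteq> sets borel" by simp
  qed
  ultimately show ?thesis by (rule that)
qed

locale radon_space = sigma_finite_measure \<mu> for \<mu> :: "'a::{heine_borel, polish_space} measure" +
  assumes radon: "radon_measure \<mu>"
begin

lemma sets_mu [measurable_cong, simp]: "sets \<mu> = sets borel"
  using radon by (simp add: radon_measure_def)

lemma space_mu [simp]: "space \<mu> = UNIV"
  using sets_eq_imp_space_eq[OF sets_mu] by simp

sublocale mm: pair_sigma_finite \<mu> \<mu> ..

lemma sets_mu_pair: "sets (\<mu> \<Otimes>\<^sub>M \<mu>) = sets borel"
  by (simp add: borel_prod[symmetric] cong: sets_pair_measure_cong)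

lemma emeasure_bounded_finite:
  assumes "A \<in> sets borel" "bounded A" shows "emeasure \<mu> A < \<infinity>"
proof -
  have "compact (closure A)" using assms by simp
  then have "emeasure \<mu> (closure A) < \<infinity>" using radon unfolding radon_measure_def by blast
  moreover have "emeasure \<mu> A \<le> emeasure \<mu> (closure A)"
    by (intro emeasure_mono closure_subset) auto
  ultimately show ?thesis by (rule le_less_trans[rotated])
qed

lemma indicator_L2: "A \<in> sets borel \<Longrightarrow> bounded A \<Longrightarrow> indicator A \<in> L2 \<mu>"
  using emeasure_bounded_finite by (intro L2_indicator) auto

lemma self_adjoint_chi: "A \<in> sets borel \<Longrightarrow> self_adjoint_op \<mu> (chi A)"
  unfolding chi_def by (rule self_adjoint_op_mult_op[where C = 1]) (auto simp: indicator_def)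

lemma bounded_op_chi: "A \<in> sets borel \<Longrightarrow> bounded_op \<mu> (chi A)"
  using self_adjoint_chi by (auto simp: self_adjoint_op_def)

section \<open>Product measures with one and two factors, transported to E and to E x E\<close>

lemma integrable_PiM_1:
  fixes \<phi> :: "(nat \<Rightarrow> 'a) \<Rightarrow> complex"
  assumes \<phi>: "integrable (\<Pi>\<^sub>M i\<in>{..<1}. \<mu>) \<phi>"
  shows "integrable \<mu> (\<lambda>x. \<phi> (\<lambda>i\<in>{..<1}. x))"
    "integral\<^sup>L (\<Pi>\<^sub>M i\<in>{..<1}. \<mu>) \<phi> = (\<integral>x. \<phi> (\<lambda>i\<in>{..<1}. x) \<partial>\<mu>)"
proof -
  interpret P: product_sigma_finite "\<lambda>_::nat. \<mu>"
    by (rule product_sigma_finite.intro) (rule sigma_finite_measure_axioms)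
  let ?h = "\<lambda>x. \<lambda>i\<in>{..<1::nat}. x"
  have h: "?h \<in> \<mu> \<rightarrow>\<^sub>M (\<Pi>\<^sub>M i\<in>{..<1}. \<mu>)" by (intro measurable_restrict) auto
  have d: "distr \<mu> (\<Pi>\<^sub>M i\<in>{..<1}. \<mu>) ?h = (\<Pi>\<^sub>M i\<in>{..<1}. \<mu>)"
  proof (rule P.PiM_eqI)
    fix A :: "nat \<Rightarrow> 'a set" assume A: "\<And>i. i \<in> {..<1} \<Longrightarrow> A i \<in> sets \<mu>"
    have "?h -` (Pi\<^sub>E {..<1} A) \<inter> space \<mu> = A 0"
      unfolding space_mu Int_UNIV_right vimage_def by (simp add: PiE_def Pi_def restrict_def extensional_def)
    then show "emeasure (distr \<mu> (\<Pi>\<^sub>M i\<in>{..<1}. \<mu>) ?h) (Pi\<^sub>E {..<1} A) = (\<Prod>i\<in>{..<1}. emeasure \<mu> (A i))"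
      using A h by (subst emeasure_distr) (auto intro!: sets_PiM_I_finite)
  qed auto
  show "integrable \<mu> (\<lambda>x. \<phi> (?h x))"
    using integrable_distr_eq[OF h borel_measurable_integrable[OF \<phi>]] \<phi> unfolding d by blast
  show "integral\<^sup>L (\<Pi>\<^sub>M i\<in>{..<1}. \<mu>) \<phi> = (\<integral>x. \<phi> (?h x) \<partial>\<mu>)"
    using integral_distr[OF h borel_measurable_integrable[OF \<phi>]] unfolding d .
qed

lemma integrable_PiM_2:
  fixes \<phi> :: "(nat \<Rightarrow> 'a) \<Rightarrow> complex"
  assumes \<phi>: "integrable (\<Pi>\<^sub>M i\<in>{..<2}. \<mu>) \<phi>"
  shows "integrable (\<mu> \<Otimes>\<^sub>M \<mu>) (\<lambda>p. \<phi> (\<lambda>i\<in>{..<2}. if i = 0 then fst p else snd p))"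
    "integral\<^sup>L (\<Pi>\<^sub>M i\<in>{..<2}. \<mu>) \<phi> = (\<integral>p. \<phi> (\<lambda>i\<in>{..<2}. if i = 0 then fst p else snd p) \<partial>(\<mu> \<Otimes>\<^sub>M \<mu>))"
proof -
  interpret P: product_sigma_finite "\<lambda>_::nat. \<mu>"
    by (rule product_sigma_finite.intro) (rule sigma_finite_measure_axioms)
  let ?h = "\<lambda>p. \<lambda>i\<in>{..<2::nat}. if i = 0 then fst p else snd p"
  have h: "?h \<in> \<mu> \<Otimes>\<^sub>M \<mu> \<rightarrow>\<^sub>M (\<Pi>\<^sub>M i\<in>{..<2}. \<mu>)" by (intro measurable_restrict) auto
  have d: "distr (\<mu> \<Otimes>\<^sub>M \<mu>) (\<Pi>\<^sub>M i\<in>{..<2}. \<mu>) ?h = (\<Pi>\<^sub>M i\<in>{..<2}. \<mu>)"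
  proof (rule P.PiM_eqI)
    fix A :: "nat \<Rightarrow> 'a set" assume A: "\<And>i. i \<in> {..<2} \<Longrightarrow> A i \<in> sets \<mu>"
    have two: "{..<2::nat} = {0, 1}" by auto
    have "?h -` (Pi\<^sub>E {..<2} A) \<inter> space (\<mu> \<Otimes>\<^sub>M \<mu>) = A 0 \<times> A 1"
    proof (rule Set.set_eqI)
      fix p
      show "p \<in> ?h -` (Pi\<^sub>E {..<2} A) \<inter> space (\<mu> \<Otimes>\<^sub>M \<mu>) \<longleftrightarrow> p \<in> A 0 \<times> A 1"
        unfolding two by (cases p) (simp add: space_pair_measure PiE_iff restrict_def extensional_def)
    qed
    then show "emeasure (distr (\<mu> \<Otimes>\<^sub>M \<mu>) (\<Pi>\<^sub>M i\<in>{..<2}. \<mu>) ?h) (Pi\<^sub>E {..<2} A) = (\<Prod>i\<in>{..<2}. emeasure \<mu> (A i))"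
      using A h by (subst emeasure_distr) (auto intro!: sets_PiM_I_finite simp: emeasure_pair_measure_Times two)
  qed auto
  show "integrable (\<mu> \<Otimes>\<^sub>M \<mu>) (\<lambda>p. \<phi> (?h p))"
    using integrable_distr_eq[OF h borel_measurable_integrable[OF \<phi>]] \<phi> unfolding d by blast
  show "integral\<^sup>L (\<Pi>\<^sub>M i\<in>{..<2}. \<mu>) \<phi> = (\<integral>p. \<phi> (?h p) \<partial>(\<mu> \<Otimes>\<^sub>M \<mu>))"
    using integral_distr[OF h borel_measurable_integrable[OF \<phi>]] unfolding d .
qed

end

section \<open>Kernels extended by zero\<close>

text \<open>Extension by 0 lets all integrals run over the whole space and makes joint measurability
  a statement about the full product.\<close>

definition ext_kernel :: "'a set \<Rightarrow> ('a \<Rightarrow> 'a \<Rightarrow> complex) \<Rightarrow> 'a \<Rightarrow> 'a \<Rightarrow> complex" where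
  "ext_kernel E0 k x y = (if x \<in> E0 \<and> y \<in> E0 then k x y else 0)"

lemma integral_op_ext_kernel: "integral_op M E0 k f x = (\<integral>y. ext_kernel E0 k x y * f y \<partial>M)"
  unfolding integral_op_def set_lebesgue_integral_def
  by (auto simp: ext_kernel_def intro!: Bochner_Integration.integral_cong split: split_indicator)

locale kernel_op = radon_space \<mu> for \<mu> :: "'a::{heine_borel, polish_space} measure" +
  fixes K :: "'a operator" and E0 :: "'a set" and k :: "'a \<Rightarrow> 'a \<Rightarrow> complex"
  assumes adm: "admissible_kernel \<mu> K E0 k" and sa: "self_adjoint_op \<mu> K"
begin

definition kk :: "'a \<Rightarrow> 'a \<Rightarrow> complex" where "kk = ext_kernel E0 k"

lemma E0_measurable [measurable]: "E0 \<in> sets borel"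
  using adm by (simp add: admissible_kernel_def)

lemma AE_E0: "AE x in \<mu>. x \<in> E0"
  using adm by (intro AE_I[where N = "- E0"]) (auto simp: admissible_kernel_def)

lemma kk_measurable [measurable]: "(\<lambda>p. kk (fst p) (snd p)) \<in> borel_measurable (\<mu> \<Otimes>\<^sub>M \<mu>)"
proof -
  have "(\<lambda>(x, y). k x y) \<in> borel_measurable (restrict_space borel (E0 \<times> E0))"
    using adm by (simp add: admissible_kernel_def)
  moreover have "E0 \<times> E0 \<in> sets borel" by (rule borel_Times) measurable
  ultimately have "(\<lambda>p. indicator (E0 \<times> E0) p *\<^sub>R (case p of (x, y) \<Rightarrow> k x y)) \<in> borel_measurable borel"
    by (subst (asm) borel_measurable_restrict_space_iff) auto
  also have "(\<lambda>p. indicator (E0 \<times> E0) p *\<^sub>R (case p of (x, y) \<Rightarrow> k x y)) = (\<lambda>p. kk (fst p) (snd p))"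
    by (auto simp: kk_def ext_kernel_def fun_eq_iff split: split_indicator)
  finally show ?thesis by (simp cong: measurable_cong_sets[OF sets_mu_pair])
qed

lemma kk_measurable' [measurable (raw)]:
  assumes [measurable]: "f \<in> N \<rightarrow>\<^sub>M \<mu>" "g \<in> N \<rightarrow>\<^sub>M \<mu>"
  shows "(\<lambda>x. kk (f x) (g x)) \<in> borel_measurable N"
  using measurable_compose[OF _ kk_measurable, of "\<lambda>x. (f x, g x)"] by simp

lemma AE_integrable_kk: "f \<in> L2 \<mu> \<Longrightarrow> AE x in \<mu>. integrable \<mu> (\<lambda>y. kk x y * f y)"
proof -
  assume "f \<in> L2 \<mu>"
  then have "AE x in \<mu>. set_integrable \<mu> E0 (\<lambda>y. k x y * f y)"
    using adm by (auto simp: admissible_kernel_def)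
  then show ?thesis
  proof eventually_elim
    case (elim x)
    show ?case
    proof (cases "x \<in> E0")
      case True
      have "(\<lambda>y. kk x y * f y) = (\<lambda>y. indicator E0 y *\<^sub>R (k x y * f y))"
        using True by (auto simp: kk_def ext_kernel_def split: split_indicator)
      then show ?thesis using elim by (simp add: set_integrable_def)
    qed (simp add: kk_def ext_kernel_def)
  qed
qed

lemma AE_K_eq: "f \<in> L2 \<mu> \<Longrightarrow> AE x in \<mu>. K f x = (\<integral>y. kk x y * f y \<partial>\<mu>)"
  using adm by (auto simp: admissible_kernel_def op_eq_def integral_op_ext_kernel kk_def)

lemma bounded_K: "bounded_op \<mu> K" using sa by (simp add: self_adjoint_op_def)

text \<open>The trace formula with \<open>n = 1\<close>, where the cyclic successor of 0 is 0 again.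
  It fixes integrals of the kernel along the diagonal, which the operator alone may not see.\<close>

lemma diag_trace:
  assumes A: "A \<in> sets borel" "bounded A"
  shows "integrable \<mu> (\<lambda>x. indicator A x * kk x x)"
    "op_trace \<mu> (chi A \<circ> K \<circ> chi A) = (\<integral>x. indicator A x * kk x x \<partial>\<mu>)"
proof -
  let ?\<phi> = "\<lambda>x. indicator (\<Pi>\<^sub>E i\<in>{..<1}. A \<inter> E0) x *\<^sub>R (\<Prod>i<1. k (x i) (x (Suc i mod 1)))"
  have a: "integrable (\<Pi>\<^sub>M i\<in>{..<1}. \<mu>) ?\<phi>"
    "op_trace \<mu> ((chi A \<circ> K \<circ> chi A) ^^ 1) = integral\<^sup>L (\<Pi>\<^sub>M i\<in>{..<1}. \<mu>) ?\<phi>"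
    using adm A by (auto simp only: admissible_kernel_def set_integrable_def set_lebesgue_integral_def order.refl)
  have e: "?\<phi> (\<lambda>i\<in>{..<1}. x) = indicator A x * kk x x" for x
    by (auto simp: kk_def ext_kernel_def PiE_iff split: split_indicator)
  show "integrable \<mu> (\<lambda>x. indicator A x * kk x x)"
    using integrable_PiM_1(1)[OF a(1)] unfolding e .
  show "op_trace \<mu> (chi A \<circ> K \<circ> chi A) = (\<integral>x. indicator A x * kk x x \<partial>\<mu>)"
    using a(2) integrable_PiM_1(2)[OF a(1)] unfolding e by simp
qed

text \<open>The trace formula with \<open>n = 2\<close>. By hermitian symmetry its integrand is a
  squared modulus almost everywhere, so it computes Hilbert-Schmidt norms from the kernel.\<close>

lemma pair_trace:
  assumes A: "A \<in> sets borel" "bounded A"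
  shows "integrable (\<mu> \<Otimes>\<^sub>M \<mu>) (\<lambda>p. indicator (A \<times> A) p * (kk (fst p) (snd p) * kk (snd p) (fst p)))"
    "op_trace \<mu> ((chi A \<circ> K \<circ> chi A) ^^ 2) =
      (\<integral>p. indicator (A \<times> A) p * (kk (fst p) (snd p) * kk (snd p) (fst p)) \<partial>(\<mu> \<Otimes>\<^sub>M \<mu>))"
proof -
  let ?\<phi> = "\<lambda>x. indicator (\<Pi>\<^sub>E i\<in>{..<2}. A \<inter> E0) x *\<^sub>R (\<Prod>i<2. k (x i) (x (Suc i mod 2)))"
  have "1 \<le> (2::nat)" by simp
  then have a: "integrable (\<Pi>\<^sub>M i\<in>{..<2}. \<mu>) ?\<phi>"
    "op_trace \<mu> ((chi A \<circ> K \<circ> chi A) ^^ 2) = integral\<^sup>L (\<Pi>\<^sub>M i\<in>{..<2}. \<mu>) ?\<phi>"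
    using adm A unfolding admissible_kernel_def set_integrable_def set_lebesgue_integral_def by blast+
  have two: "{..<2::nat} = {0, 1}" by auto
  have e: "?\<phi> (\<lambda>i\<in>{..<2}. if i = 0 then fst p else snd p) =
      indicator (A \<times> A) p * (kk (fst p) (snd p) * kk (snd p) (fst p))" for p
    by (cases p) (auto simp: kk_def ext_kernel_def PiE_iff two split: split_indicator)
  show "integrable (\<mu> \<Otimes>\<^sub>M \<mu>) (\<lambda>p. indicator (A \<times> A) p * (kk (fst p) (snd p) * kk (snd p) (fst p)))"
    using integrable_PiM_2(1)[OF a(1)] unfolding e .
  show "op_trace \<mu> ((chi A \<circ> K \<circ> chi A) ^^ 2) =
      (\<integral>p. indicator (A \<times> A) p * (kk (fst p) (snd p) * kk (snd p) (fst p)) \<partial>(\<mu> \<Otimes>\<^sub>M \<mu>))"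
    using a(2) integrable_PiM_2(2)[OF a(1)] unfolding e by simp
qed

text \<open>
  Self-adjointness gives \<open>\<integral>\<integral> k(x, y) = \<integral>\<integral> cnj (k(y, x))\<close> over rectangles, but k need not be jointly
  integrable; the proof restricts to the sets \<open>F n m\<close> on which it is.
\<close>

lemma hermitian_AE: "AE p in \<mu> \<Otimes>\<^sub>M \<mu>. kk (fst p) (snd p) = cnj (kk (snd p) (fst p))"
proof -
  define z :: 'a where "z = undefined"
  \<comment> \<open>\<open>e n x\<close> is the L1 norm of the row at \<open>x\<close> over a ball.
    It is finite for almost every \<open>x\<close> because the indicator of the ball lies in L2 and
    is thus integrable against almost every row.\<close>
  define e where "e n x = (\<integral>\<^sup>+y. ennreal (cmod (kk x y)) * indicator (ball z (real n)) y \<partial>\<mu>)" for n :: nat and x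
  have [measurable]: "ball z r \<in> sets borel" for r by simp
  have e_meas [measurable]: "e n \<in> borel_measurable \<mu>" for n unfolding e_def by measurable
  define F where "F n m = {x \<in> ball z (real n). e n x \<le> of_nat m}" for n m :: nat
  have F [measurable]: "F n m \<in> sets borel" for n m
  proof -
    have "{x \<in> space \<mu>. e n x \<le> of_nat m} \<in> sets \<mu>"
      by (rule borel_measurable_le[OF e_meas]) simp
    then have "ball z (real n) \<inter> {x. e n x \<le> of_nat m} \<in> sets borel" by simp
    also have "ball z (real n) \<inter> {x. e n x \<le> of_nat m} = F n m" by (auto simp: F_def)
    finally show ?thesis .
  qed
  have Fb: "bounded (F n m)" for n m by (rule bounded_subset[OF bounded_ball]) (auto simp: F_def)
  have e_fin: "AE x in \<mu>. e n x < \<infinity>" for n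
  proof -
    have "AE x in \<mu>. integrable \<mu> (\<lambda>y. kk x y * indicator (ball z (real n)) y)"
      by (intro AE_integrable_kk indicator_L2) auto
    then show ?thesis
    proof eventually_elim
      case (elim x)
      then have "(\<integral>\<^sup>+y. ennreal (cmod (kk x y * indicator (ball z (real n)) y)) \<partial>\<mu>) < \<infinity>"
        by (simp add: integrable_iff_bounded)
      also have "(\<integral>\<^sup>+y. ennreal (cmod (kk x y * indicator (ball z (real n)) y)) \<partial>\<mu>) = e n x"
        unfolding e_def by (intro nn_integral_cong) (auto split: split_indicator)
      finally show ?case .
    qed
  qed
  have on_F: "AE p in \<mu> \<Otimes>\<^sub>M \<mu>. fst p \<in> F n m \<longrightarrow> snd p \<in> F n m \<longrightarrow> kk (fst p) (snd p) = cnj (kk (snd p) (fst p))" for n m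
  proof -
    let ?F = "F n m"
    define q where "q p = indicator (?F \<times> ?F) p * kk (fst p) (snd p)" for p
    have [measurable]: "q \<in> borel_measurable (\<mu> \<Otimes>\<^sub>M \<mu>)" unfolding q_def by measurable
    have "(\<integral>\<^sup>+p. ennreal (cmod (q p)) \<partial>(\<mu> \<Otimes>\<^sub>M \<mu>)) = (\<integral>\<^sup>+x. \<integral>\<^sup>+y. ennreal (cmod (q (x, y))) \<partial>\<mu> \<partial>\<mu>)"
      by (rule nn_integral_fst[symmetric]) measurable
    also have "\<dots> \<le> (\<integral>\<^sup>+x. of_nat m * indicator ?F x \<partial>\<mu>)"
    proof (intro nn_integral_mono)
      fix x
      show "(\<integral>\<^sup>+y. ennreal (cmod (q (x, y))) \<partial>\<mu>) \<le> of_nat m * indicator ?F x"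
      proof (cases "x \<in> ?F")
        case True
        have "(\<integral>\<^sup>+y. ennreal (cmod (q (x, y))) \<partial>\<mu>) \<le> e n x"
          unfolding e_def q_def by (intro nn_integral_mono) (auto simp: F_def split: split_indicator)
        then show ?thesis using True by (auto simp: F_def)
      qed (simp add: q_def)
    qed
    also have "\<dots> = of_nat m * emeasure \<mu> ?F" by (simp add: nn_integral_cmult_indicator)
    also have "\<dots> < \<infinity>"
      using emeasure_bounded_finite[OF F Fb] by (simp add: ennreal_mult_less_top of_nat_less_top)
    finally have qi: "integrable (\<mu> \<Otimes>\<^sub>M \<mu>) q" by (simp add: integrable_iff_bounded)
    have qi': "integrable (\<mu> \<Otimes>\<^sub>M \<mu>) (\<lambda>p. cnj (q (snd p, fst p)))"
      using mm.integrable_product_swap[OF qi] by (simp add: case_prod_unfold)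
    \<comment> \<open>A rectangle integral of the cut kernel is a matrix element of \<open>K\<close>
      between indicators; this is where self-adjointness can enter.\<close>
    have rect: "(\<integral>p. indicator (A1 \<times> A2) p * q p \<partial>(\<mu> \<Otimes>\<^sub>M \<mu>)) =
        l2_inner \<mu> (K (indicator (?F \<inter> A2))) (indicator (?F \<inter> A1))"
      if [measurable]: "A1 \<in> sets borel" "A2 \<in> sets borel" for A1 A2
    proof -
      have ind: "indicator (?F \<inter> A1) \<in> L2 \<mu>" "indicator (?F \<inter> A2) \<in> L2 \<mu>"
        by (intro indicator_L2 bounded_Int; use Fb in simp)+
      have "integrable (\<mu> \<Otimes>\<^sub>M \<mu>) (\<lambda>p. indicator (A1 \<times> A2) p * q p)"
        by (rule Bochner_Integration.integrable_bound[OF qi]) (auto split: split_indicator)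
      then have "(\<integral>p. indicator (A1 \<times> A2) p * q p \<partial>(\<mu> \<Otimes>\<^sub>M \<mu>)) =
          (\<integral>x. \<integral>y. indicator (A1 \<times> A2) (x, y) * q (x, y) \<partial>\<mu> \<partial>\<mu>)"
        by (rule mm.integral_fst'[symmetric])
      also have "\<dots> = (\<integral>x. K (indicator (?F \<inter> A2)) x * cnj (indicator (?F \<inter> A1) x) \<partial>\<mu>)"
      proof (rule integral_cong_AE)
        show "AE x in \<mu>. (\<integral>y. indicator (A1 \<times> A2) (x, y) * q (x, y) \<partial>\<mu>) =
            K (indicator (?F \<inter> A2)) x * cnj (indicator (?F \<inter> A1) x)"
          using AE_K_eq[OF ind(2)]
        proof eventually_elim
          case (elim x)
          have "(\<integral>y. indicator (A1 \<times> A2) (x, y) * q (x, y) \<partial>\<mu>) =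
              (\<integral>y. indicator (?F \<inter> A1) x * (kk x y * indicator (?F \<inter> A2) y) \<partial>\<mu>)"
            by (intro Bochner_Integration.integral_cong) (auto simp: q_def split: split_indicator)
          then show ?case by (simp add: elim indicator_def)
        qed
        show "(\<lambda>x. K (indicator (?F \<inter> A2)) x * cnj (indicator (?F \<inter> A1) x)) \<in> borel_measurable \<mu>"
          using L2_measurable[OF bounded_op_L2[OF bounded_K ind(2)]] by measurable
      qed measurable
      finally show ?thesis by (simp add: l2_inner_def)
    qed
    have "AE p in \<mu> \<Otimes>\<^sub>M \<mu>. q p - cnj (q (snd p, fst p)) = 0"
    proof (rule AE_zero_if_integral_zero_on_generator)
      show "sigma_finite_measure (\<mu> \<Otimes>\<^sub>M \<mu>)" by standard
      show "integrable (\<mu> \<Otimes>\<^sub>M \<mu>) (\<lambda>p. q p - cnj (q (snd p, fst p)))" using qi qi' by simp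
      let ?G = "{a \<times> b |a b. a \<in> sets \<mu> \<and> b \<in> sets \<mu>}"
      show "Int_stable ?G" by (rule Int_stable_pair_measure_generator)
      show "?G \<subseteq> Pow (space (\<mu> \<Otimes>\<^sub>M \<mu>))" by (auto simp: space_pair_measure)
      show "sets (\<mu> \<Otimes>\<^sub>M \<mu>) = sigma_sets (space (\<mu> \<Otimes>\<^sub>M \<mu>)) ?G"
        by (simp add: sets_pair_measure space_pair_measure)
      show "space (\<mu> \<Otimes>\<^sub>M \<mu>) \<in> ?G" unfolding space_pair_measure by blast
      fix A assume "A \<in> ?G"
      then obtain A1 A2 where A: "A = A1 \<times> A2" and [measurable]: "A1 \<in> sets borel" "A2 \<in> sets borel" by auto
      have i1: "integrable (\<mu> \<Otimes>\<^sub>M \<mu>) (\<lambda>p. indicator A p * q p)"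
        unfolding A by (rule Bochner_Integration.integrable_bound[OF qi]) (auto split: split_indicator)
      have i2: "integrable (\<mu> \<Otimes>\<^sub>M \<mu>) (\<lambda>p. indicator A p * cnj (q (snd p, fst p)))"
        unfolding A by (rule Bochner_Integration.integrable_bound[OF qi']) (auto split: split_indicator)
      have L: "indicator (?F \<inter> A1) \<in> L2 \<mu>" "indicator (?F \<inter> A2) \<in> L2 \<mu>"
        by (intro indicator_L2 bounded_Int; use Fb in simp)+
      have "(\<integral>p. indicator A p * cnj (q (snd p, fst p)) \<partial>(\<mu> \<Otimes>\<^sub>M \<mu>)) =
          (\<integral>p. cnj (case p of (x, y) \<Rightarrow> indicator (A2 \<times> A1) (y, x) * q (y, x)) \<partial>(\<mu> \<Otimes>\<^sub>M \<mu>))"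
        unfolding A by (intro Bochner_Integration.integral_cong) (auto simp: indicator_def split: if_splits)
      also have "\<dots> = cnj (\<integral>(x, y). indicator (A2 \<times> A1) (y, x) * q (y, x) \<partial>(\<mu> \<Otimes>\<^sub>M \<mu>))"
        by (rule Bochner_Integration.integral_cnj)
      also have "(\<integral>(x, y). indicator (A2 \<times> A1) (y, x) * q (y, x) \<partial>(\<mu> \<Otimes>\<^sub>M \<mu>)) =
          (\<integral>p. indicator (A2 \<times> A1) p * q p \<partial>(\<mu> \<Otimes>\<^sub>M \<mu>))"
        by (rule mm.integral_product_swap) measurable
      also have "cnj \<dots> = cnj (l2_inner \<mu> (K (indicator (?F \<inter> A1))) (indicator (?F \<inter> A2)))"
        by (subst rect) auto
      also have "\<dots> = l2_inner \<mu> (K (indicator (?F \<inter> A2))) (indicator (?F \<inter> A1))"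
        using self_adjoint_opD(2)[OF sa L(2) L(1)] l2_inner_commute[of \<mu> "indicator (?F \<inter> A2)"] by simp
      also have "\<dots> = (\<integral>p. indicator A p * q p \<partial>(\<mu> \<Otimes>\<^sub>M \<mu>))" unfolding A by (subst rect) auto
      finally have "(\<integral>p. indicator A p * q p - indicator A p * cnj (q (snd p, fst p)) \<partial>(\<mu> \<Otimes>\<^sub>M \<mu>)) = 0"
        using i1 i2 by simp
      moreover have "indicator A p *\<^sub>R (q p - cnj (q (snd p, fst p))) =
          indicator A p * q p - indicator A p * cnj (q (snd p, fst p))" for p
        by (auto split: split_indicator)
      ultimately show "set_lebesgue_integral (\<mu> \<Otimes>\<^sub>M \<mu>) A (\<lambda>p. q p - cnj (q (snd p, fst p))) = 0"
        by (simp add: set_lebesgue_integral_def)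
    qed
    then show ?thesis by eventually_elim (auto simp: q_def)
  qed
  have e_fin': "AE x in \<mu>. \<forall>n. e n x < \<infinity>" using e_fin by (simp add: AE_all_countable)
  have "AE p in \<mu> \<Otimes>\<^sub>M \<mu>. \<forall>n. e n (fst p) < \<infinity>"
  proof (rule mm.AE_pair_measure)
    show "{p \<in> space (\<mu> \<Otimes>\<^sub>M \<mu>). \<forall>n. e n (fst p) < \<infinity>} \<in> sets (\<mu> \<Otimes>\<^sub>M \<mu>)" by measurable
    show "AE x in \<mu>. AE y in \<mu>. \<forall>n. e n (fst (x, y)) < \<infinity>" using e_fin' by eventually_elim simp
  qed
  moreover have "AE p in \<mu> \<Otimes>\<^sub>M \<mu>. \<forall>n. e n (snd p) < \<infinity>"
  proof (rule mm.AE_pair_measure)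
    show "{p \<in> space (\<mu> \<Otimes>\<^sub>M \<mu>). \<forall>n. e n (snd p) < \<infinity>} \<in> sets (\<mu> \<Otimes>\<^sub>M \<mu>)" by measurable
    show "AE x in \<mu>. AE y in \<mu>. \<forall>n. e n (snd (x, y)) < \<infinity>" using e_fin' by simp
  qed
  moreover have "AE p in \<mu> \<Otimes>\<^sub>M \<mu>. \<forall>n m. fst p \<in> F n m \<longrightarrow> snd p \<in> F n m \<longrightarrow> kk (fst p) (snd p) = cnj (kk (snd p) (fst p))"
    using on_F by (simp add: AE_all_countable)
  ultimately show ?thesis
  proof eventually_elim
    case (elim p)
    \<comment> \<open>Both points of almost every pair lie in a common \<open>F n m\<close> once
      \<open>n\<close> and \<open>m\<close> are large.\<close>
    obtain n :: nat where n: "max (dist z (fst p)) (dist z (snd p)) < real n" using reals_Archimedean2 by blast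
    have "max (e n (fst p)) (e n (snd p)) < \<infinity>" using elim by (auto simp: max_def)
    then obtain m :: nat where m: "max (e n (fst p)) (e n (snd p)) < of_nat m"
      by (metis ennreal_Ex_less_of_nat infinity_ennreal_def)
    have "fst p \<in> F n m" "snd p \<in> F n m" using n m by (auto simp: F_def less_imp_le)
    then show ?case using elim(3) by blast
  qed
qed

end


section \<open>Hilbert-Schmidt norms of blocks of K and square-integrability of kernel rows\<close>

lemma (in radon_space) l2_norm_chi_Un:
  assumes [measurable]: "X \<in> sets borel" "Y \<in> sets borel" and "X \<inter> Y = {}" and f: "f \<in> L2 \<mu>"
  shows "(l2_norm \<mu> (chi (X \<union> Y) f))\<^sup>2 = (l2_norm \<mu> (chi X f))\<^sup>2 + (l2_norm \<mu> (chi Y f))\<^sup>2"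
proof -
  have i: "integrable \<mu> (\<lambda>x. (cmod (chi Z f x))\<^sup>2)" if "Z \<in> sets borel" for Z
    using bounded_op_L2[OF bounded_op_chi[OF that] f] by (simp add: L2_iff)
  have "(cmod (chi (X \<union> Y) f x))\<^sup>2 = (cmod (chi X f x))\<^sup>2 + (cmod (chi Y f x))\<^sup>2" for x
    using assms(3) by (auto simp: chi_def mult_op_def split: split_indicator)
  then show ?thesis using i by (simp add: l2_norm_power2)
qed

lemma (in radon_space) l2_norm_chi_le:
  assumes [measurable]: "X \<in> sets borel" and f: "f \<in> L2 \<mu>"
  shows "(l2_norm \<mu> (chi X f))\<^sup>2 \<le> (l2_norm \<mu> f)\<^sup>2"
proof -
  have "chi (X \<union> - X) f = f" by (simp add: chi_def mult_op_def)
  then show ?thesis using l2_norm_chi_Un[of X "- X" f] f by simp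
qed

locale positive_kernel_op = kernel_op +
  assumes pos: "positive_op \<mu> K" and ltc: "locally_trace_class \<mu> K"
begin

definition tr :: "'a set \<Rightarrow> real" where "tr A = Re (op_trace \<mu> (chi A \<circ> K \<circ> chi A))"

definition cut :: "'a set \<Rightarrow> 'a set \<Rightarrow> 'a operator" where "cut X Y = chi X \<circ> K \<circ> chi Y"

text \<open>The squared Hilbert-Schmidt norm of the block \<open>cut X Y\<close>.\<close>

definition hs :: "'a set \<Rightarrow> 'a set \<Rightarrow> real" where
  "hs X Y = (\<Sum>\<^sub>\<infinity>e\<in>l2_basis \<mu>. (l2_norm \<mu> (cut X Y e))\<^sup>2)"

lemma positive_cut: "A \<in> sets borel \<Longrightarrow> positive_op \<mu> (cut A A)"
  unfolding cut_def by (intro positive_op_sandwich self_adjoint_chi pos)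

lemma bounded_cut: "X \<in> sets borel \<Longrightarrow> Y \<in> sets borel \<Longrightarrow> bounded_op \<mu> (cut X Y)"
  unfolding cut_def by (intro bounded_op_comp bounded_op_chi bounded_K)

lemma tr_has_sum:
  assumes "A \<in> sets borel" "bounded A"
  shows "((\<lambda>e. Re (l2_inner \<mu> (cut A A e) e)) has_sum tr A) (l2_basis \<mu>)" "0 \<le> tr A"
    "op_trace \<mu> (cut A A) = of_real (tr A)"
proof -
  have "trace_class \<mu> (cut A A)"
    using ltc assms by (auto simp: locally_trace_class_def cut_def)
  note * = trace_class_has_sum[OF positive_cut[OF assms(1)] this, folded tr_def[unfolded cut_def[symmetric]]]
  show "((\<lambda>e. Re (l2_inner \<mu> (cut A A e) e)) has_sum tr A) (l2_basis \<mu>)"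
    "op_trace \<mu> (cut A A) = of_real (tr A)"
    using * by (simp_all add: tr_def cut_def)
  then show "0 \<le> tr A" using trace_nonneg[OF positive_cut[OF assms(1)]] by blast
qed

text \<open>Dropping the left cut-off and applying \<open>positive_op_norm_le\<close> bounds the
  squared norms by the diagonal of \<open>cut Y Y\<close>. The constant does not depend on
  \<open>X\<close>, which may be unbounded; \<open>NN_strip_finite\<close> relies on this
  uniformity.\<close>

lemma hs_summable:
  "\<exists>c. \<forall>X\<in>sets borel. \<forall>Y\<in>sets borel. bounded Y \<longrightarrow>
    (\<lambda>e. (l2_norm \<mu> (cut X Y e))\<^sup>2) summable_on l2_basis \<mu> \<and> hs X Y \<le> c * tr Y"
proof -
  obtain c where c: "0 < c" "\<And>f. f \<in> L2 \<mu> \<Longrightarrow> l2_norm \<mu> (K f) \<le> c * l2_norm \<mu> f"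
    using bounded_opE[OF bounded_K] by blast
  have "(\<lambda>e. (l2_norm \<mu> (cut X Y e))\<^sup>2) summable_on l2_basis \<mu> \<and> hs X Y \<le> c * tr Y"
    if XY: "X \<in> sets borel" "Y \<in> sets borel" "bounded Y" for X Y
  proof -
    have le: "(l2_norm \<mu> (cut X Y e))\<^sup>2 \<le> c * Re (l2_inner \<mu> (cut Y Y e) e)" if "e \<in> l2_basis \<mu>" for e
    proof -
      have e: "e \<in> L2 \<mu>" using that by (rule l2_basis_L2)
      have Ye: "chi Y e \<in> L2 \<mu>" using bounded_op_chi[OF XY(2)] e by auto
      have KYe: "K (chi Y e) \<in> L2 \<mu>" using bounded_K Ye by auto
      have "(l2_norm \<mu> (cut X Y e))\<^sup>2 \<le> (l2_norm \<mu> (K (chi Y e)))\<^sup>2"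
        unfolding cut_def comp_def by (rule l2_norm_chi_le[OF XY(1) KYe])
      also have "\<dots> \<le> c * Re (l2_inner \<mu> (K (chi Y e)) (chi Y e))"
        by (rule positive_op_norm_le[OF pos c(2) Ye])
      also have "l2_inner \<mu> (K (chi Y e)) (chi Y e) = l2_inner \<mu> (cut Y Y e) e"
        using self_adjoint_opD(2)[OF self_adjoint_chi[OF XY(2)] KYe e] by (simp add: cut_def)
      finally show ?thesis .
    qed
    have s: "((\<lambda>e. c * Re (l2_inner \<mu> (cut Y Y e) e)) has_sum c * tr Y) (l2_basis \<mu>)"
      by (intro has_sum_cmult_right tr_has_sum XY)
    have "(\<lambda>e. (l2_norm \<mu> (cut X Y e))\<^sup>2) summable_on l2_basis \<mu>"
      by (rule summable_on_comparison_test[OF has_sum_imp_summable[OF s] le]) auto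
    moreover from this have "hs X Y \<le> c * tr Y"
      unfolding hs_def infsumI[OF s, symmetric] using has_sum_imp_summable[OF s] le by (intro infsum_mono) auto
    ultimately show ?thesis ..
  qed
  then show ?thesis by blast
qed

lemma hs_has_sum:
  assumes "X \<in> sets borel" "Y \<in> sets borel" "bounded Y"
  shows "((\<lambda>e. (l2_norm \<mu> (cut X Y e))\<^sup>2) has_sum hs X Y) (l2_basis \<mu>)"
  using hs_summable assms unfolding hs_def by (auto intro!: has_sum_infsum)

text \<open>The two blocks are adjoint to each other, so \<open>Hilbert_Schmidt_swap\<close>
  applies.\<close>

lemma hs_commute:
  assumes XY: "X \<in> sets borel" "Y \<in> sets borel" "bounded Y"
  shows "hs Y X = hs X Y"
proof -
  have "l2_inner \<mu> (cut X Y f) g = l2_inner \<mu> f (cut Y X g)" if f: "f \<in> L2 \<mu>" and g: "g \<in> L2 \<mu>" for f g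
  proof -
    have L: "chi Y f \<in> L2 \<mu>" "K (chi Y f) \<in> L2 \<mu>" "chi X g \<in> L2 \<mu>" "K (chi X g) \<in> L2 \<mu>"
      by (intro bounded_op_L2[OF bounded_K] bounded_op_L2[OF bounded_op_chi] XY f g)+
    show ?thesis
      unfolding cut_def comp_def
      by (rule trans[OF self_adjoint_opD(2)[OF self_adjoint_chi[OF XY(1)] L(2) g]
            trans[OF self_adjoint_opD(2)[OF sa L(1,3)] self_adjoint_opD(2)[OF self_adjoint_chi[OF XY(2)] f L(4)]]])
  qed
  then have "((\<lambda>e. (l2_norm \<mu> (cut Y X e))\<^sup>2) has_sum hs X Y) (l2_basis \<mu>)"
    by (intro Hilbert_Schmidt_swap(1)[OF orthonormal_basis_l2_basis bounded_cut bounded_cut _ hs_has_sum] XY)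
  then show ?thesis unfolding hs_def[of Y X] by (rule infsumI)
qed

lemma hs_Un:
  assumes "X \<in> sets borel" "X' \<in> sets borel" "X \<inter> X' = {}" "Y \<in> sets borel" "bounded Y"
  shows "hs (X \<union> X') Y = hs X Y + hs X' Y"
proof -
  have "((\<lambda>e. (l2_norm \<mu> (cut X Y e))\<^sup>2 + (l2_norm \<mu> (cut X' Y e))\<^sup>2) has_sum hs X Y + hs X' Y) (l2_basis \<mu>)"
    by (intro has_sum_add hs_has_sum assms)
  moreover have "(l2_norm \<mu> (cut (X \<union> X') Y e))\<^sup>2 = (l2_norm \<mu> (cut X Y e))\<^sup>2 + (l2_norm \<mu> (cut X' Y e))\<^sup>2"
    if "e \<in> l2_basis \<mu>" for e
    unfolding cut_def comp_def
    by (intro l2_norm_chi_Un assms bounded_op_L2[OF bounded_K] bounded_op_L2[OF bounded_op_chi] l2_basis_L2 that)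
  ultimately have "((\<lambda>e. (l2_norm \<mu> (cut (X \<union> X') Y e))\<^sup>2) has_sum hs X Y + hs X' Y) (l2_basis \<mu>)"
    by (simp cong: has_sum_cong)
  then show ?thesis unfolding hs_def[of "X \<union> X'"] by (rule infsumI)
qed

lemma hs_Un_square:
  assumes BD: "B \<in> sets borel" "bounded B" "D \<in> sets borel" "bounded D" "B \<inter> D = {}"
  shows "hs (B \<union> D) (B \<union> D) = hs B B + 2 * hs D B + hs D D"
proof -
  have C: "B \<union> D \<in> sets borel" "bounded (B \<union> D)" using BD by auto
  have "hs (B \<union> D) (B \<union> D) = hs B (B \<union> D) + hs D (B \<union> D)" by (intro hs_Un BD C)
  also have "hs B (B \<union> D) = hs (B \<union> D) B" by (intro hs_commute BD C)
  also have "hs D (B \<union> D) = hs (B \<union> D) D" by (intro hs_commute BD C)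
  also have "hs (B \<union> D) B = hs B B + hs D B" by (intro hs_Un BD)
  also have "hs (B \<union> D) D = hs B D + hs D D" by (intro hs_Un BD)
  also have "hs B D = hs D B" by (intro hs_commute BD)
  finally show ?thesis by simp
qed

lemma hs_nonneg: "0 \<le> hs X Y"
  unfolding hs_def by (rule infsum_nonneg) simp

text \<open>As a measure, the squared modulus of the kernel is additive over blocks and continuous
  along increasing sets. Its values are compared with \<open>hs\<close>, which is defined from the
  operator.\<close>

definition NN :: "('a \<times> 'a) measure" where
  "NN = density (\<mu> \<Otimes>\<^sub>M \<mu>) (\<lambda>p. ennreal ((cmod (kk (fst p) (snd p)))\<^sup>2))"

lemma sets_NN [measurable_cong]: "sets NN = sets (\<mu> \<Otimes>\<^sub>M \<mu>)" by (simp add: NN_def)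

lemma emeasure_NN:
  assumes "S \<in> sets (\<mu> \<Otimes>\<^sub>M \<mu>)"
  shows "emeasure NN S = (\<integral>\<^sup>+p. ennreal ((cmod (kk (fst p) (snd p)))\<^sup>2) * indicator S p \<partial>(\<mu> \<Otimes>\<^sub>M \<mu>))"
proof -
  have "(\<lambda>p. ennreal ((cmod (kk (fst p) (snd p)))\<^sup>2)) \<in> borel_measurable (\<mu> \<Otimes>\<^sub>M \<mu>)" by measurable
  then show ?thesis unfolding NN_def by (rule emeasure_density[OF _ assms])
qed

lemma Times_sets [measurable]: "X \<in> sets borel \<Longrightarrow> Y \<in> sets borel \<Longrightarrow> X \<times> Y \<in> sets (\<mu> \<Otimes>\<^sub>M \<mu>)"
  by (rule pair_measureI) simp_all

text \<open>The trace of the squared block is on one side its squared Hilbert-Schmidt norm and on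
  the other the integral of \<open>kk x y * kk y x\<close>, whose integrand is the squared modulus
  by hermitian symmetry.\<close>

lemma NN_square:
  assumes A: "A \<in> sets borel" "bounded A"
  shows "emeasure NN (A \<times> A) = ennreal (hs A A)" "op_trace \<mu> (cut A A ^^ 2) = of_real (hs A A)"
proof -
  define g where "g p = indicator (A \<times> A) p * (cmod (kk (fst p) (snd p)))\<^sup>2" for p
  have AA: "A \<times> A \<in> sets (\<mu> \<Otimes>\<^sub>M \<mu>)" by (rule Times_sets[OF A(1) A(1)])
  have g_meas [measurable]: "g \<in> borel_measurable (\<mu> \<Otimes>\<^sub>M \<mu>)" unfolding g_def using AA by measurable
  let ?w = "\<lambda>p. indicator (A \<times> A) p * (kk (fst p) (snd p) * kk (snd p) (fst p))"
  have eq: "AE p in \<mu> \<Otimes>\<^sub>M \<mu>. ?w p = complex_of_real (g p)"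
    using hermitian_AE
  proof eventually_elim
    case (elim p)
    then have "kk (snd p) (fst p) = cnj (kk (fst p) (snd p))" by simp
    then have "kk (fst p) (snd p) * kk (snd p) (fst p) = complex_of_real ((cmod (kk (fst p) (snd p)))\<^sup>2)"
      by (simp only: complex_norm_square)
    then show ?case by (simp add: g_def indicator_def)
  qed
  have wm: "?w \<in> borel_measurable (\<mu> \<Otimes>\<^sub>M \<mu>)" using pair_trace(1)[OF A] by (rule borel_measurable_integrable)
  have gm': "(\<lambda>p. complex_of_real (g p)) \<in> borel_measurable (\<mu> \<Otimes>\<^sub>M \<mu>)" by measurable
  have "integrable (\<mu> \<Otimes>\<^sub>M \<mu>) (\<lambda>p. complex_of_real (g p))"
    using pair_trace(1)[OF A] integrable_cong_AE[OF wm gm' eq] by blast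
  then have gi: "integrable (\<mu> \<Otimes>\<^sub>M \<mu>) g" by (simp add: complex_of_real_integrable_eq)
  have "op_trace \<mu> (cut A A ^^ 2) = (\<integral>p. ?w p \<partial>(\<mu> \<Otimes>\<^sub>M \<mu>))"
    unfolding cut_def by (rule pair_trace(2)[OF A])
  also have "\<dots> = (\<integral>p. complex_of_real (g p) \<partial>(\<mu> \<Otimes>\<^sub>M \<mu>))"
    by (rule integral_cong_AE[OF wm gm' eq])
  also have "\<dots> = of_real (integral\<^sup>L (\<mu> \<Otimes>\<^sub>M \<mu>) g)" by simp
  finally have "op_trace \<mu> (cut A A ^^ 2) = of_real (integral\<^sup>L (\<mu> \<Otimes>\<^sub>M \<mu>) g)" .
  moreover show ot: "op_trace \<mu> (cut A A ^^ 2) = of_real (hs A A)"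
    by (rule op_trace_power2[OF positive_cut[OF A(1)] tr_has_sum(1)[OF A] hs_has_sum[OF A(1) A]])
  ultimately have "hs A A = integral\<^sup>L (\<mu> \<Otimes>\<^sub>M \<mu>) g" by (simp only: of_real_eq_iff)
  moreover have "emeasure NN (A \<times> A) = (\<integral>\<^sup>+p. ennreal (g p) \<partial>(\<mu> \<Otimes>\<^sub>M \<mu>))"
    unfolding emeasure_NN[OF AA] by (intro nn_integral_cong) (simp add: g_def indicator_def)
  moreover have "\<dots> = ennreal (integral\<^sup>L (\<mu> \<Otimes>\<^sub>M \<mu>) g)"
    by (rule nn_integral_eq_integral[OF gi]) (simp add: g_def)
  ultimately show "emeasure NN (A \<times> A) = ennreal (hs A A)" by simp
qed

lemma NN_swap:
  assumes XY [measurable]: "X \<in> sets borel" "Y \<in> sets borel"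
  shows "emeasure NN (X \<times> Y) = emeasure NN (Y \<times> X)"
proof -
  let ?g = "\<lambda>X Y p. ennreal ((cmod (kk (fst p) (snd p)))\<^sup>2) * indicator (X \<times> Y) p"
  note S = Times_sets[OF XY] Times_sets[OF XY(2,1)]
  have "emeasure NN (X \<times> Y) = (\<integral>\<^sup>+p. ?g X Y p \<partial>(\<mu> \<Otimes>\<^sub>M \<mu>))" by (rule emeasure_NN[OF S(1)])
  also have "\<dots> = (\<integral>\<^sup>+p. ?g X Y p \<partial>distr (\<mu> \<Otimes>\<^sub>M \<mu>) (\<mu> \<Otimes>\<^sub>M \<mu>) (\<lambda>(x, y). (y, x)))"
    by (subst mm.distr_pair_swap) simp
  also have "\<dots> = (\<integral>\<^sup>+p. ?g X Y (case p of (x, y) \<Rightarrow> (y, x)) \<partial>(\<mu> \<Otimes>\<^sub>M \<mu>))"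
    using S by (intro nn_integral_distr) measurable
  also have "\<dots> = (\<integral>\<^sup>+p. ?g Y X p \<partial>(\<mu> \<Otimes>\<^sub>M \<mu>))"
    by (intro nn_integral_cong_AE, use hermitian_AE in eventually_elim)
      (auto simp: indicator_def split: prod.splits)
  also have "\<dots> = emeasure NN (Y \<times> X)" by (rule emeasure_NN[OF S(2), symmetric])
  finally show ?thesis .
qed

text \<open>The trace formula speaks of squares \<open>A \<times> A\<close> only. Subtracting the
  squares over \<open>B\<close> and \<open>D\<close> from the one over \<open>B \<union> D\<close>
  leaves the two off-diagonal rectangles, which have equal mass by symmetry.\<close>

lemma NN_off_diagonal:
  assumes BD: "B \<in> sets borel" "bounded B" "D \<in> sets borel" "bounded D" "B \<inter> D = {}"
  shows "emeasure NN (B \<times> D) = ennreal (hs D B)"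
proof -
  let ?C = "B \<union> D"
  have C: "?C \<in> sets borel" "bounded ?C" using BD by auto
  have S: "X \<times> Y \<in> sets NN" if "X \<in> sets borel" "Y \<in> sets borel" for X Y
    unfolding sets_NN using that by (rule Times_sets)
  have "emeasure NN (?C \<times> ?C) = emeasure NN ((B \<times> B \<union> B \<times> D) \<union> (D \<times> B \<union> D \<times> D))"
    by (rule arg_cong[of _ _ "emeasure NN"]) blast
  also have "\<dots> = emeasure NN (B \<times> B \<union> B \<times> D) + emeasure NN (D \<times> B \<union> D \<times> D)"
    by (rule plus_emeasure[symmetric], intro sets.Un S BD, intro sets.Un S BD) (use BD(5) in blast)
  also have "emeasure NN (B \<times> B \<union> B \<times> D) = emeasure NN (B \<times> B) + emeasure NN (B \<times> D)"
    by (rule plus_emeasure[symmetric], intro S BD, intro S BD) (use BD(5) in blast)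
  also have "emeasure NN (D \<times> B \<union> D \<times> D) = emeasure NN (D \<times> B) + emeasure NN (D \<times> D)"
    by (rule plus_emeasure[symmetric], intro S BD, intro S BD) (use BD(5) in blast)
  also have "emeasure NN (D \<times> B) = emeasure NN (B \<times> D)" by (intro NN_swap BD)
  finally have eq: "ennreal (hs ?C ?C) =
      ennreal (hs B B) + emeasure NN (B \<times> D) + (emeasure NN (B \<times> D) + ennreal (hs D D))"
    using NN_square BD C by simp
  \<comment> \<open>The value over \<open>B \<union> D\<close> is finite, which is what permits
    cancellation in \<open>ennreal\<close>.\<close>
  then have "emeasure NN (B \<times> D) \<noteq> \<infinity>" by auto
  then obtain r where r: "0 \<le> r" "emeasure NN (B \<times> D) = ennreal r" by (cases "emeasure NN (B \<times> D)") auto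
  with eq have "ennreal (hs ?C ?C) = ennreal (hs B B + r + (r + hs D D))"
    by (simp add: hs_nonneg flip: ennreal_plus)
  then have "hs ?C ?C = hs B B + r + (r + hs D D)"
    using r hs_nonneg by (subst (asm) ennreal_inj) (auto intro: add_nonneg_nonneg)
  then show ?thesis using hs_Un_square[OF BD] r by simp
qed

text \<open>Off \<open>B\<close> the strip is exhausted by bounded pieces, each of mass at most
  \<open>c * tr B\<close> by the uniform bound of \<open>hs_summable\<close>; over \<open>B\<close>
  itself the mass is a Hilbert-Schmidt norm.\<close>

lemma NN_strip_finite:
  assumes B: "B \<in> sets borel" "bounded B"
  shows "emeasure NN (B \<times> UNIV) < \<infinity>"
proof -
  obtain c where c: "\<forall>X\<in>sets borel. \<forall>Y\<in>sets borel. bounded Y \<longrightarrow>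
    (\<lambda>e. (l2_norm \<mu> (cut X Y e))\<^sup>2) summable_on l2_basis \<mu> \<and> hs X Y \<le> c * tr Y"
    using hs_summable by blast
  define z :: 'a where "z = undefined"
  define D where "D n = ball z (real n) - B" for n :: nat
  have D: "D n \<in> sets borel" "bounded (D n)" "B \<inter> D n = {}" for n
    using B by (auto simp: D_def intro: bounded_subset[OF bounded_ball])
  have S: "X \<times> Y \<in> sets NN" if "X \<in> sets borel" "Y \<in> sets borel" for X Y
    unfolding sets_NN using that by (rule Times_sets)
  have "(\<Union>n. B \<times> D n) = B \<times> - B"
  proof (intro equalityI subsetI)
    fix p assume p: "p \<in> B \<times> - B"
    obtain n :: nat where "dist z (snd p) < real n" using reals_Archimedean2 by blast
    with p show "p \<in> (\<Union>n. B \<times> D n)" by (auto simp: D_def)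
  qed (auto simp: D_def)
  then have "emeasure NN (B \<times> - B) = (SUP n. emeasure NN (B \<times> D n))"
  proof (subst SUP_emeasure_incseq)
    show "range (\<lambda>n. B \<times> D n) \<subseteq> sets NN" using S B(1) D(1) by blast
    show "incseq (\<lambda>n. B \<times> D n)" by (auto simp: incseq_def D_def)
  qed simp
  also have "\<dots> \<le> ennreal (c * tr B)"
  proof (rule SUP_least)
    fix n
    show "emeasure NN (B \<times> D n) \<le> ennreal (c * tr B)"
      unfolding NN_off_diagonal[OF B D] using c D(1)[of n] B by (intro ennreal_leI) blast
  qed
  finally have "emeasure NN (B \<times> - B) < \<infinity>" by (rule le_less_trans) simp
  moreover have "emeasure NN (B \<times> UNIV) = emeasure NN (B \<times> B) + emeasure NN (B \<times> - B)"
  proof -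
    have "emeasure NN (B \<times> UNIV) = emeasure NN (B \<times> B \<union> B \<times> - B)"
      by (rule arg_cong[of _ _ "emeasure NN"]) blast
    also have "\<dots> = emeasure NN (B \<times> B) + emeasure NN (B \<times> - B)"
    proof (rule plus_emeasure[symmetric])
      show "B \<times> B \<in> sets NN" "B \<times> - B \<in> sets NN" using B(1) by (intro S; simp)+
    qed blast
    finally show ?thesis .
  qed
  ultimately show ?thesis by (simp add: NN_square(1)[OF B])
qed

text \<open>Tonelli's theorem on the strip \<open>B \<times> UNIV\<close>. The whole row has to be
  controlled, not only its part in \<open>B\<close>, since \<open>W\<close> acts on all of
  it.\<close>

lemma row_L2:
  assumes B: "B \<in> sets borel" "bounded B"
  shows "AE x in \<mu>. x \<in> B \<longrightarrow> (\<lambda>y. cnj (kk x y)) \<in> L2 \<mu>"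
proof -
  note [measurable] = B(1)
  have BU: "B \<times> UNIV \<in> sets (\<mu> \<Otimes>\<^sub>M \<mu>)" by (rule Times_sets[OF B(1)]) simp
  have "emeasure NN (B \<times> UNIV) =
      (\<integral>\<^sup>+x. \<integral>\<^sup>+y. ennreal ((cmod (kk x y))\<^sup>2) * indicator (B \<times> UNIV) (x, y) \<partial>\<mu> \<partial>\<mu>)"
    unfolding emeasure_NN[OF BU] using BU by (subst nn_integral_fst[symmetric]) auto
  then have "(\<integral>\<^sup>+x. \<integral>\<^sup>+y. ennreal ((cmod (kk x y))\<^sup>2) * indicator (B \<times> UNIV) (x, y) \<partial>\<mu> \<partial>\<mu>) \<noteq> \<infinity>"
    using NN_strip_finite[OF B] by auto
  then have "AE x in \<mu>. (\<integral>\<^sup>+y. ennreal ((cmod (kk x y))\<^sup>2) * indicator (B \<times> UNIV) (x, y) \<partial>\<mu>) \<noteq> \<infinity>"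
    using BU by (intro nn_integral_PInf_AE) measurable
  then show ?thesis
  proof eventually_elim
    case (elim x)
    show ?case
    proof
      assume "x \<in> B"
      with elim have "(\<integral>\<^sup>+y. ennreal ((cmod (kk x y))\<^sup>2) \<partial>\<mu>) < \<infinity>" by (simp add: less_top)
      moreover have "(\<lambda>y. kk x y) \<in> borel_measurable \<mu>" by measurable
      ultimately show "(\<lambda>y. cnj (kk x y)) \<in> L2 \<mu>" by (simp add: L2_iff integrable_iff_bounded)
    qed
  qed
qed

end


section \<open>Point configurations of a determinantal process\<close>

definition occupied :: "'a::metric_space set \<Rightarrow> ('a \<Rightarrow> nat) set" where
  "occupied A = {X \<in> Conf. \<exists>x\<in>A. X x \<noteq> 0}"

text \<open>
  The probability that A contains no point of an independent thinning of X that keeps each point with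
  probability s; the value at \<open>s = 1\<close> is the indicator of having no point in A.
\<close>

definition thin :: "real \<Rightarrow> 'a set \<Rightarrow> ('a \<Rightarrow> nat) \<Rightarrow> real" where
  "thin s A X = (\<Prod>x | x \<in> A \<and> X x \<noteq> 0. (1 - s) ^ X x)"

lemma finite_Conf: "X \<in> Conf \<Longrightarrow> bounded A \<Longrightarrow> finite {x. x \<in> A \<and> X x \<noteq> 0}"
  by (auto simp: Conf_def)

lemma thin_bounds:
  assumes "0 \<le> s" "s \<le> 1" shows "0 \<le> thin s A X" "thin s A X \<le> 1"
  unfolding thin_def using assms by (auto intro!: prod_nonneg prod_le_1 power_le_one)

lemma thin_occupied:
  assumes s: "0 \<le> s" "s \<le> 1" and X: "X \<in> occupied A" and A: "bounded A"
  shows "thin s A X \<le> 1 - s"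
proof -
  obtain x where x: "x \<in> A" "X x \<noteq> 0" and XC: "X \<in> Conf" using X by (auto simp: occupied_def)
  let ?F = "{x. x \<in> A \<and> X x \<noteq> 0}"
  have "thin s A X = (1 - s) ^ X x * (\<Prod>x\<in>?F - {x}. (1 - s) ^ X x)"
    unfolding thin_def using x by (intro prod.remove finite_Conf[OF XC A]) auto
  also have "\<dots> \<le> (1 - s) ^ X x * 1"
    using s by (intro mult_left_mono prod_le_1) (auto intro!: power_le_one)
  also have "(1 - s) ^ X x \<le> (1 - s) ^ 1"
    using s x by (intro power_decreasing) auto
  finally show ?thesis by simp
qed

lemma thin_Un:
  assumes "X \<in> Conf" "bounded A1" "bounded A2" "A1 \<inter> A2 = {}"
  shows "thin s (A1 \<union> A2) X = thin s A1 X * thin s A2 X"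
proof -
  have "{x. x \<in> A1 \<union> A2 \<and> X x \<noteq> 0} = {x. x \<in> A1 \<and> X x \<noteq> 0} \<union> {x. x \<in> A2 \<and> X x \<noteq> 0}" by auto
  then show ?thesis
    unfolding thin_def using assms
    by (simp only:) (intro prod.union_disjoint finite_Conf; auto)
qed

lemma conf_prod_thin:
  assumes "s \<noteq> 0"
  shows "conf_prod (\<lambda>x. complex_of_real (- s) * indicator A x) X = of_real (thin s A X)"
proof -
  have "{x. X x \<noteq> 0 \<and> complex_of_real (- s) * indicator A x \<noteq> 0} = {x. x \<in> A \<and> X x \<noteq> 0}"
    using assms by (auto simp: indicator_def)
  then show ?thesis unfolding conf_prod_def thin_def by (auto simp: intro!: prod.cong)
qed

section \<open>Void probabilities, null points and null pairs\<close>

locale dpp = positive_kernel_op \<mu> K E0 k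
  for \<mu> :: "'a::{heine_borel, polish_space} measure" and K E0 k +
  fixes P :: "('a \<Rightarrow> nat) measure"
  assumes dpp: "determinantal_process \<mu> K P"
begin

sublocale P: prob_space P
  using dpp by (simp add: determinantal_process_def point_process_def)

lemma space_P: "space P = Conf"
  using dpp by (simp add: determinantal_process_def point_process_def)

definition thin_op :: "real \<Rightarrow> 'a set \<Rightarrow> 'a operator" where
  "thin_op s A = (let g = \<lambda>x. complex_of_real (- s) * indicator A x in
     mult_op (\<lambda>x. sgn (g x) * complex_of_real (sqrt (cmod (g x)))) \<circ> K \<circ>
     mult_op (\<lambda>x. complex_of_real (sqrt (cmod (g x)))))"

lemma thin_expectation:
  assumes s: "0 < s" and A: "A \<in> sets borel" "bounded A"
  shows "integrable P (thin s A)" "(\<integral>X. thin s A X \<partial>P) = Re (fredholm_det \<mu> (thin_op s A))"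
proof -
  let ?g = "\<lambda>x. complex_of_real (- s) * indicator A x"
  have "?g \<in> borel_measurable borel" using A by measurable
  moreover have "bounded (range ?g)"
    by (rule boundedI[where B = s]) (use s in \<open>auto simp: indicator_def\<close>)
  moreover have "\<exists>C. compact C \<and> (\<forall>x. x \<notin> C \<longrightarrow> ?g x = 0)"
    using A(2) closure_subset[of A] by (intro exI[of _ "closure A"]) (auto simp: indicator_def)
  ultimately have *: "integrable P (conf_prod ?g)"
    "(\<integral>X. conf_prod ?g X \<partial>P) = fredholm_det \<mu> (thin_op s A)"
    using dpp unfolding determinantal_process_def thin_op_def Let_def by blast+
  have eq: "conf_prod ?g = (\<lambda>X. complex_of_real (thin s A X))"
    by (rule ext, rule conf_prod_thin) (use s in simp)
  show "integrable P (thin s A)"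
    using *(1) unfolding eq by (simp add: complex_of_real_integrable_eq)
  show "(\<integral>X. thin s A X \<partial>P) = Re (fredholm_det \<mu> (thin_op s A))"
    using arg_cong[OF *(2), of Re] unfolding eq by simp
qed

text \<open>On \<open>A\<close> the sign is -1 and the two square roots contribute a factor
  \<open>s\<close>; elsewhere everything vanishes. So only the matrix entries of
  \<open>cut A A\<close> enter the determinant.\<close>

lemma thin_op_inner:
  assumes s: "0 < s" and A: "A \<in> sets borel" and e: "e \<in> L2 \<mu>" "e' \<in> L2 \<mu>"
  shows "l2_inner \<mu> (thin_op s A e) e' = - of_real s * l2_inner \<mu> (cut A A e) e'"
proof -
  let ?r = "complex_of_real (sqrt s)"
  have Ae: "chi A e \<in> L2 \<mu>" using bounded_op_chi[OF A] e by auto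
  have Ae': "chi A e' \<in> L2 \<mu>" using bounded_op_chi[OF A] e by auto
  have KL: "K f \<in> L2 \<mu>" if "f \<in> L2 \<mu>" for f using bounded_K that by auto
  have rAe: "(\<lambda>x. ?r * chi A e x) \<in> L2 \<mu>" using Ae by (rule L2_scale)
  let ?g = "\<lambda>x. complex_of_real (- s) * indicator A x"
  have r: "complex_of_real (sqrt (cmod (?g x))) = ?r * indicator A x" for x
    using s by (cases "x \<in> A") auto
  have r': "sgn (?g x) * (?r * (indicator A x * w)) = - ?r * (indicator A x * w)" for x w
    using s by (cases "x \<in> A") (auto simp: sgn_of_real)
  have "thin_op s A e = (\<lambda>x. (- ?r) * chi A (K (\<lambda>x. ?r * chi A e x)) x)"
    unfolding thin_op_def Let_def comp_def r mult_op_def chi_def mult.assoc by (simp only: r')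
  then have "l2_inner \<mu> (thin_op s A e) e' = (- ?r) * l2_inner \<mu> (chi A (K (\<lambda>x. ?r * chi A e x))) e'"
    by (simp only: l2_inner_scale_left)
  also have "l2_inner \<mu> (chi A (K (\<lambda>x. ?r * chi A e x))) e' = l2_inner \<mu> (K (\<lambda>x. ?r * chi A e x)) (chi A e')"
    by (rule self_adjoint_opD(2)[OF self_adjoint_chi[OF A] KL[OF rAe] e(2)])
  also have "\<dots> = ?r * l2_inner \<mu> (K (chi A e)) (chi A e')"
    by (rule bounded_op_inner_scale[OF bounded_K Ae Ae'])
  also have "l2_inner \<mu> (K (chi A e)) (chi A e') = l2_inner \<mu> (cut A A e) e'"
    using self_adjoint_opD(2)[OF self_adjoint_chi[OF A] KL[OF Ae] e(2)] by (simp add: cut_def)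
  finally have "l2_inner \<mu> (thin_op s A e) e' = - (?r * ?r) * l2_inner \<mu> (cut A A e) e'" by simp
  moreover have "?r * ?r = of_real s" using s by (simp flip: of_real_mult)
  ultimately show ?thesis by simp
qed

lemma thin_expansion:
  assumes s: "0 < s" "s * tr A \<le> 1 / 2" and A: "A \<in> sets borel" "bounded A"
  shows "\<bar>(\<integral>X. thin s A X \<partial>P) - (1 - s * tr A + s\<^sup>2 * (((tr A)\<^sup>2 - hs A A) / 2))\<bar> \<le> 2 * (s * tr A) ^ 3"
  unfolding thin_expectation(2)[OF s(1) A]
  by (rule fredholm_det_expansion[OF positive_cut[OF A(1)] tr_has_sum(1)[OF A] hs_has_sum[OF A(1) A]
        thin_op_inner[OF s(1) A(1) l2_basis_L2 l2_basis_L2] _ s(2)]) (use s in auto)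

text \<open>At \<open>s = 1\<close> every point in \<open>A\<close> contributes a factor 0, so
  occupation is read off from a function whose integrability comes with the process. Measurability
  of \<open>occupied A\<close> follows without recourse to the vague topology.\<close>

lemma occupied_eq: "A \<in> sets borel \<Longrightarrow> bounded A \<Longrightarrow> occupied A = {X \<in> space P. thin 1 A X = 0}"
proof -
  assume A: "A \<in> sets borel" "bounded A"
  have "thin 1 A X = 0 \<longleftrightarrow> (\<exists>x\<in>A. X x \<noteq> 0)" if "X \<in> Conf" for X
  proof -
    have "(\<Prod>x | x \<in> A \<and> X x \<noteq> 0. (1 - 1 :: real) ^ X x) = 0 \<longleftrightarrow>
        (\<exists>x\<in>{x. x \<in> A \<and> X x \<noteq> 0}. (1 - 1 :: real) ^ X x = 0)"
      by (rule prod_zero_iff[OF finite_Conf[OF that A(2)]])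
    then show ?thesis unfolding thin_def by auto
  qed
  then show ?thesis by (auto simp: occupied_def space_P)
qed

lemma occupied_sets [measurable]:
  assumes "A \<in> sets borel" "bounded A" shows "occupied A \<in> sets P"
proof -
  have "thin 1 A \<in> borel_measurable P" using thin_expectation(1)[of 1 A] assms by auto
  then show ?thesis unfolding occupied_eq[OF assms] by measurable
qed

lemma tr_eq: "A \<in> sets borel \<Longrightarrow> bounded A \<Longrightarrow> tr A = (\<integral>x. indicator A x * Re (kk x x) \<partial>\<mu>)"
proof -
  assume A: "A \<in> sets borel" "bounded A"
  have "tr A = Re (\<integral>x. indicator A x * kk x x \<partial>\<mu>)" by (simp add: tr_def diag_trace(2)[OF A])
  also have "\<dots> = (\<integral>x. Re (indicator A x * kk x x) \<partial>\<mu>)"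
    by (rule integral_Re[symmetric, OF diag_trace(1)[OF A]])
  also have "\<dots> = (\<integral>x. indicator A x * Re (kk x x) \<partial>\<mu>)"
    by (intro Bochner_Integration.integral_cong) (auto simp: indicator_def)
  finally show ?thesis .
qed

lemma integrable_diag: "A \<in> sets borel \<Longrightarrow> bounded A \<Longrightarrow> integrable \<mu> (\<lambda>x. indicator A x * Re (kk x x))"
proof -
  assume A: "A \<in> sets borel" "bounded A"
  have "integrable \<mu> (\<lambda>x. Re (indicator A x * kk x x))"
    by (rule integrable_Re[OF diag_trace(1)[OF A]])
  moreover have "Re (indicator A x * kk x x) = indicator A x * Re (kk x x)" for x by (auto simp: indicator_def)
  ultimately show ?thesis by simp
qed

lemma tr_Un:
  assumes A: "A1 \<in> sets borel" "bounded A1" "A2 \<in> sets borel" "bounded A2" "A1 \<inter> A2 = {}"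
  shows "tr (A1 \<union> A2) = tr A1 + tr A2"
proof -
  have "indicator (A1 \<union> A2) x * Re (kk x x) = indicator A1 x * Re (kk x x) + indicator A2 x * Re (kk x x)" for x
    using A(5) by (auto simp: indicator_def)
  then show ?thesis using A integrable_diag by (simp add: tr_eq)
qed

text \<open>
  Since \<open>1 - thin s A \<ge> s\<close> on configurations with a point in A, the probability times \<open>s\<^sup>2\<close> is at most
  the expectation of \<open>(1 - thin s A1) (1 - thin s A2)\<close>, whose expansion starts with the coefficient
  \<open>tr A1 * tr A2 - hs A2 A1\<close> of \<open>s\<^sup>2\<close>.
\<close>

lemma prob_occupied_pair_le:
  assumes A: "A1 \<in> sets borel" "bounded A1" "A2 \<in> sets borel" "bounded A2" "A1 \<inter> A2 = {}"
  shows "P.prob (occupied A1 \<inter> occupied A2) \<le> tr A1 * tr A2"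
proof -
  let ?C = "A1 \<union> A2"
  have C: "?C \<in> sets borel" "bounded ?C" using A by auto
  have t: "0 \<le> tr A1" "0 \<le> tr A2" "0 \<le> tr ?C" by (intro tr_has_sum A C)+
  define p where "p = P.prob (occupied A1 \<inter> occupied A2)"
  \<comment> \<open>Collects the three cubic error terms of \<open>thin_expansion\<close>.\<close>
  define R where "R = 2 * (tr A1 ^ 3 + tr A2 ^ 3 + tr ?C ^ 3)"
  have bound: "p \<le> tr A1 * tr A2 + s * R" if s: "0 < s" "s \<le> 1" "s * tr ?C \<le> 1 / 2" for s
  proof -
    have s1: "s * tr A1 \<le> 1 / 2" "s * tr A2 \<le> 1 / 2"
      using s t tr_Un[OF A] by (auto simp: distrib_left) (smt (verit) mult_nonneg_nonneg)+
    have i: "integrable P (thin s A1)" "integrable P (thin s A2)" "integrable P (thin s ?C)"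
      using thin_expectation(1)[OF s(1)] A C by auto
    have O: "occupied A1 \<inter> occupied A2 \<in> sets P" using A by auto
    have "s\<^sup>2 * p = (\<integral>X. s\<^sup>2 * indicator (occupied A1 \<inter> occupied A2) X \<partial>P)"
      using O by (simp add: p_def sets.Int_space_eq2)
    also have "\<dots> \<le> (\<integral>X. 1 - thin s A1 X - thin s A2 X + thin s ?C X \<partial>P)"
    proof (rule integral_mono)
      show "integrable P (\<lambda>X. s\<^sup>2 * indicator (occupied A1 \<inter> occupied A2) X)"
        using O by (intro integrable_mult_right integrable_real_indicator) (auto simp: P.emeasure_eq_measure)
      show "integrable P (\<lambda>X. 1 - thin s A1 X - thin s A2 X + thin s ?C X)"
        using i by auto
      fix X assume "X \<in> space P"
      then have X: "X \<in> Conf" by (simp add: space_P)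
      \<comment> \<open>Inclusion-exclusion: multiplicativity over disjoint sets factors the
        integrand.\<close>
      have e: "1 - thin s A1 X - thin s A2 X + thin s ?C X = (1 - thin s A1 X) * (1 - thin s A2 X)"
        using thin_Un[OF X A(2,4,5)] by (simp add: algebra_simps)
      have nn: "0 \<le> (1 - thin s A1 X) * (1 - thin s A2 X)"
        using thin_bounds(2)[of s] s by (intro mult_nonneg_nonneg) auto
      show "s\<^sup>2 * indicator (occupied A1 \<inter> occupied A2) X \<le> 1 - thin s A1 X - thin s A2 X + thin s ?C X"
      proof (cases "X \<in> occupied A1 \<inter> occupied A2")
        case True
        then have "thin s A1 X \<le> 1 - s" "thin s A2 X \<le> 1 - s"
          using thin_occupied[of s X] s A by auto
        then have "s * s \<le> (1 - thin s A1 X) * (1 - thin s A2 X)"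
          using s by (intro mult_mono) auto
        then show ?thesis using True by (simp add: e power2_eq_square)
      qed (use nn e in simp)
    qed
    also have "\<dots> = 1 - (\<integral>X. thin s A1 X \<partial>P) - (\<integral>X. thin s A2 X \<partial>P) + (\<integral>X. thin s ?C X \<partial>P)"
      using i by (simp add: P.prob_space)
    also have "\<dots> \<le> s\<^sup>2 * (tr A1 * tr A2 - hs A2 A1) + s ^ 3 * R"
    proof -
      \<comment> \<open>All terms of order 0 and 1 cancel; in order 2 the squares cancel and
        \<open>hs_Un_square\<close> leaves only the mixed terms.\<close>
      have "1 - (1 - s * tr A1 + s\<^sup>2 * (((tr A1)\<^sup>2 - hs A1 A1) / 2)) - (1 - s * tr A2 + s\<^sup>2 * (((tr A2)\<^sup>2 - hs A2 A2) / 2))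
          + (1 - s * tr ?C + s\<^sup>2 * (((tr ?C)\<^sup>2 - hs ?C ?C) / 2)) = s\<^sup>2 * (tr A1 * tr A2 - hs A2 A1)"
        unfolding hs_Un_square[OF A] tr_Un[OF A] by (simp add: power2_eq_square field_simps)
      moreover have "s ^ 3 * R = 2 * (s * tr A1) ^ 3 + 2 * (s * tr A2) ^ 3 + 2 * (s * tr ?C) ^ 3"
        by (simp add: R_def power_mult_distrib distrib_left)
      ultimately show ?thesis
        using thin_expansion[OF s(1) s1(1) A(1,2)] thin_expansion[OF s(1) s1(2) A(3,4)]
          thin_expansion[OF s(1,3) C] unfolding abs_le_iff by linarith
    qed
    also have "\<dots> \<le> s\<^sup>2 * (tr A1 * tr A2 + s * R)"
      using mult_nonneg_nonneg[OF zero_le_power2[of s] hs_nonneg[of A2 A1]]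
      by (simp add: algebra_simps power2_eq_square power3_eq_cube)
    finally show ?thesis using s by simp
  qed
  have "p \<le> tr A1 * tr A2"
  proof (rule field_le_epsilon)
    fix e :: real assume e: "0 < e"
    have R: "0 \<le> R" using t by (simp add: R_def)
    \<comment> \<open>The three bounds ensure in turn \<open>s \<le> 1\<close>,
      \<open>s * tr ?C \<le> 1 / 2\<close> and \<open>s * R \<le> e\<close>; adding 1 keeps the
      denominators positive.\<close>
    define s where "s = min 1 (min (1 / (2 * (tr ?C + 1))) (e / (R + 1)))"
    have s: "0 < s" "s \<le> 1" "s \<le> 1 / (2 * (tr ?C + 1))" "s \<le> e / (R + 1)"
      using t e R by (auto simp: s_def)
    have "s * tr ?C \<le> 1 / (2 * (tr ?C + 1)) * tr ?C" using s t by (intro mult_right_mono) auto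
    also have "\<dots> \<le> 1 / 2" using t by (simp add: field_simps)
    finally have "p \<le> tr A1 * tr A2 + s * R" using bound s by blast
    moreover have "s * R \<le> e / (R + 1) * R" using s R by (intro mult_right_mono) auto
    moreover have "\<dots> \<le> e" using R e by (simp add: field_simps)
    ultimately show "p \<le> tr A1 * tr A2 + e" by linarith
  qed
  then show ?thesis by (simp add: p_def)
qed

text \<open>Over a null set the cut operator is 0, so the Fredholm determinant is 1, and at
  \<open>s = 1\<close> this is the probability of having no point there.\<close>

lemma AE_avoids_null:
  assumes N: "N \<in> sets borel" "bounded N" "emeasure \<mu> N = 0"
  shows "AE X in P. \<forall>x\<in>N. X x = 0"
proof -
  have "l2_inner \<mu> (thin_op 1 N e) e' = 0" if e: "e \<in> l2_basis \<mu>" "e' \<in> l2_basis \<mu>" for e e'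
  proof -
    have L: "e \<in> L2 \<mu>" "e' \<in> L2 \<mu>" using e l2_basis_L2 by auto
    have 0: "AE x in \<mu>. cut N N e x = 0"
      using N by (intro AE_I[where N = N]) (auto simp: cut_def chi_def mult_op_def indicator_def)
    have "l2_inner \<mu> (cut N N e) e' = l2_inner \<mu> (\<lambda>_. 0) e'"
      using bounded_op_L2[OF bounded_cut[OF N(1) N(1)] L(1)] L 0 by (intro l2_inner_cong_AE) auto
    then show ?thesis using thin_op_inner[of 1 N e e'] N L by simp
  qed
  then have "fredholm_det \<mu> (thin_op 1 N) = 1" by (rule fredholm_det_zero)
  then have "(\<integral>X. thin 1 N X \<partial>P) = 1" using thin_expectation(2)[of 1 N] N by simp
  then have "(\<integral>X. 1 - thin 1 N X \<partial>P) = 0"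
    using thin_expectation(1)[of 1 N] N by (simp add: P.prob_space)
  moreover have "integrable P (\<lambda>X. 1 - thin 1 N X)" using thin_expectation(1)[of 1 N] N by simp
  ultimately have "AE X in P. 1 - thin 1 N X = 0"
    using thin_bounds(2)[of 1 N] by (subst (asm) integral_nonneg_eq_0_iff_AE) auto
  then show ?thesis
  proof (rule AE_mp, intro AE_I2 impI)
    fix X assume "X \<in> space P" "1 - thin 1 N X = 0"
    then have "X \<notin> occupied N" using occupied_eq[OF N(1,2)] by auto
    then show "\<forall>x\<in>N. X x = 0" using \<open>X \<in> space P\<close> by (auto simp: occupied_def space_P)
  qed
qed

text \<open>The intensity of the process on \<open>B\<close>. The absolute value makes it a measure
  without first showing that the diagonal is nonnegative; only upper bounds are drawn from
  it.\<close>

definition diag_measure :: "'a set \<Rightarrow> 'a measure" where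
  "diag_measure B = density \<mu> (\<lambda>x. ennreal (indicator B x * \<bar>Re (kk x x)\<bar>))"

context
  fixes B :: "'a set"
  assumes B: "B \<in> sets borel" "bounded B"
begin

lemma sets_diag [measurable_cong, simp]: "sets (diag_measure B) = sets borel"
  by (simp add: diag_measure_def)

lemma space_diag [simp]: "space (diag_measure B) = UNIV"
  by (simp add: diag_measure_def)

lemma diag_density_measurable [measurable]:
  "(\<lambda>x. indicator B x * \<bar>Re (kk x x)\<bar>) \<in> borel_measurable \<mu>"
  using B by measurable

lemma tr_le_diag:
  assumes A: "A \<in> sets borel" "A \<subseteq> B"
  shows "ennreal (tr A) \<le> emeasure (diag_measure B) A"
proof -
  have Ab: "bounded A" using A B bounded_subset by blast
  have ia: "integrable \<mu> (\<lambda>x. \<bar>indicator A x * Re (kk x x)\<bar>)"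
    using integrable_diag[OF A(1) Ab] by (rule integrable_abs)
  have "tr A \<le> (\<integral>x. \<bar>indicator A x * Re (kk x x)\<bar> \<partial>\<mu>)"
    unfolding tr_eq[OF A(1) Ab] by (intro integral_mono integrable_diag[OF A(1) Ab] ia) auto
  then have "ennreal (tr A) \<le> ennreal (\<integral>x. \<bar>indicator A x * Re (kk x x)\<bar> \<partial>\<mu>)" by (rule ennreal_leI)
  also have "\<dots> = (\<integral>\<^sup>+x. ennreal \<bar>indicator A x * Re (kk x x)\<bar> \<partial>\<mu>)"
    by (rule nn_integral_eq_integral[symmetric, OF ia]) auto
  also have "\<dots> = (\<integral>\<^sup>+x. ennreal (indicator B x * \<bar>Re (kk x x)\<bar>) * indicator A x \<partial>\<mu>)"
    using A(2) by (intro nn_integral_cong) (auto simp: indicator_def)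
  also have "\<dots> = emeasure (diag_measure B) A"
    unfolding diag_measure_def by (rule emeasure_density[symmetric]) (use A in \<open>auto intro: diag_density_measurable\<close>)
  finally show ?thesis .
qed

lemma finite_diag: "finite_measure (diag_measure B)"
proof
  have ia: "integrable \<mu> (\<lambda>x. \<bar>indicator B x * Re (kk x x)\<bar>)"
    using integrable_diag[OF B] by (rule integrable_abs)
  have "emeasure (diag_measure B) (space (diag_measure B)) = (\<integral>\<^sup>+x. ennreal (indicator B x * \<bar>Re (kk x x)\<bar>) * indicator UNIV x \<partial>\<mu>)"
    unfolding diag_measure_def by (subst emeasure_density) (auto intro: diag_density_measurable)
  also have "\<dots> = (\<integral>\<^sup>+x. ennreal \<bar>indicator B x * Re (kk x x)\<bar> \<partial>\<mu>)"
    by (intro nn_integral_cong) (auto simp: abs_mult)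
  also have "\<dots> = ennreal (\<integral>x. \<bar>indicator B x * Re (kk x x)\<bar> \<partial>\<mu>)"
    by (rule nn_integral_eq_integral[OF ia]) auto
  finally show "emeasure (diag_measure B) (space (diag_measure B)) \<noteq> \<infinity>" by simp
qed

text \<open>
  The finitely many rectangles are not disjoint; refining them to the atoms of the algebras generated
  by the U i and by the V i makes the bound for pairs additive.
\<close>

lemma prob_rectangles_le:
  fixes U V :: "nat \<Rightarrow> 'a set"
  assumes [measurable]: "\<And>i. U i \<in> sets borel" "\<And>i. V i \<in> sets borel"
    and UB: "\<And>i. U i \<subseteq> B" and VB: "\<And>i. V i \<subseteq> B" and disj: "\<And>i. U i \<inter> V i = {}"
  shows "emeasure P (\<Union>i\<le>n. occupied (U i) \<inter> occupied (V i)) \<le>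
    emeasure (diag_measure B \<Otimes>\<^sub>M diag_measure B) (\<Union>i\<le>n. U i \<times> V i)"
proof -
  let ?\<nu> = "diag_measure B"
  interpret \<nu>: finite_measure ?\<nu> by (rule finite_diag)
  interpret \<nu>\<nu>: pair_sigma_finite ?\<nu> ?\<nu> ..
  define a where "a W S = {x \<in> B. {i. i \<le> n \<and> x \<in> W i} = S}" for W :: "nat \<Rightarrow> 'a set" and S
  \<comment> \<open>A common index \<open>i\<close> of \<open>S\<close> and \<open>T\<close> places
    the product of the two atoms inside \<open>U i \<times> V i\<close>. It also makes the atoms
    disjoint, as \<open>prob_occupied_pair_le\<close> requires.\<close>
  define J where "J = {(S, T). S \<subseteq> {..n} \<and> T \<subseteq> {..n} \<and> S \<inter> T \<noteq> {}}"
  have "J \<subseteq> Pow {..n} \<times> Pow {..n}" by (auto simp: J_def)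
  then have J: "finite J" by (rule finite_subset) simp
  have a_sets: "a W S \<in> sets borel" if W: "\<And>i. W i \<in> sets borel" for W :: "nat \<Rightarrow> 'a set" and S
  proof (cases "S \<subseteq> {..n}")
    case True
    have "a W S = B \<inter> (\<Inter>i\<in>{..n}. if i \<in> S then W i else - W i)"
      using True
      by (auto simp: a_def split: if_splits)
    also have "\<dots> \<in> sets borel" using B W by (intro sets.Int sets.finite_INT) auto
    finally show ?thesis .
  next
    case False
    then have "a W S = {}" by (auto simp: a_def)
    then show ?thesis by simp
  qed
  have aB: "a W S \<subseteq> B" for W S by (auto simp: a_def)
  have ab: "bounded (a W S)" for W S by (rule bounded_subset[OF B(2) aB])
  have a_disj: "a U S \<inter> a V T = {}" if "(S, T) \<in> J" for S T
    using that disj by (auto simp: a_def J_def)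
  have sub: "(\<Union>i\<le>n. occupied (U i) \<inter> occupied (V i)) \<subseteq> (\<Union>(S, T)\<in>J. occupied (a U S) \<inter> occupied (a V T))"
  proof
    fix X assume "X \<in> (\<Union>i\<le>n. occupied (U i) \<inter> occupied (V i))"
    then obtain i x y where i: "i \<le> n" "X \<in> Conf" "x \<in> U i" "X x \<noteq> 0" "y \<in> V i" "X y \<noteq> 0"
      by (auto simp: occupied_def)
    define S where "S = {i. i \<le> n \<and> x \<in> U i}"
    define T where "T = {i. i \<le> n \<and> y \<in> V i}"
    have "(S, T) \<in> J" using i by (auto simp: J_def S_def T_def)
    moreover have "x \<in> a U S" "y \<in> a V T" using i UB VB by (auto simp: a_def S_def T_def)
    ultimately show "X \<in> (\<Union>(S, T)\<in>J. occupied (a U S) \<inter> occupied (a V T))"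
      using i by (auto simp: occupied_def intro!: bexI[of _ "(S, T)"])
  qed
  have oa: "occupied (a U S) \<inter> occupied (a V T) \<in> sets P" for S T
    using a_sets ab by (intro sets.Int occupied_sets) auto
  have "emeasure P (\<Union>i\<le>n. occupied (U i) \<inter> occupied (V i)) \<le>
      emeasure P (\<Union>p\<in>J. occupied (a U (fst p)) \<inter> occupied (a V (snd p)))"
    using sub oa J by (intro emeasure_mono) (auto simp: case_prod_unfold)
  also have "\<dots> \<le> (\<Sum>p\<in>J. emeasure P (occupied (a U (fst p)) \<inter> occupied (a V (snd p))))"
    using oa by (intro emeasure_subadditive_finite J) auto
  also have "\<dots> \<le> (\<Sum>p\<in>J. emeasure (?\<nu> \<Otimes>\<^sub>M ?\<nu>) (a U (fst p) \<times> a V (snd p)))"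
  proof (rule sum_mono)
    fix p assume "p \<in> J"
    then have d: "a U (fst p) \<inter> a V (snd p) = {}" by (intro a_disj) simp
    have "emeasure P (occupied (a U (fst p)) \<inter> occupied (a V (snd p))) \<le> ennreal (tr (a U (fst p)) * tr (a V (snd p)))"
      unfolding P.emeasure_eq_measure using a_sets ab d by (intro ennreal_leI prob_occupied_pair_le) auto
    also have "\<dots> = ennreal (tr (a U (fst p))) * ennreal (tr (a V (snd p)))"
      using a_sets ab by (intro ennreal_mult tr_has_sum) auto
    also have "\<dots> \<le> emeasure ?\<nu> (a U (fst p)) * emeasure ?\<nu> (a V (snd p))"
      using a_sets aB by (intro mult_mono tr_le_diag) auto
    also have "\<dots> = emeasure (?\<nu> \<Otimes>\<^sub>M ?\<nu>) (a U (fst p) \<times> a V (snd p))"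
      using a_sets by (intro \<nu>.emeasure_pair_measure_Times[symmetric]) auto
    finally show "emeasure P (occupied (a U (fst p)) \<inter> occupied (a V (snd p))) \<le>
        emeasure (?\<nu> \<Otimes>\<^sub>M ?\<nu>) (a U (fst p) \<times> a V (snd p))" .
  qed
  also have "\<dots> = emeasure (?\<nu> \<Otimes>\<^sub>M ?\<nu>) (\<Union>p\<in>J. a U (fst p) \<times> a V (snd p))"
  proof (rule sum_emeasure[OF _ _ J])
    show "(\<lambda>p. a U (fst p) \<times> a V (snd p)) ` J \<subseteq> sets (?\<nu> \<Otimes>\<^sub>M ?\<nu>)"
      using a_sets by (auto intro!: pair_measureI)
    show "disjoint_family_on (\<lambda>p. a U (fst p) \<times> a V (snd p)) J"
      by (auto simp: disjoint_family_on_def a_def)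
  qed
  also have "(\<Union>p\<in>J. a U (fst p) \<times> a V (snd p)) \<subseteq> (\<Union>i\<le>n. U i \<times> V i)"
  proof
    fix w assume "w \<in> (\<Union>p\<in>J. a U (fst p) \<times> a V (snd p))"
    then obtain S T where ST: "(S, T) \<in> J" "fst w \<in> a U S" "snd w \<in> a V T" by auto
    then obtain i where "i \<in> S" "i \<in> T" by (auto simp: J_def)
    then show "w \<in> (\<Union>i\<le>n. U i \<times> V i)" using ST(2,3) by (auto simp: a_def mem_Times_iff)
  qed
  then have "emeasure (?\<nu> \<Otimes>\<^sub>M ?\<nu>) (\<Union>p\<in>J. a U (fst p) \<times> a V (snd p)) \<le> emeasure (?\<nu> \<Otimes>\<^sub>M ?\<nu>) (\<Union>i\<le>n. U i \<times> V i)"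
    by (intro emeasure_mono sets.finite_UN pair_measureI) auto
  finally show ?thesis .
qed

text \<open>By outer regularity \<open>N\<close> lies in an open set \<open>G\<close> of small mass.
  Off the diagonal \<open>G\<close> is a countable union of products of disjoint basis sets, and
  \<open>prob_rectangles_le\<close> bounds any finite number of them by the mass of
  \<open>G\<close>.\<close>

lemma AE_avoids_null_pairs:
  assumes N: "N \<in> sets (\<mu> \<Otimes>\<^sub>M \<mu>)" "emeasure (\<mu> \<Otimes>\<^sub>M \<mu>) N = 0" "N \<subseteq> B \<times> B"
  shows "AE X in P. \<forall>x y. x \<noteq> y \<longrightarrow> X x \<noteq> 0 \<longrightarrow> X y \<noteq> 0 \<longrightarrow> (x, y) \<notin> N"
proof -
  let ?\<nu> = "diag_measure B"
  interpret \<nu>: finite_measure ?\<nu> by (rule finite_diag)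
  interpret \<nu>\<nu>: pair_sigma_finite ?\<nu> ?\<nu> ..
  interpret fp: finite_measure "?\<nu> \<Otimes>\<^sub>M ?\<nu>"
  proof
    have "emeasure (?\<nu> \<Otimes>\<^sub>M ?\<nu>) (space (?\<nu> \<Otimes>\<^sub>M ?\<nu>)) = emeasure ?\<nu> (space ?\<nu>) * emeasure ?\<nu> (space ?\<nu>)"
      unfolding space_pair_measure by (rule \<nu>.emeasure_pair_measure_Times[OF sets.top sets.top])
    then show "emeasure (?\<nu> \<Otimes>\<^sub>M ?\<nu>) (space (?\<nu> \<Otimes>\<^sub>M ?\<nu>)) \<noteq> \<infinity>"
      by (simp add: ennreal_mult_eq_top_iff)
  qed
  have sets_pair: "sets (?\<nu> \<Otimes>\<^sub>M ?\<nu>) = sets borel"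
    by (simp add: borel_prod[symmetric] cong: sets_pair_measure_cong)
  have N': "N \<in> sets (?\<nu> \<Otimes>\<^sub>M ?\<nu>)" using N(1) by (simp add: sets_pair sets_mu_pair)
  \<comment> \<open>The product of the diagonal measures is absolutely continuous with respect to
    \<open>\<mu> \<Otimes>\<^sub>M \<mu>\<close>.\<close>
  have null: "emeasure (?\<nu> \<Otimes>\<^sub>M ?\<nu>) N = 0"
  proof -
    have "AE p in \<mu> \<Otimes>\<^sub>M \<mu>. p \<notin> N" using N by (intro AE_not_in) (simp add: null_sets_def)
    then have "AE x in \<mu>. AE y in \<mu>. (x, y) \<notin> N" by (rule mm.AE_pair)
    then have "AE x in ?\<nu>. AE y in ?\<nu>. (x, y) \<notin> N"
      unfolding diag_measure_def by (subst AE_density, measurable)+ (auto intro: AE_mp)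
    then have "AE p in ?\<nu> \<Otimes>\<^sub>M ?\<nu>. p \<notin> N"
    proof (rule \<nu>\<nu>.AE_pair_measure[rotated])
      have "{p \<in> space (?\<nu> \<Otimes>\<^sub>M ?\<nu>). p \<notin> N} = space (?\<nu> \<Otimes>\<^sub>M ?\<nu>) - N" by auto
      then show "{p \<in> space (?\<nu> \<Otimes>\<^sub>M ?\<nu>). p \<notin> N} \<in> sets (?\<nu> \<Otimes>\<^sub>M ?\<nu>)"
        using sets.compl_sets[OF N'] by simp
    qed
    then show ?thesis using N' by (subst (asm) AE_iff_measurable[OF N']) (auto simp: space_pair_measure)
  qed
  \<comment> \<open>The set of bad configurations itself is not known to be measurable, so it is
    enclosed in events of arbitrarily small probability.\<close>
  have "\<exists>Z. Z \<in> sets P \<and> emeasure P Z \<le> ennreal (1 / real (Suc m)) \<and>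
      (\<forall>X\<in>Conf. (\<exists>x y. x \<noteq> y \<and> X x \<noteq> 0 \<and> X y \<noteq> 0 \<and> (x, y) \<in> N) \<longrightarrow> X \<in> Z)" for m
  proof -
    have "(INF G\<in>{G. N \<subseteq> G \<and> open G}. emeasure (?\<nu> \<Otimes>\<^sub>M ?\<nu>) G) < ennreal (1 / real (Suc m))"
      using outer_regular[of "?\<nu> \<Otimes>\<^sub>M ?\<nu>" N] sets_pair N' null fp.emeasure_finite by simp
    then obtain G where G: "N \<subseteq> G" "open G" "emeasure (?\<nu> \<Otimes>\<^sub>M ?\<nu>) G < ennreal (1 / real (Suc m))"
      by (auto simp: INF_less_iff)
    \<comment> \<open>A rectangle that misses the diagonal has disjoint sides.\<close>
    define H where "H = G \<inter> {p. fst p \<noteq> snd p}"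
    have "open H" unfolding H_def
      by (intro open_Int G open_Collect_neq continuous_intros)
    obtain \<B> :: "'a set set" where \<B>: "countable \<B>" "topological_basis \<B>" using ex_countable_basis by blast
    \<comment> \<open>The empty rectangle keeps \<open>R\<close> nonempty, so that it can be
      enumerated.\<close>
    define R where "R = insert ({}, {}) {(b, c). b \<in> \<B> \<and> c \<in> \<B> \<and> b \<times> c \<subseteq> H}"
    have R: "countable R" "R \<noteq> {}"
      unfolding R_def using \<B>(1) by (auto intro: countable_subset[of _ "\<B> \<times> \<B>"])
    define u where "u i = from_nat_into R i" for i
    have u: "u i \<in> R" for i unfolding u_def using R by (intro from_nat_into)
    have u_surj: "\<exists>i. u i = r" if "r \<in> R" for r
      unfolding u_def using from_nat_into_surj[OF R(1) that] .
    define U where "U i = fst (u i) \<inter> B" for i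
    define V where "V i = snd (u i) \<inter> B" for i
    have open_R: "open (fst r)" "open (snd r)" "fst r \<times> snd r \<subseteq> H" if "r \<in> R" for r
      using that topological_basis_open[OF \<B>(2)] by (auto simp: R_def)
    have UV: "U i \<in> sets borel" "V i \<in> sets borel" "U i \<subseteq> B" "V i \<subseteq> B" "U i \<times> V i \<subseteq> H" for i
      using open_R[OF u[of i]] B by (auto simp: U_def V_def)
    have UVd: "U i \<inter> V i = {}" for i using UV(5)[of i] by (auto simp: H_def)
    have UVb: "bounded (U i)" "bounded (V i)" for i using UV(3,4)[of i] B(2) bounded_subset by blast+
    define On where "On n = (\<Union>i\<le>n. occupied (U i) \<inter> occupied (V i))" for n
    have On: "On n \<in> sets P" for n
      unfolding On_def using UV UVb by (intro sets.finite_UN sets.Int occupied_sets) auto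
    have "emeasure P (On n) \<le> ennreal (1 / real (Suc m))" for n
    proof -
      have "emeasure P (On n) \<le> emeasure (?\<nu> \<Otimes>\<^sub>M ?\<nu>) (\<Union>i\<le>n. U i \<times> V i)"
        unfolding On_def by (intro prob_rectangles_le UV UVd)
      also have "\<dots> \<le> emeasure (?\<nu> \<Otimes>\<^sub>M ?\<nu>) G"
      proof (rule emeasure_mono)
        show "(\<Union>i\<le>n. U i \<times> V i) \<subseteq> G" using UV(5) unfolding H_def by blast
        show "G \<in> sets (?\<nu> \<Otimes>\<^sub>M ?\<nu>)" unfolding sets_pair by (rule borel_open[OF G(2)])
      qed
      finally show ?thesis using G(3) by simp
    qed
    moreover have "incseq On" unfolding On_def by (intro monoI UN_mono) auto
    ultimately have "emeasure P (\<Union>n. On n) \<le> ennreal (1 / real (Suc m))"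
      using On by (subst SUP_emeasure_incseq[symmetric]) (auto intro!: SUP_least)
    moreover have "(\<Union>n. On n) \<in> sets P" using On by auto
    moreover have "X \<in> (\<Union>n. On n)"
      if X: "X \<in> Conf" "x \<noteq> y" "X x \<noteq> 0" "X y \<noteq> 0" "(x, y) \<in> N" for X x y
    proof -
      have "(x, y) \<in> H" using X G by (auto simp: H_def)
      then obtain b c where bc: "open b" "open c" "x \<in> b" "y \<in> c" "b \<times> c \<subseteq> H"
        using open_prod_elim[OF \<open>open H\<close>] by (metis mem_Sigma_iff)
      obtain b' c' where b': "b' \<in> \<B>" "x \<in> b'" "b' \<subseteq> b" and c': "c' \<in> \<B>" "y \<in> c'" "c' \<subseteq> c"
        using topological_basisE[OF \<B>(2) bc(1,3)] topological_basisE[OF \<B>(2) bc(2,4)] by metis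
      then have "(b', c') \<in> R" using bc(5) by (auto simp: R_def)
      then obtain i where i: "u i = (b', c')" using u_surj by blast
      have "x \<in> U i" "y \<in> V i" using i b' c' X(5) N(3) by (auto simp: U_def V_def)
      then have "X \<in> On i" using X by (auto simp: On_def occupied_def)
      then show ?thesis by blast
    qed
    ultimately show ?thesis by blast
  qed
  then obtain Z where Z: "\<And>m. Z m \<in> sets P" "\<And>m. emeasure P (Z m) \<le> ennreal (1 / real (Suc m))"
    "\<And>m X. X \<in> Conf \<Longrightarrow> (\<exists>x y. x \<noteq> y \<and> X x \<noteq> 0 \<and> X y \<noteq> 0 \<and> (x, y) \<in> N) \<Longrightarrow> X \<in> Z m" by metis
  have "emeasure P (\<Inter>m. Z m) = 0"
  proof -
    have "emeasure P (\<Inter>m. Z m) \<le> ennreal (1 / real (Suc m))" for m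
      using Z(1) by (intro order.trans[OF emeasure_mono Z(2)]) auto
    moreover have "(\<lambda>m. ennreal (1 / real (Suc m))) \<longlonglongrightarrow> ennreal 0"
      by (intro tendsto_ennrealI LIMSEQ_Suc lim_1_over_n)
    ultimately have "emeasure P (\<Inter>m. Z m) \<le> ennreal 0" by (intro LIMSEQ_le_const) auto
    then show ?thesis by simp
  qed
  show ?thesis
  proof (rule AE_I)
    show "{X \<in> space P. \<not> (\<forall>x y. x \<noteq> y \<longrightarrow> X x \<noteq> 0 \<longrightarrow> X y \<noteq> 0 \<longrightarrow> (x, y) \<notin> N)} \<subseteq> (\<Inter>m. Z m)"
      unfolding space_P using Z(3) by blast
    show "emeasure P (\<Inter>m. Z m) = 0" by fact
    show "(\<Inter>m. Z m) \<in> sets P" using Z(1) by auto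
  qed
qed

end

end


section \<open>Compressions and their kernels\<close>

text \<open>Only \<open>K\<close> carries a point process; \<open>K1\<close> contributes just a
  kernel. \<open>W_on_B\<close> and \<open>W_chi\<close> say that \<open>W\<close> cancels next to
  \<open>chi B\<close> on either side, and they replace all mention of a projection.\<close>

locale compression = dpp \<mu> K E0 k P + C: kernel_op \<mu> K1 E1 k1
  for \<mu> :: "'a::{heine_borel, polish_space} measure" and K E0 k P K1 E1 k1 +
  fixes W :: "'a operator" and B :: "'a set"
  assumes B [measurable]: "B \<in> sets borel" and B_bounded: "bounded B"
    and W: "self_adjoint_op \<mu> W"
    and W_on_B: "f \<in> L2 \<mu> \<Longrightarrow> AE x in \<mu>. x \<in> B \<longrightarrow> W f x = f x"
    and W_chi: "f \<in> L2 \<mu> \<Longrightarrow> AE x in \<mu>. W (chi B f) x = chi B f x"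
    and K1: "op_eq \<mu> K1 (W \<circ> K \<circ> W)"
begin

lemma bounded_W: "bounded_op \<mu> W" using W by (simp add: self_adjoint_op_def)

lemma W_L2: "f \<in> L2 \<mu> \<Longrightarrow> W f \<in> L2 \<mu>" by (rule bounded_op_L2[OF bounded_W])

lemma K_L2: "f \<in> L2 \<mu> \<Longrightarrow> K f \<in> L2 \<mu>" by (rule bounded_op_L2[OF bounded_K])

definition row :: "'a \<Rightarrow> 'a \<Rightarrow> complex" where "row x y = cnj (kk x y)"

lemma inner_row: "l2_inner \<mu> f (row x) = (\<integral>y. kk x y * f y \<partial>\<mu>)"
  by (simp add: l2_inner_def row_def mult.commute)

text \<open>For \<open>x\<close> in \<open>B\<close>, \<open>K1 f x = K (W f) x\<close> is the inner
  product of \<open>W f\<close> with the row at \<open>x\<close>, and moving \<open>W\<close> across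
  gives the row of the second kernel. The null set of \<open>x\<close> depends on \<open>f\<close>,
  hence the countable family of test sets; intersecting them with balls puts their indicators in
  L2.\<close>

lemma row_compressed:
  "AE x in \<mu>. x \<in> B \<longrightarrow> row x \<in> L2 \<mu> \<and> (AE y in \<mu>. cnj (C.kk x y) = W (row x) y)"
proof -
  obtain G :: "'a set set" where G: "countable G" "Int_stable G" "UNIV \<in> G" "\<And>A. A \<in> G \<Longrightarrow> open A"
    "sets borel = sigma_sets UNIV G"
    using countable_Int_stable_generator by blast
  define z :: 'a where "z = undefined"
  have bL: "A \<inter> ball z (real n) \<in> sets borel" "bounded (A \<inter> ball z (real n))" if "A \<in> G" for A n
    using G(4)[OF that] by (auto intro: bounded_subset[OF bounded_ball])
  have iL: "indicator (A \<inter> ball z (real n)) \<in> L2 \<mu>" if "A \<in> G" for A n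
    by (intro indicator_L2 bL that)
  have one: "AE x in \<mu>. x \<in> B \<longrightarrow> integrable \<mu> (\<lambda>y. C.kk x y * f y) \<and>
      (\<integral>y. C.kk x y * f y \<partial>\<mu>) = l2_inner \<mu> (W f) (row x)" if f: "f \<in> L2 \<mu>" for f
  proof -
    have "AE x in \<mu>. K1 f x = W (K (W f)) x" using K1 f by (auto simp: op_eq_def)
    then show ?thesis
      using C.AE_integrable_kk[OF f] C.AE_K_eq[OF f] W_on_B[OF K_L2[OF W_L2[OF f]]] AE_K_eq[OF W_L2[OF f]]
      by eventually_elim (auto simp: inner_row)
  qed
  have "AE x in \<mu>. \<forall>A\<in>G. \<forall>n. x \<in> B \<longrightarrow> integrable \<mu> (\<lambda>y. C.kk x y * indicator (A \<inter> ball z (real n)) y) \<and>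
      (\<integral>y. C.kk x y * indicator (A \<inter> ball z (real n)) y \<partial>\<mu>) = l2_inner \<mu> (W (indicator (A \<inter> ball z (real n)))) (row x)"
    unfolding AE_ball_countable[OF G(1)] AE_all_countable using one[OF iL] by blast
  with row_L2[OF B B_bounded] show ?thesis
  proof eventually_elim
    case (elim x)
    show ?case
    proof
      assume x: "x \<in> B"
      have r: "row x \<in> L2 \<mu>" using elim(1) x by (simp add: row_def[abs_def])
      have Wr: "W (row x) \<in> L2 \<mu>" by (rule W_L2[OF r])
      have zero: "AE y in \<mu>. indicator (ball z (real n)) y * (C.kk x y - cnj (W (row x) y)) = 0" for n
      proof (rule AE_zero_if_integral_zero_on_generator)
        have i: "integrable \<mu> (\<lambda>y. C.kk x y * indicator (A \<inter> ball z (real n)) y)"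
          "integrable \<mu> (\<lambda>y. indicator (A \<inter> ball z (real n)) y * cnj (W (row x) y))"
          "(\<integral>y. C.kk x y * indicator (A \<inter> ball z (real n)) y \<partial>\<mu>) =
            (\<integral>y. indicator (A \<inter> ball z (real n)) y * cnj (W (row x) y) \<partial>\<mu>)" if "A \<in> G" for A
          using elim(2) x that integrable_l2_inner[OF iL[OF that] Wr] self_adjoint_opD(2)[OF W iL[OF that] r]
          by (auto simp: l2_inner_def)
        have e: "C.kk x y * indicator (A \<inter> ball z (real n)) y - indicator (A \<inter> ball z (real n)) y * cnj (W (row x) y)
            = indicator A y *\<^sub>R (indicator (ball z (real n)) y * (C.kk x y - cnj (W (row x) y)))" for A y
          by (auto simp: indicator_def algebra_simps)
        show "sigma_finite_measure \<mu>" by (rule sigma_finite_measure_axioms)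
        show "integrable \<mu> (\<lambda>y. indicator (ball z (real n)) y * (C.kk x y - cnj (W (row x) y)))"
          using Bochner_Integration.integrable_diff[OF i(1,2)[OF G(3)]] unfolding e by simp
        show "set_lebesgue_integral \<mu> A (\<lambda>y. indicator (ball z (real n)) y * (C.kk x y - cnj (W (row x) y))) = 0"
          if "A \<in> G" for A
          unfolding set_lebesgue_integral_def e[symmetric] using i[OF that] by simp
      qed (use G in auto)
      then have "AE y in \<mu>. \<forall>n. indicator (ball z (real n)) y * (C.kk x y - cnj (W (row x) y)) = 0"
        unfolding AE_all_countable by blast
      then have "AE y in \<mu>. cnj (C.kk x y) = W (row x) y"
      proof eventually_elim
        case (elim y)
        obtain n :: nat where "dist z y < real n" using reals_Archimedean2 by blast
        with elim[rule_format, of n] have "C.kk x y = cnj (W (row x) y)" by simp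
        then show ?case by simp
      qed
      with r show "row x \<in> L2 \<mu> \<and> (AE y in \<mu>. cnj (C.kk x y) = W (row x) y)" ..
    qed
  qed
qed

lemma kernels_agree: "AE p in \<mu> \<Otimes>\<^sub>M \<mu>. fst p \<in> B \<longrightarrow> snd p \<in> B \<longrightarrow> kk (fst p) (snd p) = C.kk (fst p) (snd p)"
proof (rule mm.AE_pair_measure)
  show "{p \<in> space (\<mu> \<Otimes>\<^sub>M \<mu>). fst p \<in> B \<longrightarrow> snd p \<in> B \<longrightarrow> kk (fst p) (snd p) = C.kk (fst p) (snd p)}
      \<in> sets (\<mu> \<Otimes>\<^sub>M \<mu>)"
    by measurable
  show "AE x in \<mu>. AE y in \<mu>. fst (x, y) \<in> B \<longrightarrow> snd (x, y) \<in> B \<longrightarrow> kk (fst (x, y)) (snd (x, y)) = C.kk (fst (x, y)) (snd (x, y))"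
    using row_compressed
  proof eventually_elim
    case (elim x)
    show ?case
    proof (cases "x \<in> B")
      case True
      with elim have r: "row x \<in> L2 \<mu>" and a: "AE y in \<mu>. cnj (C.kk x y) = W (row x) y" by auto
      from a W_on_B[OF r] show ?thesis
      proof eventually_elim
        case (elim y)
        then have "y \<in> B \<Longrightarrow> cnj (C.kk x y) = cnj (kk x y)" by (simp add: row_def)
        then show ?case by simp
      qed
    qed simp
  qed
qed

text \<open>The blocks of \<open>K\<close> and \<open>K1\<close> over any Borel part of
  \<open>B\<close> coincide, hence so do their traces and, by the trace formula with
  \<open>n = 1\<close>, the integrals of both diagonals over that part.\<close>

lemma diagonals_agree: "AE x in \<mu>. x \<in> B \<longrightarrow> kk x x = C.kk x x"
proof -
  let ?h = "\<lambda>x. indicator B x * kk x x - indicator B x * C.kk x x"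
  have i: "integrable \<mu> (\<lambda>x. indicator A x * kk x x)" "integrable \<mu> (\<lambda>x. indicator A x * C.kk x x)"
    if "A \<in> sets borel" "bounded A" for A
    using diag_trace(1)[OF that] C.diag_trace(1)[OF that] by auto
  have "AE x in \<mu>. ?h x = 0"
  proof (rule density_zero)
    show "integrable \<mu> ?h" using i[OF B B_bounded] by simp
    fix A assume "A \<in> sets \<mu>"
    then have AB: "A \<inter> B \<in> sets borel" "bounded (A \<inter> B)" using B B_bounded by auto
    have "op_trace \<mu> (chi (A \<inter> B) \<circ> K1 \<circ> chi (A \<inter> B)) = op_trace \<mu> (chi (A \<inter> B) \<circ> K \<circ> chi (A \<inter> B))"
      unfolding op_trace_def
    proof (rule infsum_cong)
      fix e assume "e \<in> l2_basis \<mu>"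
      then have e: "e \<in> L2 \<mu>" by (rule l2_basis_L2)
      let ?f = "chi (A \<inter> B) e"
      have f: "?f \<in> L2 \<mu>" by (rule bounded_op_L2[OF bounded_op_chi[OF AB(1)] e])
      have "chi B ?f = ?f" by (auto simp: chi_def mult_op_def fun_eq_iff indicator_def)
      then have 1: "AE x in \<mu>. W ?f x = ?f x" using W_chi[OF f] by simp
      have 2: "AE x in \<mu>. K (W ?f) x = K ?f x" by (rule bounded_op_cong_AE[OF bounded_K W_L2[OF f] f 1])
      have 3: "AE x in \<mu>. K1 ?f x = W (K (W ?f)) x" using K1 f by (auto simp: op_eq_def)
      have "AE x in \<mu>. chi (A \<inter> B) (K1 ?f) x = chi (A \<inter> B) (K ?f) x"
        using 2 3 W_on_B[OF K_L2[OF W_L2[OF f]]]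
        by eventually_elim (auto simp: chi_def mult_op_def indicator_def)
      moreover have "chi (A \<inter> B) (K1 ?f) \<in> L2 \<mu>" "chi (A \<inter> B) (K ?f) \<in> L2 \<mu>"
        by (intro bounded_op_L2[OF bounded_op_chi[OF AB(1)]] K_L2 f bounded_op_L2[OF C.bounded_K])+
      ultimately show "l2_inner \<mu> ((chi (A \<inter> B) \<circ> K1 \<circ> chi (A \<inter> B)) e) e = l2_inner \<mu> ((chi (A \<inter> B) \<circ> K \<circ> chi (A \<inter> B)) e) e"
        using e by (simp add: l2_inner_cong_AE)
    qed
    then have "(\<integral>x. indicator (A \<inter> B) x * kk x x \<partial>\<mu>) = (\<integral>x. indicator (A \<inter> B) x * C.kk x x \<partial>\<mu>)"
      by (simp add: diag_trace(2)[OF AB] C.diag_trace(2)[OF AB])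
    moreover have "indicator A x *\<^sub>R ?h x = indicator (A \<inter> B) x * kk x x - indicator (A \<inter> B) x * C.kk x x" for x
      by (auto simp: indicator_def)
    ultimately show "set_lebesgue_integral \<mu> A ?h = 0"
      unfolding set_lebesgue_integral_def using i[OF AB] by simp
  qed
  then show ?thesis by eventually_elim (auto simp: indicator_def)
qed

text \<open>All that the Palm operators require of a single point. Rows and columns are listed
  separately because hermitian symmetry holds only almost everywhere.\<close>

definition good :: "'a \<Rightarrow> bool" where
  "good p \<longleftrightarrow> p \<in> E0 \<and> p \<in> E1 \<and> row p \<in> L2 \<mu> \<and> (AE y in \<mu>. kk y p = row p y) \<and>
     (AE y in \<mu>. C.kk y p = W (row p) y) \<and> (AE y in \<mu>. cnj (C.kk p y) = W (row p) y) \<and> kk p p = C.kk p p"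

lemma AE_good: "AE p in \<mu>. p \<in> B \<longrightarrow> good p"
proof -
  have h: "AE p in \<mu>. AE y in \<mu>. kk p y = cnj (kk y p)" using mm.AE_pair[OF hermitian_AE] by simp
  have h1: "AE p in \<mu>. AE y in \<mu>. C.kk p y = cnj (C.kk y p)" using mm.AE_pair[OF C.hermitian_AE] by simp
  show ?thesis
    using h h1 row_compressed diagonals_agree AE_E0 C.AE_E0
  proof eventually_elim
    case (elim p)
    show ?case
    proof
      assume "p \<in> B"
      with elim(3) have c: "AE y in \<mu>. cnj (C.kk p y) = W (row p) y" and r: "row p \<in> L2 \<mu>" by auto
      have "AE y in \<mu>. kk y p = row p y" using elim(1) by eventually_elim (simp add: row_def)
      moreover have "AE y in \<mu>. C.kk y p = W (row p) y" using elim(2) c by eventually_elim simp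
      ultimately show "good p" using c r elim(4-6) \<open>p \<in> B\<close> by (simp add: good_def)
    qed
  qed
qed

lemma AE_points_good:
  "AE X in P. (\<forall>x\<in>B. X x \<noteq> 0 \<longrightarrow> good x) \<and> (\<forall>x\<in>B. \<forall>y\<in>B. X x \<noteq> 0 \<longrightarrow> X y \<noteq> 0 \<longrightarrow> kk x y = C.kk x y)"
proof -
  obtain N where N: "{p \<in> space \<mu>. \<not> (p \<in> B \<longrightarrow> good p)} \<subseteq> N" "emeasure \<mu> N = 0" "N \<in> sets \<mu>"
    using AE_good by (rule AE_E)
  have NB: "N \<inter> B \<in> sets borel" "bounded (N \<inter> B)" "emeasure \<mu> (N \<inter> B) = 0"
    using N B B_bounded emeasure_mono[of "N \<inter> B" N \<mu>] by auto
  let ?M = "{p \<in> space (\<mu> \<Otimes>\<^sub>M \<mu>). \<not> (fst p \<in> B \<longrightarrow> snd p \<in> B \<longrightarrow> kk (fst p) (snd p) = C.kk (fst p) (snd p))}"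
  have M: "?M \<in> sets (\<mu> \<Otimes>\<^sub>M \<mu>)" by measurable
  moreover have "emeasure (\<mu> \<Otimes>\<^sub>M \<mu>) ?M = 0"
    using kernels_agree M by (subst (asm) AE_iff_measurable[OF M refl]) simp
  moreover have "?M \<subseteq> B \<times> B" by (auto simp: mem_Times_iff)
  ultimately have "AE X in P. \<forall>x y. x \<noteq> y \<longrightarrow> X x \<noteq> 0 \<longrightarrow> X y \<noteq> 0 \<longrightarrow> (x, y) \<notin> ?M"
    by (rule AE_avoids_null_pairs[OF B B_bounded])
  with AE_avoids_null[OF NB] show ?thesis
  proof eventually_elim
    case (elim X)
    have g: "good x" if "x \<in> B" "X x \<noteq> 0" for x using elim(1) N(1) that by auto
    moreover have "kk x y = C.kk x y" if "x \<in> B" "y \<in> B" "X x \<noteq> 0" "X y \<noteq> 0" for x y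
      using elim(2) that g by (cases "x = y") (auto simp: good_def space_pair_measure)
    ultimately show ?case by blast
  qed
qed

end


section \<open>Palm kernels as finite-rank perturbations\<close>

text \<open>Expand along the first row, and each resulting minor along its first column.\<close>

lemma kernel_det_Cons:
  fixes k :: "'a \<Rightarrow> 'a \<Rightarrow> complex"
  defines "M ps \<equiv> Matrix.mat (length ps) (length ps) (\<lambda>(i, j). k (ps ! i) (ps ! j))"
  shows "kernel_det k (x # ps) (y # ps) = k x y * kernel_det k ps ps -
    (\<Sum>j<length ps. \<Sum>i<length ps. cofactor (M ps) i j * k x (ps ! j) * k (ps ! i) y)"
proof -
  let ?n = "length ps"
  let ?A = "Matrix.mat (Suc ?n) (Suc ?n) (\<lambda>(i, j). k ((x # ps) ! i) ((y # ps) ! j))"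
  have "Determinant.det ?A = (\<Sum>j<Suc ?n. ?A $$ (0, j) * cofactor ?A 0 j)"
    by (rule laplace_expansion_row) auto
  also have "\<dots> = k x y * cofactor ?A 0 0 + (\<Sum>j<?n. k x (ps ! j) * cofactor ?A 0 (Suc j))"
    by (subst sum.lessThan_Suc_shift) simp
  also have "mat_delete ?A 0 0 = M ps"
    unfolding mat_delete_def M_def by (intro eq_matI) auto
  then have "cofactor ?A 0 0 = kernel_det k ps ps"
    by (simp add: cofactor_def kernel_det_def M_def)
  also have "(\<Sum>j<?n. k x (ps ! j) * cofactor ?A 0 (Suc j)) =
      (\<Sum>j<?n. - (\<Sum>i<?n. cofactor (M ps) i j * k x (ps ! j) * k (ps ! i) y))"
  proof (rule sum.cong[OF refl])
    fix j assume "j \<in> {..<?n}"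
    then have j: "j < ?n" by simp
    let ?D = "mat_delete ?A 0 (Suc j)"
    have D: "?D \<in> carrier_mat ?n ?n" by (simp add: mat_delete_def)
    have "Determinant.det ?D = (\<Sum>i<?n. ?D $$ (i, 0) * cofactor ?D i 0)"
      by (rule laplace_expansion_column[OF D]) (use j in linarith)
    also have "\<dots> = (\<Sum>i<?n. k (ps ! i) y * ((- 1) ^ j * cofactor (M ps) i j))"
    proof (rule sum.cong[OF refl])
      fix i assume "i \<in> {..<?n}"
      then have i: "i < ?n" by simp
      have "mat_delete ?D i 0 = mat_delete (M ps) i j"
        using i j unfolding mat_delete_def M_def by (intro eq_matI) (auto simp: less_diff_conv)
      \<comment> \<open>The inner expansion carries the sign \<open>(- 1) ^ i\<close>, the cofactor
        of \<open>M ps\<close> the sign \<open>(- 1) ^ (i + j)\<close>. The surplus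
        \<open>(- 1) ^ j\<close> meets the outer sign \<open>(- 1) ^ Suc j\<close> and leaves the
        minus of the statement.\<close>
      then have "cofactor ?D i 0 = (- 1) ^ j * cofactor (M ps) i j"
        by (simp add: cofactor_def power_add mult.left_commute[of "(- 1) ^ j"] flip: power_mult_distrib)
      moreover have "ps \<noteq> []" using j by auto
      then have "?D $$ (i, 0) = k (ps ! i) y" using i j by (simp add: mat_delete_def)
      ultimately show "?D $$ (i, 0) * cofactor ?D i 0 = k (ps ! i) y * ((- 1) ^ j * cofactor (M ps) i j)" by simp
    qed
    also have "\<dots> = (- 1) ^ j * (\<Sum>i<?n. cofactor (M ps) i j * k (ps ! i) y)"
      by (simp add: sum_distrib_left mult_ac)
    finally have "cofactor ?A 0 (Suc j) = - ((- 1) ^ j * (- 1) ^ j) * (\<Sum>i<?n. cofactor (M ps) i j * k (ps ! i) y)"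
      by (simp add: cofactor_def)
    also have "(- 1 :: complex) ^ j * (- 1) ^ j = 1" by (simp flip: power_mult_distrib)
    finally show "k x (ps ! j) * cofactor ?A 0 (Suc j) = - (\<Sum>i<?n. cofactor (M ps) i j * k x (ps ! j) * k (ps ! i) y)"
      by (simp add: sum_distrib_left sum_negf mult_ac)
  qed
  finally show ?thesis by (simp add: kernel_det_def sum_negf)
qed

lemma kernel_det_cong:
  assumes "length qs = length ps" "\<And>x y. x \<in> set ps \<Longrightarrow> y \<in> set qs \<Longrightarrow> k x y = k' x y"
  shows "kernel_det k ps qs = kernel_det k' ps qs"
proof -
  have "Matrix.mat (length ps) (length ps) (\<lambda>(i, j). k (ps ! i) (qs ! j)) =
      Matrix.mat (length ps) (length ps) (\<lambda>(i, j). k' (ps ! i) (qs ! j))"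
    using assms by (intro eq_matI) auto
  then show ?thesis by (simp add: kernel_det_def)
qed

lemma bounded_op_sum_op:
  assumes "finite I" "\<And>i. i \<in> I \<Longrightarrow> bounded_op M (T i)"
  shows "bounded_op M (\<lambda>f x. \<Sum>i\<in>I. T i f x)"
  using assms
proof (induction I rule: finite_induct)
  case empty
  show ?case by (rule bounded_opI[where C = 0]) (auto simp: l2_norm_def)
next
  case (insert i I)
  have "(\<lambda>f x. \<Sum>i\<in>insert i I. T i f x) = T i + (\<lambda>f x. \<Sum>i\<in>I. T i f x)"
    using insert.hyps by (simp add: fun_eq_iff)
  then show ?case using insert by (simp only:) (intro bounded_op_plus; simp)
qed

lemma bounded_op_rank_one:
  assumes g: "g \<in> L2 M" and h: "h \<in> L2 M"
  shows "bounded_op M (\<lambda>f x. c * l2_inner M f h * g x)"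
proof (rule bounded_opI[where C = "cmod c * l2_norm M h * l2_norm M g"])
  fix f assume f: "f \<in> L2 M"
  show "(\<lambda>x. c * l2_inner M f h * g x) \<in> L2 M" using g by (rule L2_scale)
  show "l2_norm M (\<lambda>x. c * l2_inner M f h * g x) \<le> cmod c * l2_norm M h * l2_norm M g * l2_norm M f"
    unfolding l2_norm_scale norm_mult
    using mult_left_mono[OF mult_right_mono[OF l2_Cauchy_Schwarz[OF f h] l2_norm_nonneg[of M g]] norm_ge_zero[of c]]
    by (simp add: mult_ac)
qed (auto simp: l2_inner_add_left h l2_inner_scale_left algebra_simps)

lemma bounded_op_minus:
  assumes "bounded_op M S" "bounded_op M T" shows "bounded_op M (S - T)"
proof -
  have "S - T = S + (mult_op (\<lambda>_. - 1) \<circ> T)" by (simp add: fun_eq_iff mult_op_def)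
  then show ?thesis
    using assms by (simp only:) (intro bounded_op_plus bounded_op_comp bounded_op_mult_op[where C = 1]; simp)
qed

text \<open>For a nonzero determinant this is the entry in row \<open>j\<close> and column
  \<open>i\<close> of the inverse of the matrix of \<open>k\<close> at the points, so that
  \<open>palm_kernel_eq\<close> presents the Palm kernel as a Schur complement.\<close>

definition palm_coeff :: "('a \<Rightarrow> 'a \<Rightarrow> complex) \<Rightarrow> 'a list \<Rightarrow> nat \<Rightarrow> nat \<Rightarrow> complex" where
  "palm_coeff k ps i j =
     cofactor (Matrix.mat (length ps) (length ps) (\<lambda>(i, j). k (ps ! i) (ps ! j))) i j / kernel_det k ps ps"

definition palm_positive :: "('a \<Rightarrow> 'a \<Rightarrow> complex) \<Rightarrow> 'a list \<Rightarrow> bool" where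
  "palm_positive k ps \<longleftrightarrow> kernel_det k ps ps \<in> \<real> \<and> 0 < Re (kernel_det k ps ps)"

lemma palm_cong:
  assumes "\<And>x y. x \<in> set ps \<Longrightarrow> y \<in> set ps \<Longrightarrow> k x y = k' x y"
  shows "palm_coeff k ps = palm_coeff k' ps" "palm_positive k ps = palm_positive k' ps"
proof -
  have "Matrix.mat (length ps) (length ps) (\<lambda>(i, j). k (ps ! i) (ps ! j)) =
      Matrix.mat (length ps) (length ps) (\<lambda>(i, j). k' (ps ! i) (ps ! j))"
    using assms by (intro eq_matI) auto
  moreover have "kernel_det k ps ps = kernel_det k' ps ps" using assms by (rule kernel_det_cong[OF refl])
  ultimately show "palm_coeff k ps = palm_coeff k' ps" "palm_positive k ps = palm_positive k' ps"
    by (simp_all add: palm_coeff_def[abs_def] palm_positive_def)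
qed

lemma palm_kernel_eq:
  "palm_kernel k ps x y = (if palm_positive k ps
     then k x y - (\<Sum>j<length ps. \<Sum>i<length ps. palm_coeff k ps i j * k x (ps ! j) * k (ps ! i) y) else 0)"
  unfolding palm_kernel_def palm_positive_def kernel_det_Cons palm_coeff_def
  by (auto simp: diff_divide_distrib sum_divide_distrib)

context kernel_op
begin

text \<open>R p stands for the p-th column of the kernel, equal a.e. to the conjugate of the p-th row.\<close>

definition palm_op :: "('a \<Rightarrow> 'a \<Rightarrow> complex) \<Rightarrow> 'a list \<Rightarrow> 'a operator" where
  "palm_op R ps = (if palm_positive kk ps
     then K - (\<lambda>f x. \<Sum>(j, i)\<in>{..<length ps} \<times> {..<length ps}.
       palm_coeff kk ps i j * l2_inner \<mu> f (R (ps ! i)) * R (ps ! j) x)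
     else 0)"

context
  fixes R :: "'a \<Rightarrow> 'a \<Rightarrow> complex" and ps :: "'a list"
  assumes ps: "set ps \<subseteq> E0" and R: "\<And>p. p \<in> set ps \<Longrightarrow> R p \<in> L2 \<mu>"
    and row: "\<And>p. p \<in> set ps \<Longrightarrow> AE y in \<mu>. cnj (kk p y) = R p y"
    and col: "\<And>p. p \<in> set ps \<Longrightarrow> AE y in \<mu>. kk y p = R p y"
begin

lemma bounded_palm_op: "bounded_op \<mu> (palm_op R ps)"
proof (cases "palm_positive kk ps")
  case True
  have "bounded_op \<mu> (\<lambda>f x. \<Sum>q\<in>{..<length ps} \<times> {..<length ps}.
       palm_coeff kk ps (snd q) (fst q) * l2_inner \<mu> f (R (ps ! snd q)) * R (ps ! fst q) x)"
    by (intro bounded_op_sum_op bounded_op_rank_one R) auto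
  then show ?thesis
    unfolding palm_op_def using True by (simp add: case_prod_unfold bounded_op_minus bounded_K)
next
  case False
  have "bounded_op \<mu> (\<lambda>f x. 0)" by (rule bounded_opI[where C = 0]) (auto simp: l2_norm_def)
  then show ?thesis unfolding palm_op_def using False by (simp add: zero_fun_def)
qed

text \<open>Every term vanishes with \<open>kk\<close> as soon as \<open>x\<close> or
  \<open>y\<close> leaves \<open>E0\<close>, so extension by 0 commutes with the Palm formula when
  the points lie in \<open>E0\<close>.\<close>

lemma ext_palm_kernel:
  "ext_kernel E0 (palm_kernel k ps) x y = (if palm_positive kk ps
     then kk x y - (\<Sum>j<length ps. \<Sum>i<length ps. palm_coeff kk ps i j * kk x (ps ! j) * kk (ps ! i) y) else 0)"
proof -
  have kk: "kk p q = k p q" if "p \<in> E0" "q \<in> E0" for p q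
    using that by (simp add: kk_def ext_kernel_def)
  have in_E0: "ps ! i \<in> E0" if "i < length ps" for i using ps that by auto
  have "k p q = kk p q" if "p \<in> set ps" "q \<in> set ps" for p q
    by (rule kk[symmetric]) (use ps that in auto)
  note c = palm_cong[of ps k kk, OF this]
  show ?thesis
  proof (cases "x \<in> E0 \<and> y \<in> E0")
    case True
    then show ?thesis
      by (simp add: ext_kernel_def palm_kernel_eq c kk in_E0)
  next
    case False
    then have z: "kk x y = 0" "palm_coeff kk ps i j * kk x (ps ! j) * kk (ps ! i) y = 0" for i j
      by (auto simp: kk_def ext_kernel_def)
    have "ext_kernel E0 (palm_kernel k ps) x y = 0" using False by (auto simp: ext_kernel_def)
    then show ?thesis by (simp only: z sum.neutral_const) simp
  qed
qed

text \<open>Integration against the row of \<open>ps ! i\<close> is an inner product with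
  \<open>R (ps ! i)\<close>, and the column of \<open>ps ! j\<close> is \<open>R (ps ! j)\<close>
  almost everywhere. As there are finitely many points, one null set serves them all.\<close>

lemma integral_op_palm: "op_eq \<mu> (integral_op \<mu> E0 (palm_kernel k ps)) (palm_op R ps)"
  unfolding op_eq_def
proof
  fix f assume f: "f \<in> L2 \<mu>"
  let ?n = "length ps"
  show "AE x in \<mu>. integral_op \<mu> E0 (palm_kernel k ps) f x = palm_op R ps f x"
  proof (cases "palm_positive kk ps")
    case True
    have inner: "integrable \<mu> (\<lambda>y. kk p y * f y)" "(\<integral>y. kk p y * f y \<partial>\<mu>) = l2_inner \<mu> f (R p)" if "p \<in> set ps" for p
    proof -
      have i: "integrable \<mu> (\<lambda>y. f y * cnj (R p y))" by (rule integrable_l2_inner[OF f R[OF that]])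
      have m: "(\<lambda>y. kk p y * f y) \<in> borel_measurable \<mu>" using f by measurable
      have e: "AE y in \<mu>. kk p y * f y = f y * cnj (R p y)"
        using row[OF that] by eventually_elim (metis complex_cnj_cnj mult.commute)
      show "integrable \<mu> (\<lambda>y. kk p y * f y)"
        using i integrable_cong_AE[OF m borel_measurable_integrable[OF i] e] by blast
      show "(\<integral>y. kk p y * f y \<partial>\<mu>) = l2_inner \<mu> f (R p)"
        unfolding l2_inner_def by (rule integral_cong_AE[OF m borel_measurable_integrable[OF i] e])
    qed
    have "AE x in \<mu>. \<forall>j\<in>{..<?n}. kk x (ps ! j) = R (ps ! j) x"
      by (subst AE_ball_countable) (auto intro: col)
    with AE_integrable_kk[OF f] AE_K_eq[OF f] show ?thesis
    proof eventually_elim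
      case (elim x)
      have "integral_op \<mu> E0 (palm_kernel k ps) f x =
          (\<integral>y. kk x y * f y - (\<Sum>j<?n. \<Sum>i<?n. palm_coeff kk ps i j * kk x (ps ! j) * (kk (ps ! i) y * f y)) \<partial>\<mu>)"
        unfolding integral_op_ext_kernel ext_palm_kernel using True
        by (intro Bochner_Integration.integral_cong) (auto simp: left_diff_distrib sum_distrib_right mult.assoc)
      also have "\<dots> = (\<integral>y. kk x y * f y \<partial>\<mu>) -
          (\<Sum>j<?n. \<Sum>i<?n. palm_coeff kk ps i j * kk x (ps ! j) * (\<integral>y. kk (ps ! i) y * f y \<partial>\<mu>))"
      proof -
        let ?T = "\<lambda>j i y. palm_coeff kk ps i j * kk x (ps ! j) * (kk (ps ! i) y * f y)"
        have T: "integrable \<mu> (?T j i)" if "i < ?n" for i j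
          using that by (intro integrable_mult_right inner(1)) simp
        have "(\<integral>y. kk x y * f y - (\<Sum>j<?n. \<Sum>i<?n. ?T j i y) \<partial>\<mu>) =
            (\<integral>y. kk x y * f y \<partial>\<mu>) - (\<integral>y. (\<Sum>j<?n. \<Sum>i<?n. ?T j i y) \<partial>\<mu>)"
          by (intro Bochner_Integration.integral_diff elim(1) Bochner_Integration.integrable_sum T) simp
        also have "(\<integral>y. (\<Sum>j<?n. \<Sum>i<?n. ?T j i y) \<partial>\<mu>) = (\<Sum>j<?n. \<integral>y. (\<Sum>i<?n. ?T j i y) \<partial>\<mu>)"
          by (intro Bochner_Integration.integral_sum Bochner_Integration.integrable_sum T) simp
        also have "\<dots> = (\<Sum>j<?n. \<Sum>i<?n. integral\<^sup>L \<mu> (?T j i))"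
          by (intro sum.cong refl Bochner_Integration.integral_sum T) simp
        finally show ?thesis by simp
      qed
      also have "\<dots> = K f x - (\<Sum>j<?n. \<Sum>i<?n. palm_coeff kk ps i j * R (ps ! j) x * l2_inner \<mu> f (R (ps ! i)))"
        using elim(2,3) inner(2) by simp
      finally show ?case
        unfolding palm_op_def using True by (simp add: sum.cartesian_product mult_ac)
    qed
  next
    case False
    then show ?thesis
      by (simp add: palm_op_def integral_op_ext_kernel ext_palm_kernel)
  qed
qed

lemma bounded_integral_op_palm: "bounded_op \<mu> (integral_op \<mu> E0 (palm_kernel k ps))"
proof (rule bounded_op_cong[OF bounded_palm_op integral_op_palm])
  fix f assume [measurable]: "f \<in> L2 \<mu>"
  have "(\<lambda>p. ext_kernel E0 (palm_kernel k ps) (fst p) (snd p) * f (snd p)) \<in> borel_measurable (\<mu> \<Otimes>\<^sub>M \<mu>)"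
    unfolding ext_palm_kernel using L2_measurable[OF \<open>f \<in> L2 \<mu>\<close>] by measurable
  then have "(\<lambda>x. \<integral>y. ext_kernel E0 (palm_kernel k ps) x y * f y \<partial>\<mu>) \<in> borel_measurable \<mu>"
    by (intro borel_measurable_lebesgue_integral) (simp add: case_prod_unfold)
  then show "integral_op \<mu> E0 (palm_kernel k ps) f \<in> borel_measurable \<mu>"
    by (simp add: integral_op_ext_kernel[abs_def])
qed

end

end


section \<open>The resolvent identity\<close>

text \<open>\<open>inverse_op\<close> is an arbitrary choice among inverses; this carries a computed
  inverse over to the chosen one, up to \<open>op_eq\<close>.\<close>

lemma is_inverse_op_unique:
  assumes R: "bounded_op M R" and S: "is_inverse_op M R S" and S': "is_inverse_op M R S'"
  shows "op_eq M S S'"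
  unfolding op_eq_def
proof
  fix f assume f: "f \<in> L2 M"
  have b: "bounded_op M S" "bounded_op M S'" using S S' by (auto simp: is_inverse_op_def)
  have S'f: "S' f \<in> L2 M" by (rule bounded_op_L2[OF b(2) f])
  have "AE x in M. R (S' f) x = f x" using S' f by (auto simp: is_inverse_op_def op_eq_def)
  then have "AE x in M. S (R (S' f)) x = S f x"
    by (rule bounded_op_cong_AE[OF b(1) bounded_op_L2[OF R S'f] f])
  moreover have "AE x in M. S (R (S' f)) x = S' f x" using S S'f by (auto simp: is_inverse_op_def op_eq_def)
  ultimately show "AE x in M. S f x = S' f x" by eventually_elim simp
qed

text \<open>
  With \<open>U = chi B \<circ> A\<close>, invertibility of \<open>1 - U W\<close> and of \<open>1 - W U = 1 - U\<close> are equivalent, and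
  \<open>(1 - U W)\<^sup>-\<^sup>1 = 1 + U (1 - U)\<^sup>-\<^sup>1 W\<close>.
\<close>

locale compressed_resolvent = radon_space \<mu> for \<mu> :: "'a::{heine_borel, polish_space} measure" +
  fixes W A A1 :: "'a operator" and B :: "'a set"
  assumes B [measurable]: "B \<in> sets borel"
    and W: "bounded_op \<mu> W" and A: "bounded_op \<mu> A" and A1: "bounded_op \<mu> A1"
    and W_on_B: "f \<in> L2 \<mu> \<Longrightarrow> AE x in \<mu>. x \<in> B \<longrightarrow> W f x = f x"
    and W_chi: "f \<in> L2 \<mu> \<Longrightarrow> AE x in \<mu>. W (chi B f) x = chi B f x"
    and A1_eq: "op_eq \<mu> A1 (W \<circ> A \<circ> W)"
begin

definition R :: "'a operator" where "R = id - (chi B \<circ> A)"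
definition R1 :: "'a operator" where "R1 = id - (chi B \<circ> A1)"
definition U :: "'a operator" where "U = chi B \<circ> A"

lemma U: "bounded_op \<mu> U"
  unfolding U_def by (rule bounded_op_comp[OF bounded_op_chi[OF B] A])

lemma R: "bounded_op \<mu> R"
  unfolding R_def by (rule bounded_op_minus[OF bounded_op_id bounded_op_comp[OF bounded_op_chi[OF B] A]])

lemma R1: "bounded_op \<mu> R1"
  unfolding R1_def by (rule bounded_op_minus[OF bounded_op_id bounded_op_comp[OF bounded_op_chi[OF B] A1]])

lemma R_apply: "R f x = f x - U f x" by (simp add: R_def U_def)

lemmas WL = bounded_op_L2[OF W] and AL = bounded_op_L2[OF A] and UL = bounded_op_L2[OF U]

lemma W_U: "f \<in> L2 \<mu> \<Longrightarrow> AE x in \<mu>. W (U f) x = U f x"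
  unfolding U_def comp_def by (rule W_chi[OF AL])

text \<open>On \<open>B\<close> the outer \<open>W\<close> of \<open>W \<circ> A \<circ> W\<close>
  is the identity, so \<open>chi B \<circ> A1\<close> is \<open>U \<circ> W\<close>.\<close>

lemma R1_apply:
  assumes f: "f \<in> L2 \<mu>"
  shows "AE x in \<mu>. R1 f x = f x - U (W f) x"
proof -
  have "AE x in \<mu>. A1 f x = W (A (W f)) x" using A1_eq f by (auto simp: op_eq_def)
  with W_on_B[OF AL[OF WL[OF f]]] show ?thesis
    by eventually_elim (auto simp: R1_def U_def chi_def mult_op_def indicator_def)
qed

lemma W_add_U:
  assumes "f \<in> L2 \<mu>" "g \<in> L2 \<mu>"
  shows "AE x in \<mu>. W (\<lambda>x. f x + U g x) x = W f x + U g x"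
  using bounded_op_add[OF W assms(1) UL[OF assms(2)]] W_U[OF assms(2)] by eventually_elim simp

text \<open>Since \<open>W U = U\<close> and \<open>S = 1 + U S\<close>, applying \<open>W\<close>
  to the proposed inverse gives \<open>S W\<close>. Both product identities rest on this
  cancellation, and \<open>compressed_resolvent_eq\<close> uses the second claim directly.\<close>

lemma inverse_compressed:
  assumes S: "is_inverse_op \<mu> R S"
  shows "is_inverse_op \<mu> R1 (id + (U \<circ> S \<circ> W))"
    and "f \<in> L2 \<mu> \<Longrightarrow> AE x in \<mu>. W ((id + (U \<circ> S \<circ> W)) f) x = S (W f) x"
proof -
  let ?S = "id + (U \<circ> S \<circ> W)"
  have bS: "bounded_op \<mu> S" using S by (simp add: is_inverse_op_def)
  have b: "bounded_op \<mu> ?S" by (intro bounded_op_plus bounded_op_id bounded_op_comp U bS W)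
  have S_eq: "?S f = (\<lambda>x. f x + U (S (W f)) x)" for f by (simp add: fun_eq_iff)
  have SL: "S f \<in> L2 \<mu>" if "f \<in> L2 \<mu>" for f using bounded_op_L2[OF bS that] .
  have RS: "AE x in \<mu>. S f x = f x + U (S f) x" if "f \<in> L2 \<mu>" for f
    using S that by (auto simp: is_inverse_op_def op_eq_def R_apply diff_eq_eq)
  have SR: "AE x in \<mu>. S (\<lambda>x. f x - U f x) x = f x" if "f \<in> L2 \<mu>" for f
  proof -
    have "AE x in \<mu>. S (R f) x = f x" using S that by (auto simp: is_inverse_op_def op_eq_def)
    moreover have "R f = (\<lambda>x. f x - U f x)" by (simp add: R_apply fun_eq_iff)
    ultimately show ?thesis by simp
  qed
  show WS: "AE x in \<mu>. W (?S f) x = S (W f) x" if f: "f \<in> L2 \<mu>" for f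
    unfolding S_eq using W_add_U[OF f SL[OF WL[OF f]]] RS[OF WL[OF f]] by eventually_elim simp
  show "is_inverse_op \<mu> R1 ?S"
    unfolding is_inverse_op_def op_eq_def
  proof (intro conjI ballI b)
    fix f assume f: "f \<in> L2 \<mu>"
    have Sf: "?S f \<in> L2 \<mu>" by (rule bounded_op_L2[OF b f])
    have "AE x in \<mu>. U (W (?S f)) x = U (S (W f)) x"
      by (rule bounded_op_cong_AE[OF U WL[OF Sf] SL[OF WL[OF f]] WS[OF f]])
    with R1_apply[OF Sf] show "AE x in \<mu>. (R1 \<circ> ?S) f x = id f x"
      by eventually_elim (simp add: S_eq)
    let ?g = "\<lambda>x. f x - U (W f) x"
    have g: "?g \<in> L2 \<mu>" using f UL[OF WL[OF f]] by (rule L2_diff)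
    have R1f: "R1 f \<in> L2 \<mu>" by (rule bounded_op_L2[OF R1 f])
    have Wg: "AE x in \<mu>. W ?g x = W f x - U (W f) x"
      using bounded_op_diff[OF W f UL[OF WL[OF f]]] W_U[OF WL[OF f]] by eventually_elim simp
    have "AE x in \<mu>. W (R1 f) x = W ?g x"
      by (rule bounded_op_cong_AE[OF W R1f g R1_apply[OF f]])
    with Wg have W1: "AE x in \<mu>. W (R1 f) x = W f x - U (W f) x" by eventually_elim simp
    have Wf': "(\<lambda>x. W f x - U (W f) x) \<in> L2 \<mu>" by (rule L2_diff[OF WL[OF f] UL[OF WL[OF f]]])
    have "AE x in \<mu>. S (W (R1 f)) x = S (\<lambda>x. W f x - U (W f) x) x"
      by (rule bounded_op_cong_AE[OF bS WL[OF R1f] Wf' W1])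
    with SR[OF WL[OF f]] have "AE x in \<mu>. S (W (R1 f)) x = W f x" by eventually_elim simp
    then have "AE x in \<mu>. U (S (W (R1 f))) x = U (W f) x"
      by (rule bounded_op_cong_AE[OF U SL[OF WL[OF R1f]] WL[OF f]])
    with R1_apply[OF f] show "AE x in \<mu>. (?S \<circ> R1) f x = id f x"
      by eventually_elim (simp add: S_eq)
  qed
qed

text \<open>The same algebraic identity with \<open>U\<close> and \<open>W\<close> interchanged. The
  converse matters because \<open>conditional_op\<close> is 0 when inversion fails: both operators
  have to fall into the same case.\<close>

lemma inverse_uncompressed:
  assumes S: "is_inverse_op \<mu> R1 S"
  shows "is_inverse_op \<mu> R (id + (W \<circ> S \<circ> U))"
proof -
  let ?S = "id + (W \<circ> S \<circ> U)"
  have bS: "bounded_op \<mu> S" using S by (simp add: is_inverse_op_def)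
  have b: "bounded_op \<mu> ?S" by (intro bounded_op_plus bounded_op_id bounded_op_comp U bS W)
  have S_eq: "?S f = (\<lambda>x. f x + W (S (U f)) x)" for f by (simp add: fun_eq_iff)
  have SL: "S f \<in> L2 \<mu>" if "f \<in> L2 \<mu>" for f using bounded_op_L2[OF bS that] .
  show ?thesis
    unfolding is_inverse_op_def op_eq_def
  proof (intro conjI ballI b)
    fix f assume f: "f \<in> L2 \<mu>"
    let ?h = "S (U f)"
    have h: "?h \<in> L2 \<mu>" by (rule SL[OF UL[OF f]])
    have "AE x in \<mu>. R1 ?h x = U f x" using S UL[OF f] by (auto simp: is_inverse_op_def op_eq_def)
    with R1_apply[OF h] have h1: "AE x in \<mu>. ?h x = U f x + U (W ?h) x" by eventually_elim simp
    have s: "(\<lambda>x. U f x + U (W ?h) x) \<in> L2 \<mu>" by (rule L2_add[OF UL[OF f] UL[OF WL[OF h]]])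
    have "AE x in \<mu>. W ?h x = W (\<lambda>x. U f x + U (W ?h) x) x"
      by (rule bounded_op_cong_AE[OF W h s h1])
    with W_add_U[OF UL[OF f] WL[OF h]] W_U[OF f]
    have Wh: "AE x in \<mu>. W ?h x = U f x + U (W ?h) x" by eventually_elim simp
    have "AE x in \<mu>. U (\<lambda>x. f x + W ?h x) x = U f x + U (W ?h) x"
      by (rule bounded_op_add[OF U f WL[OF h]])
    with Wh show "AE x in \<mu>. (R \<circ> ?S) f x = id f x"
      unfolding comp_apply S_eq R_apply id_apply by eventually_elim simp
    have Rf: "R f \<in> L2 \<mu>" by (rule bounded_op_L2[OF R f])
    let ?u = "U f"
    have u: "?u \<in> L2 \<mu>" by (rule UL[OF f])
    have Rf_eq: "R f = (\<lambda>x. f x - ?u x)" by (simp add: R_apply fun_eq_iff)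
    have "AE x in \<mu>. U (W ?u) x = U ?u x" by (rule bounded_op_cong_AE[OF U WL[OF u] u W_U[OF f]])
    with R1_apply[OF u] bounded_op_diff[OF U f u]
    have "AE x in \<mu>. U (R f) x = R1 ?u x" unfolding Rf_eq by eventually_elim simp
    then have "AE x in \<mu>. S (U (R f)) x = S (R1 ?u) x"
      by (rule bounded_op_cong_AE[OF bS UL[OF Rf] bounded_op_L2[OF R1 u]])
    moreover have "AE x in \<mu>. S (R1 ?u) x = ?u x" using S u by (auto simp: is_inverse_op_def op_eq_def)
    ultimately have "AE x in \<mu>. S (U (R f)) x = ?u x" by eventually_elim simp
    then have "AE x in \<mu>. W (S (U (R f))) x = W ?u x"
      by (rule bounded_op_cong_AE[OF W SL[OF UL[OF Rf]] u])
    with W_U[OF f] show "AE x in \<mu>. (?S \<circ> R) f x = id f x"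
      by eventually_elim (simp add: S_eq R_apply)
  qed
qed

lemma invertible_iff: "invertible_op \<mu> R1 \<longleftrightarrow> invertible_op \<mu> R"
  using inverse_compressed(1) inverse_uncompressed R R1 unfolding invertible_op_def by blast

text \<open>\<open>W (chi B f)\<close> is \<open>chi B f\<close> by \<open>W_chi\<close>, and this
  is also the part of \<open>W f\<close> on \<open>B\<close> by \<open>W_on_B\<close>; the remaining
  parts must agree.\<close>

lemma W_chi_compl:
  assumes f: "f \<in> L2 \<mu>" shows "AE x in \<mu>. W (chi (- B) f) x = chi (- B) (W f) x"
proof -
  have L: "chi B f \<in> L2 \<mu>" "chi (- B) f \<in> L2 \<mu>"
    using bounded_op_L2[OF bounded_op_chi f] B by auto
  have "f = (\<lambda>x. chi B f x + chi (- B) f x)" by (auto simp: chi_def mult_op_def fun_eq_iff indicator_def)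
  then have "AE x in \<mu>. W f x = W (chi B f) x + W (chi (- B) f) x" using bounded_op_add[OF W L] by simp
  with W_chi[OF f] W_on_B[OF f] show ?thesis
    by eventually_elim (auto simp: chi_def mult_op_def indicator_def)
qed

text \<open>The inner \<open>W\<close> of \<open>A1\<close> meets the inverse of \<open>R1\<close>
  and the two become \<open>S W\<close> by the second claim of \<open>inverse_compressed\<close>.
  The cut-offs to the complement of \<open>B\<close> then commute with the two factors
  \<open>W\<close>.\<close>

lemma compressed_resolvent_eq:
  assumes inv: "invertible_op \<mu> R"
  shows "op_eq \<mu> (chi (- B) \<circ> A1 \<circ> inverse_op \<mu> R1 \<circ> chi (- B))
    (W \<circ> (chi (- B) \<circ> A \<circ> inverse_op \<mu> R \<circ> chi (- B)) \<circ> W)"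
  unfolding op_eq_def
proof
  fix f assume f: "f \<in> L2 \<mu>"
  define S where "S = inverse_op \<mu> R"
  have S: "is_inverse_op \<mu> R S"
    using inv unfolding S_def inverse_op_def invertible_op_def
    by (rule someI_ex[of "is_inverse_op \<mu> R", OF conjunct2])
  let ?S1 = "id + (U \<circ> S \<circ> W)"
  have S1: "is_inverse_op \<mu> R1 ?S1" by (rule inverse_compressed(1)[OF S])
  then have "is_inverse_op \<mu> R1 (inverse_op \<mu> R1)"
    unfolding inverse_op_def by (rule someI[of "is_inverse_op \<mu> R1"])
  note uniq = is_inverse_op_unique[OF R1 this S1]
  have bS: "bounded_op \<mu> S" and bS1: "bounded_op \<mu> ?S1" and bI: "bounded_op \<mu> (inverse_op \<mu> R1)"
    using S S1 \<open>is_inverse_op \<mu> R1 (inverse_op \<mu> R1)\<close> by (simp_all add: is_inverse_op_def)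
  have cb: "bounded_op \<mu> (chi (- B))" by (rule bounded_op_chi) (use B in auto)
  let ?g = "chi (- B) f"
  let ?g' = "chi (- B) (W f)"
  have g: "?g \<in> L2 \<mu>" by (rule bounded_op_L2[OF cb f])
  have g': "?g' \<in> L2 \<mu>" by (rule bounded_op_L2[OF cb WL[OF f]])
  have Ig: "inverse_op \<mu> R1 ?g \<in> L2 \<mu>" by (rule bounded_op_L2[OF bI g])
  have S1g: "?S1 ?g \<in> L2 \<mu>" by (rule bounded_op_L2[OF bS1 g])
  have SWg: "S (W ?g) \<in> L2 \<mu>" by (rule bounded_op_L2[OF bS WL[OF g]])
  have Sg': "S ?g' \<in> L2 \<mu>" by (rule bounded_op_L2[OF bS g'])
  have 1: "AE x in \<mu>. inverse_op \<mu> R1 ?g x = ?S1 ?g x" using uniq g by (auto simp: op_eq_def)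
  have 2: "AE x in \<mu>. W (inverse_op \<mu> R1 ?g) x = W (?S1 ?g) x" by (rule bounded_op_cong_AE[OF W Ig S1g 1])
  have 3: "AE x in \<mu>. S (W ?g) x = S ?g' x"
    by (rule bounded_op_cong_AE[OF bS WL[OF g] g' W_chi_compl[OF f]])
  from 2 inverse_compressed(2)[OF S g] 3 have 4: "AE x in \<mu>. W (inverse_op \<mu> R1 ?g) x = S ?g' x"
    by eventually_elim simp
  have 5: "AE x in \<mu>. A (W (inverse_op \<mu> R1 ?g)) x = A (S ?g') x"
    by (rule bounded_op_cong_AE[OF A WL[OF Ig] Sg' 4])
  have 6: "AE x in \<mu>. W (A (W (inverse_op \<mu> R1 ?g))) x = W (A (S ?g')) x"
    by (rule bounded_op_cong_AE[OF W AL[OF WL[OF Ig]] AL[OF Sg'] 5])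
  have 7: "AE x in \<mu>. A1 (inverse_op \<mu> R1 ?g) x = W (A (W (inverse_op \<mu> R1 ?g))) x"
    using A1_eq Ig by (auto simp: op_eq_def)
  show "AE x in \<mu>. (chi (- B) \<circ> A1 \<circ> inverse_op \<mu> R1 \<circ> chi (- B)) f x =
      (W \<circ> (chi (- B) \<circ> A \<circ> inverse_op \<mu> R \<circ> chi (- B)) \<circ> W) f x"
    using 6 7 W_chi_compl[OF AL[OF Sg']]
    by eventually_elim (simp add: S_def chi_def mult_op_def)
qed

end


section \<open>Conditional kernels of compressions\<close>

text \<open>Local finiteness turns the multiplicities over \<open>B\<close> into a multiset, which
  some list realises.\<close>

lemma enumerates_exists:
  assumes "X \<in> Conf" "bounded B" shows "\<exists>ps. enumerates ps X B"
proof -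
  let ?c = "\<lambda>x. if x \<in> B then X x else 0"
  have "finite {x. 0 < ?c x}"
    using finite_Conf[OF assms] by (rule rev_finite_subset) (auto split: if_splits)
  then have c: "count (Abs_multiset ?c) = ?c" by (simp add: Abs_multiset_inverse)
  obtain ps where ps: "mset ps = Abs_multiset ?c" using ex_mset by blast
  have "count_list ps x = ?c x" for x
    unfolding count_mset[symmetric] ps c ..
  then have "enumerates ps X B" by (simp add: enumerates_def)
  then show ?thesis ..
qed

context compression
begin

text \<open>The coefficients agree because the kernels agree at the points, and compressing a
  rank-one term by the self-adjoint \<open>W\<close> replaces both of its vectors by their images
  under \<open>W\<close>.\<close>

lemma palm_op_compressed:
  assumes ps: "\<And>p. p \<in> set ps \<Longrightarrow> good p"
    and agree: "\<And>p q. p \<in> set ps \<Longrightarrow> q \<in> set ps \<Longrightarrow> kk p q = C.kk p q"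
  shows "op_eq \<mu> (C.palm_op (\<lambda>p. W (row p)) ps) (W \<circ> palm_op row ps \<circ> W)"
  unfolding op_eq_def
proof
  fix f assume f: "f \<in> L2 \<mu>"
  note c = palm_cong[of ps kk C.kk, OF agree]
  let ?I = "{..<length ps} \<times> {..<length ps}"
  show "AE x in \<mu>. C.palm_op (\<lambda>p. W (row p)) ps f x = (W \<circ> palm_op row ps \<circ> W) f x"
  proof (cases "palm_positive kk ps")
    case True
    define h where "h q = (\<lambda>x. (palm_coeff kk ps (snd q) (fst q) * l2_inner \<mu> (W f) (row (ps ! snd q))) * row (ps ! fst q) x)" for q
    have r: "row (ps ! i) \<in> L2 \<mu>" if "i < length ps" for i using ps[of "ps ! i"] that by (simp add: good_def)
    have h: "h q \<in> L2 \<mu>" if "q \<in> ?I" for q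
      unfolding h_def by (intro L2_scale r) (use that in auto)
    have e: "palm_op row ps (W f) = (\<lambda>x. K (W f) x - (\<Sum>q\<in>?I. h q x))"
      using True by (simp add: palm_op_def h_def case_prod_unfold fun_eq_iff)
    have 1: "AE x in \<mu>. W (palm_op row ps (W f)) x = W (K (W f)) x - W (\<lambda>x. \<Sum>q\<in>?I. h q x) x"
      unfolding e by (intro bounded_op_diff[OF bounded_W] K_L2 W_L2 f L2_sum h)
    have 2: "AE x in \<mu>. W (\<lambda>x. \<Sum>q\<in>?I. h q x) x = (\<Sum>q\<in>?I. W (h q) x)"
      by (rule bounded_op_sum[OF bounded_W h])
    have "AE x in \<mu>. \<forall>q\<in>?I. W (h q) x =
        palm_coeff kk ps (snd q) (fst q) * l2_inner \<mu> (W f) (row (ps ! snd q)) * W (row (ps ! fst q)) x"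
      unfolding h_def by (subst AE_ball_countable) (auto intro!: bounded_op_scale[OF bounded_W] r)
    moreover have "AE x in \<mu>. K1 f x = W (K (W f)) x" using K1 f by (auto simp: op_eq_def)
    ultimately show ?thesis
      using 1 2
    proof eventually_elim
      case (elim x)
      have i: "l2_inner \<mu> (W f) (row (ps ! snd q)) = l2_inner \<mu> f (W (row (ps ! snd q)))" if "q \<in> ?I" for q
        by (rule self_adjoint_opD(2)[OF W f r]) (use that in auto)
      have "W (h q) x = palm_coeff kk ps (snd q) (fst q) *
          l2_inner \<mu> f (W (row (ps ! snd q))) * W (row (ps ! fst q)) x" if "q \<in> ?I" for q
        unfolding bspec[OF elim(1) that] i[OF that] ..
      then have "(\<Sum>q\<in>?I. W (h q) x) = (\<Sum>q\<in>?I. palm_coeff kk ps (snd q) (fst q) *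
          l2_inner \<mu> f (W (row (ps ! snd q))) * W (row (ps ! fst q)) x)"
        by (rule sum.cong[OF refl])
      then show ?case
        using elim(2-4) True by (simp add: C.palm_op_def c[symmetric] case_prod_unfold)
    qed
  next
    case False
    then show ?thesis
      using bounded_op_zero[OF bounded_W] by (simp add: palm_op_def C.palm_op_def c[symmetric] zero_fun_def)
  qed
qed

lemma conditional_op_compressed:
  "AE X in P. op_eq \<mu> (conditional_op \<mu> E1 k1 X B) (W \<circ> conditional_op \<mu> E0 k X B \<circ> W)"
  using AE_points_good AE_space
proof eventually_elim
  case (elim X)
  \<comment> \<open>The choice depends on \<open>X\<close> and \<open>B\<close> alone, so both
    conditional operators use the same list.\<close>
  define ps where "ps = (SOME ps. enumerates ps X B)"
  have "\<exists>ps. enumerates ps X B" by (rule enumerates_exists[OF elim(2)[unfolded space_P] B_bounded])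
  then have "enumerates ps X B" unfolding ps_def by (rule someI_ex[of "\<lambda>ps. enumerates ps X B"])
  then have "count_list ps p = (if p \<in> B then X p else 0)" for p by (simp add: enumerates_def)
  then have mem: "p \<in> B \<and> X p \<noteq> 0" if "p \<in> set ps" for p
    using that count_list_0_iff[of ps p] by (auto split: if_splits)
  have good: "good p" if "p \<in> set ps" for p using mem[OF that] elim(1) by blast
  have agree: "kk p q = C.kk p q" if "p \<in> set ps" "q \<in> set ps" for p q
    using mem[OF that(1)] mem[OF that(2)] elim(1) by blast
  have E: "set ps \<subseteq> E0" "set ps \<subseteq> E1" using good by (auto simp: good_def)
  let ?A = "integral_op \<mu> E0 (palm_kernel k ps)"
  let ?A1 = "integral_op \<mu> E1 (palm_kernel k1 ps)"
  have row_facts: "row p \<in> L2 \<mu>" "AE y in \<mu>. cnj (kk p y) = row p y" "AE y in \<mu>. kk y p = row p y"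
    "W (row p) \<in> L2 \<mu>" "AE y in \<mu>. cnj (C.kk p y) = W (row p) y" "AE y in \<mu>. C.kk y p = W (row p) y"
    if "p \<in> set ps" for p
    using good[OF that] by (auto simp: good_def row_def W_L2)
  note A = bounded_integral_op_palm[OF E(1) row_facts(1-3)] integral_op_palm[OF E(1) row_facts(1-3)]
    bounded_palm_op[OF E(1) row_facts(1-3)]
  note A1 = C.bounded_integral_op_palm[OF E(2) row_facts(4-6)] C.integral_op_palm[OF E(2) row_facts(4-6)]
  have "op_eq \<mu> ?A1 (W \<circ> palm_op row ps \<circ> W)"
    using A1(2) palm_op_compressed[OF good agree] by (rule op_eq_trans)
  also have "op_eq \<mu> (W \<circ> palm_op row ps \<circ> W) (W \<circ> ?A \<circ> W)"
    by (rule op_eq_comp[OF op_eq_comp[OF op_eq_refl op_eq_sym[OF A(2)] bounded_W A(3) A(1)] op_eq_refl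
          bounded_op_comp[OF bounded_W A(3)] bounded_W bounded_W])
  finally have A1_eq: "op_eq \<mu> ?A1 (W \<circ> ?A \<circ> W)" .
  interpret X: compressed_resolvent \<mu> W ?A ?A1 B
    by (intro compressed_resolvent.intro radon_space_axioms compressed_resolvent_axioms.intro
        B bounded_W A(1) A1(1) W_on_B W_chi A1_eq)
  show ?case
  proof (cases "invertible_op \<mu> X.R")
    case True
    then show ?thesis
      using X.compressed_resolvent_eq[OF True] E X.invertible_iff
      by (simp add: conditional_op_def Let_def ps_def[symmetric] X.R_def X.R1_def)
  next
    case False
    \<comment> \<open>Both conditional operators are 0 here, and \<open>W\<close> maps the zero
      function to a null function.\<close>
    then show ?thesis
      using bounded_op_zero[OF bounded_W] E X.invertible_iff
      by (simp add: conditional_op_def Let_def ps_def[symmetric] X.R_def X.R1_def op_eq_def zero_fun_def)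
  qed
qed

end

text \<open>The range condition says \<open>chi B Q = 0\<close>, and the adjoint of this is the
  claim. Concretely, \<open>Q (Q (chi B f))\<close> vanishes on \<open>B\<close>, where
  \<open>chi B f\<close> is supported, so \<open>Q (chi B f)\<close> has norm 0.\<close>

lemma projection_chi:
  assumes "radon_space \<mu>" and Q: "orthogonal_projection \<mu> Q" and B: "B \<in> sets borel"
    and QB: "\<forall>f\<in>L2 \<mu>. AE x in \<mu>. x \<in> B \<longrightarrow> Q f x = 0" and f: "f \<in> L2 \<mu>"
  shows "AE x in \<mu>. Q (chi B f) x = 0"
proof -
  interpret radon_space \<mu> by fact
  have sa: "self_adjoint_op \<mu> Q" using Q by (simp add: orthogonal_projection_def)
  have f': "chi B f \<in> L2 \<mu>" by (rule bounded_op_L2[OF bounded_op_chi[OF B] f])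
  have Qf: "Q (chi B f) \<in> L2 \<mu>" by (rule bounded_op_L2[OF self_adjoint_opD(1)[OF sa] f'])
  have "l2_inner \<mu> (Q (chi B f)) (Q (chi B f)) = l2_inner \<mu> (chi B f) (Q (Q (chi B f)))"
    by (rule self_adjoint_opD(2)[OF sa f' Qf])
  also have "\<dots> = (\<integral>x. 0 \<partial>\<mu>)"
    unfolding l2_inner_def
  proof (rule integral_cong_AE)
    show "AE x in \<mu>. chi B f x * cnj (Q (Q (chi B f)) x) = 0"
      using QB[rule_format, OF Qf] by eventually_elim (auto simp: chi_def mult_op_def indicator_def)
    show "(\<lambda>x. chi B f x * cnj (Q (Q (chi B f)) x)) \<in> borel_measurable \<mu>"
      using L2_measurable[OF f'] L2_measurable[OF bounded_op_L2[OF self_adjoint_opD(1)[OF sa] Qf]] by measurable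
  qed simp
  finally have "l2_norm \<mu> (Q (chi B f)) = 0" by (simp add: l2_inner_self)
  then show ?thesis using l2_norm_eq_0_iff[OF Qf] by simp
qed

text \<open>\<open>conditional_op\<close> begins and ends with \<open>chi (- B)\<close>, which
  annihilates \<open>chi B\<close>; if its value is 0, both sides send every function to
  \<open>Q 0\<close>. Hence an equality of maps and not merely one up to null sets.\<close>

lemma conditional_op_plus_chi:
  "(Q + chi B) \<circ> conditional_op \<mu> E0 k X B \<circ> (Q + chi B) = Q \<circ> conditional_op \<mu> E0 k X B \<circ> Q"
proof
  fix f
  have r: "chi (- B) ((Q + chi B) f) = chi (- B) (Q f)"
    by (auto simp: chi_def mult_op_def fun_eq_iff indicator_def)
  have l: "(Q + chi B) (chi (- B) g) = Q (chi (- B) g)" for g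
    by (auto simp: chi_def mult_op_def fun_eq_iff indicator_def)
  have z: "(Q + chi B) 0 = Q 0" by (auto simp: chi_def mult_op_def fun_eq_iff)
  show "((Q + chi B) \<circ> conditional_op \<mu> E0 k X B \<circ> (Q + chi B)) f = (Q \<circ> conditional_op \<mu> E0 k X B \<circ> Q) f"
    unfolding conditional_op_def Let_def by (simp add: r l z del: plus_fun_apply)
qed


theorem lemma1p12:
  fixes \<mu> :: "'a::{heine_borel, polish_space} measure"
    and K Q :: "'a operator"
    and B E0 E1 :: "'a set"
    and k k1 :: "'a \<Rightarrow> 'a \<Rightarrow> complex"
    and P :: "('a \<Rightarrow> nat) measure"
  assumes "radon_measure \<mu>" and "sigma_finite_measure \<mu>"
    and "self_adjoint_op \<mu> K" and "locally_trace_class \<mu> K"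
    and "op_spectrum \<mu> K \<subseteq> complex_of_real ` {0..1}"
    and "determinantal_process \<mu> K P"
    and "B \<in> sets borel" and "bounded B"
    and "orthogonal_projection \<mu> Q"
    and "\<forall>f\<in>L2 \<mu>. AE x in \<mu>. x \<in> B \<longrightarrow> Q f x = 0"
    and "locally_trace_class \<mu> (Q \<circ> K \<circ> Q)"
    and "admissible_kernel \<mu> K E0 k"
    and "admissible_kernel \<mu> ((Q + chi B) \<circ> K \<circ> (Q + chi B)) E1 k1"
  shows "AE X in P.
           op_eq \<mu> (conditional_op \<mu> E1 k1 X B)
                   ((Q + chi B) \<circ> conditional_op \<mu> E0 k X B \<circ> (Q + chi B)) \<and>
           op_eq \<mu> ((Q + chi B) \<circ> conditional_op \<mu> E0 k X B \<circ> (Q + chi B))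
                   (Q \<circ> conditional_op \<mu> E0 k X B \<circ> Q)"
proof -
  interpret radon_space \<mu> by (intro radon_space.intro radon_space_axioms.intro assms)
  have Q: "self_adjoint_op \<mu> Q" using assms(9) by (simp add: orthogonal_projection_def)
  have W: "self_adjoint_op \<mu> (Q + chi B)" by (intro self_adjoint_op_plus Q self_adjoint_chi assms)
  have rs: "radon_space \<mu>" by (rule radon_space_axioms)
  interpret compression \<mu> K E0 k P "(Q + chi B) \<circ> K \<circ> (Q + chi B)" E1 k1 "Q + chi B" B
  proof (unfold_locales)
    show "positive_op \<mu> K" by (rule positive_op_of_spectrum[OF assms(3,5)])
    show "self_adjoint_op \<mu> ((Q + chi B) \<circ> K \<circ> (Q + chi B))"
      by (rule self_adjoint_op_sandwich[OF W assms(3)])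
    show "AE x in \<mu>. x \<in> B \<longrightarrow> (Q + chi B) f x = f x" if "f \<in> L2 \<mu>" for f
      using assms(10)[rule_format, OF that] by eventually_elim (auto simp: chi_def mult_op_def)
    show "AE x in \<mu>. (Q + chi B) (chi B f) x = chi B f x" if "f \<in> L2 \<mu>" for f
      using projection_chi[OF rs assms(9,7,10) that]
      by eventually_elim (auto simp: chi_def mult_op_def indicator_def)
  qed (rule assms W op_eq_refl)+
  show ?thesis
    using conditional_op_compressed by eventually_elim (simp add: conditional_op_plus_chi)
qed

end
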